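(* Let $R,I,(M,m),(K,k),\mathfrak a,\alpha,\beta$ be as described in the context, let $r\in R$, let $F=F(\alpha,r)$ be the big from small complex described in the context, let $X:\bigwedge^2M_1\to M_2$ and $X^t:M_1\otimes M_2\to M_3$ be the maps described in the context, and let $\eta\in M_4$ be the element with $[\eta]_M=1$. Then $F(\alpha,r)$ admits the structure of a commutative associative DG $R$-algebra exhibiting Poincaré duality via the following multiplication (here $F_0=R$ acts by scalar multiplication with $1\in R$ the unit, and the products $F_j\otimes F_i\to F_{i+j}$ for $j>i$ not listed are determined by $x_ix_j=(-1)^{ij}x_jx_i$; products landing in degree $>4$ are $0$). $F_1\otimes F_1\to F_2$: $$\begin{pmatrix}\phi_1\\ \theta_1\end{pmatrix}\begin{pmatrix}\phi_1'\\ \theta_1'\end{pmatrix}=\begin{pmatrix}\phi_1\phi_1'\\ -\alpha_1(\phi_1)\theta_1'-\theta_1\alpha_1(\phi_1')-r\,\theta_1\theta_1'+X(\theta_1\wedge\theta_1')\\ m_1(\theta_1)\phi_1'-m_1(\theta_1')\phi_1+\beta_2(\theta_1\theta_1')\end{pmatrix}.$$ $F_1\otimes F_2\to F_3$: $$\begin{pmatrix}\phi_1\\ \theta_1\end{pmatrix}\begin{pmatrix}\phi_2\\ \theta_2\\ \phi_1'\end{pmatrix}=\begin{pmatrix}\theta_1\alpha_2(\phi_2)-[\phi_1\phi_2]_K\,m_4(\eta)-\alpha_1(\phi_1)\theta_2-r\,\theta_1\theta_2+X^t(\theta_1\otimes\theta_2)\\ \phi_1\phi_1'-m_1(\theta_1)\phi_2-\beta_3(\theta_1\theta_2)\end{pmatrix}.$$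 $F_1\otimes F_3\to F_4$: $$\begin{pmatrix}\phi_1\\ \theta_1\end{pmatrix}\begin{pmatrix}\theta_3\\ \phi_2\end{pmatrix}=[\phi_1\phi_2]_K\,\eta-\theta_1\theta_3.$$ $F_2\otimes F_2\to F_4$: $$\begin{pmatrix}\phi_2\\ \theta_2\\ \phi_1\end{pmatrix}\begin{pmatrix}\phi_2'\\ \theta_2'\\ \phi_1'\end{pmatrix}=[\phi_2\phi_1']_K\,\eta+[\phi_1\phi_2']_K\,\eta-\theta_2\theta_2'.$$ Here $\phi_i,\phi_i'\in K_i$ and $\theta_i,\theta_i'\in M_i$.
   Context: **DG algebras.** $R$ is a commutative Noetherian ring. A DG $R$-algebra $(F,d)$ is a complex of finitely generated free $R$-modules in nonnegative degrees with a unitary associative multiplication satisfying: $F_iF_j\subseteq F_{i+j}$; $d(x_ix_j)=d(x_i)x_j+(-1)^ix_id(x_j)$; $x_ix_j=(-1)^{ij}x_jx_i$; $x_i^2=0$ for $i$ odd ($x_k\in F_k$). It is a DG$\Gamma$ $R$-algebra if moreover for each positive even $i$ every $x_i\in F_i$ has divided powers $x_i^{(k)}\in F_{ik}$ satisfying the usual divided power axioms and $d(x_i^{(k)})=d(x_i)x_i^{(k-1)}$. It exhibits Poincaré duality if there is an $m$ with $F_i=0$ for $i>m$, $F_m\cong R$, and all multiplication maps $F_i\otimes F_{m-i}\to F_m$ are perfect pairings. An orientation isomorphism is a chosen isomorphism $[-]_F:F_m\to R$. **Setup.** $I\subset R$ is a grade $4$ Gorenstein ideal (i.e. perfect of grade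 4 with $\operatorname{Ext}^4_R(R/I,R)\cong R/I$), and $(M,m):0\to M_4\to M_3\to M_2\to M_1\to M_0=R$ is a resolution of $R/I$ by finitely generated free modules that is a DG$\Gamma$ $R$-algebra exhibiting Poincaré duality. $(K,k)$ is the Koszul complex on a regular sequence of length $3$ (so $K_i=\bigwedge^iK_1$, $\operatorname{rank}K_1=3$, product = exterior product), resolving $R/\mathfrak a$, with $\mathfrak a\subseteq I$. There is a decomposition $M_1=M_{1,1}\oplus M_{1,2}$ with $\operatorname{rank}M_{1,1}=3$ and $m_1(M_{1,1})=\mathfrak a$. $\alpha_0:K_0=R\to M_0=R$ is the identity; $\alpha_1:K_1\to M_1$ has image in $M_{1,1}$ (zero $M_{1,2}$-component), satisfies $m_1\alpha_1=k_1$, and $\alpha_1(K_1)=M_{1,1}$, so $M_1=\alpha_1(K_1)\oplus M_{1,2}$. $\alpha:K\to M$ is the homomorphism of DG algebras extending $\alpha_0,\alpha_1$. Orientation isomorphisms $[-]_K:K_3\to R$, $[-]_M:M_4\to R$ are fixed. The maps $\beta_i:M_i\to K_{i-1}$ are defined by $[\beta_i(\theta_i)\cdot\phi_{4-i}]_K=(-1)^{i+1}[\theta_i\,\alpha_{4-i}(\phi_{4-i})]_M$ for all $\theta_i\in M_i$, $\phi_{4-i}\in K_{4-i}$. ($\beta_4$ is an isomorphism.) **Big from small complex** $(F(\alpha,r),f)$: $F_0=R$, $F_1=K_1\oplus M_1$, $F_2=K_2\oplus M_2\oplus K_1$, $F_3=M_3\oplus K_2$, $F_4=M_4$, with $$f_1=\begin{pmatrix}k_1&\beta_1+r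 m_1\end{pmatrix},\quad f_2=\begin{pmatrix}k_2&\beta_2&r\\0&-m_2&-\alpha_1\end{pmatrix},\quad f_3=\begin{pmatrix}\beta_3&-r\\-m_3&-\alpha_2\\0&k_2\end{pmatrix},\quad f_4=\begin{pmatrix}\alpha_3\beta_4-r m_4\\-k_3\beta_4\end{pmatrix}.$$ **The complex $B$ and the map $c$.** $B:B_5\to B_4\to B_3\to B_2\to B_1\to B_0$ has $B_0=M_0$, $B_1=M_1$, $B_2=\bigwedge^2M_1\oplus M_2$, $B_3=\bigwedge^3M_1\oplus(M_1\otimes M_2)\oplus M_3$, $B_4=(\bigwedge^2M_1\otimes M_2)\oplus D_2M_2\oplus(M_1\otimes M_3)$, $B_5=(M_1\otimes D_2M_2)\oplus(\bigwedge^2M_1\otimes M_3)$ ($D_2$ = second divided power), and differential $d$ obtained from $m_1,m_2,m_3$ by the graded Leibniz rule, where $M_1$-factors multiply by exterior multiplication, scalars $m_1(\theta_1)\in R$ multiply as scalars, and $d(\theta_2^{(2)})=m_2(\theta_2)\otimes\theta_2$. (E.g. $d(\theta_1\otimes\theta_2)=m_1(\theta_1)\theta_2-\theta_1\wedge m_2(\theta_2)$.) The morphism of complexes $c$, with $c_i:B_i\to K_{i-2}$, is: $c_0=c_1=c_2=0$; $c_3$ is zero on $M_1\otimes M_2$ and $M_3$, and $c_3(\theta_1\wedge\theta_1'\wedge\theta_1'')=\beta_2(\theta_1\theta_1')\beta_1(\theta_1'')-\beta_2(\theta_1\theta_1'')\beta_1(\theta_1')+\beta_2(\theta_1'\theta_1'')\beta_1(\theta_1)$;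 $c_4$ is zero on $D_2M_2$ and $M_1\otimes M_3$, and $c_4(\theta_1\wedge\theta_1'\otimes\theta_2)=\beta_1(\theta_1')\beta_3(\theta_1\theta_2)-\beta_1(\theta_1)\beta_3(\theta_1'\theta_2)-\beta_2(\theta_1\theta_1')\beta_2(\theta_2)$; $c_5(\theta_1\otimes\theta_2^{(2)})=\beta_1(\theta_1)\beta_4(\theta_2^{(2)})-\beta_3(\theta_1\theta_2)\beta_2(\theta_2)$ and $c_5(\theta_1'\wedge\theta_1''\otimes\theta_3)=-\beta_1(\theta_1'')\beta_4(\theta_1'\theta_3)+\beta_1(\theta_1')\beta_4(\theta_1''\theta_3)+\beta_2(\theta_1'\theta_1'')\beta_3(\theta_3)$. **The homotopy.** $h$ is a homotopy, $h_i:B_i\to K_{i-1}$ with $c_i=k_{i-1}h_i+h_{i-1}d_i$, chosen so that: (1) $h$ is zero on the summands $M_0,M_1,M_2,M_3,\bigwedge^2M_1,M_1\otimes M_2,D_2M_2,M_1\otimes M_3$; (2) $h_3(\bigwedge^2M_1\wedge\alpha_1(K_1))=0$; (3) $h_4(M_1\wedge\alpha_1(K_1)\otimes M_2)=0$; (4) $h_4(\bigwedge^2M_1\otimes\alpha_2(K_2))=0$; (5) $h_4(\theta_1\wedge\theta_1'\otimes\alpha_1(\phi_1)\theta_1)=0$; (6) $h_4(\theta_1\wedge\theta_1'\otimes\alpha_1(\phi_1)\theta_1''+\theta_1''\wedge\theta_1'\otimes\alpha_1(\phi_1)\theta_1)=0$, for all $\theta_1,\theta_1',\theta_1''\in M_1$,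 $\phi_1\in K_1$. Such a homotopy exists; fix one. **The maps $X,X^t$.** Via Poincaré duality of $M$, $X:\bigwedge^2M_1\to M_2$ and $X^t:M_1\otimes M_2\to M_3$ are defined by $$X(\theta_1\wedge\theta_1')\cdot\theta_2=(\beta_4^{-1}\circ h_4)(\theta_1\wedge\theta_1'\otimes\theta_2)=\theta_1\cdot X^t(\theta_1'\otimes\theta_2)\qquad(\theta_1,\theta_1'\in M_1,\ \theta_2\in M_2).$$ *)

theory Defs
  imports Complex_Main "HOL-Library.Poly_Mapping" "HOL-Library.Function_Algebras" "HOL-Library.Product_Plus"
begin

text \<open>
  The base ring is a type \<open>'r :: comm_ring_1\<close>. An \<open>'r\<close>-module is an abelian group type
  together with a scalar multiplication satisfying \<^locale>\<open>module\<close>; the ring itself is the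
  module with scalar multiplication \<open>(*)\<close>, so that ideals are its submodules. Linear maps
  are given by \<^locale>\<open>module_hom\<close>.
\<close>

section \<open>Modules\<close>

definition prod_scale ::
    "('r \<Rightarrow> 'a \<Rightarrow> 'a) \<Rightarrow> ('r \<Rightarrow> 'b \<Rightarrow> 'b) \<Rightarrow> 'r \<Rightarrow> 'a \<times> 'b \<Rightarrow> 'a \<times> 'b" (infixr \<open>\<oplus>\<^sub>s\<close> 65)
  where "(s \<oplus>\<^sub>s t) a = map_prod (s a) (t a)"

definition linear_on ::
    "('r \<Rightarrow> 'a::plus \<Rightarrow> 'a) \<Rightarrow> ('r \<Rightarrow> 'b::plus \<Rightarrow> 'b) \<Rightarrow> 'a set \<Rightarrow> 'b set \<Rightarrow> ('a \<Rightarrow> 'b) \<Rightarrow> bool"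
  where "linear_on s t V W g \<longleftrightarrow>
    (\<forall>x\<in>V. g x \<in> W) \<and> (\<forall>x\<in>V. \<forall>y\<in>V. g (x + y) = g x + g y) \<and>
    (\<forall>a. \<forall>x\<in>V. g (s a x) = t a (g x))"

definition bilinear_map ::
    "('r::comm_ring_1 \<Rightarrow> 'a::ab_group_add \<Rightarrow> 'a) \<Rightarrow> ('r \<Rightarrow> 'b::ab_group_add \<Rightarrow> 'b) \<Rightarrow>
     ('r \<Rightarrow> 'c::ab_group_add \<Rightarrow> 'c) \<Rightarrow> ('a \<Rightarrow> 'b \<Rightarrow> 'c) \<Rightarrow> bool"
  where "bilinear_map s t u f \<longleftrightarrow>
    (\<forall>x. module_hom t u (\<lambda>y. f x y)) \<and> (\<forall>y. module_hom s u (\<lambda>x. f x y))"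

definition has_basis ::
    "('r::comm_ring_1 \<Rightarrow> 'a::ab_group_add \<Rightarrow> 'a) \<Rightarrow> 'a set \<Rightarrow> 'a set \<Rightarrow> bool"
  where "has_basis s V B \<longleftrightarrow> \<not> module.dependent s B \<and> module.span s B = V"

definition fg_free :: "('r::comm_ring_1 \<Rightarrow> 'a::ab_group_add \<Rightarrow> 'a) \<Rightarrow> 'a set \<Rightarrow> bool"
  where "fg_free s V \<longleftrightarrow> (\<exists>B. finite B \<and> has_basis s V B)"

definition free_of_rank :: "('r::comm_ring_1 \<Rightarrow> 'a::ab_group_add \<Rightarrow> 'a) \<Rightarrow> 'a set \<Rightarrow> nat \<Rightarrow> bool"
  where "free_of_rank s V n \<longleftrightarrow> (\<exists>B. finite B \<and> card B = n \<and> has_basis s V B)"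

definition direct_sum_decomp ::
    "('r::comm_ring_1 \<Rightarrow> 'a::ab_group_add \<Rightarrow> 'a) \<Rightarrow> 'a set \<Rightarrow> 'a set \<Rightarrow> 'a set \<Rightarrow> bool"
  where "direct_sum_decomp s V P Q \<longleftrightarrow>
    module.subspace s P \<and> module.subspace s Q \<and> P \<inter> Q = {0} \<and> {x + y | x y. x \<in> P \<and> y \<in> Q} = V"

definition coset :: "'a::plus set \<Rightarrow> 'a \<Rightarrow> 'a set"
  where "coset N x = (\<lambda>n. x + n) ` N"

text \<open>An isomorphism of quotient modules \<open>V/N \<cong> W/Q\<close>.\<close>

definition quotients_isomorphic ::
    "('r \<Rightarrow> 'a::ab_group_add \<Rightarrow> 'a) \<Rightarrow> 'a set \<Rightarrow> 'a set \<Rightarrow>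
     ('r \<Rightarrow> 'b::ab_group_add \<Rightarrow> 'b) \<Rightarrow> 'b set \<Rightarrow> 'b set \<Rightarrow> bool"
  where "quotients_isomorphic s V N t W Q \<longleftrightarrow>
    (\<exists>g. bij_betw g (coset N ` V) (coset Q ` W) \<and>
      (\<forall>x\<in>V. \<forall>y\<in>V. \<forall>x'\<in>W. \<forall>y'\<in>W.
         g (coset N x) = coset Q x' \<longrightarrow> g (coset N y) = coset Q y' \<longrightarrow>
         g (coset N (x + y)) = coset Q (x' + y')) \<and>
      (\<forall>a. \<forall>x\<in>V. \<forall>x'\<in>W.
         g (coset N x) = coset Q x' \<longrightarrow> g (coset N (s a x)) = coset Q (t a x')))"

section \<open>Tensor products, exterior powers and divided powers\<close>

text \<open>
  These modules are characterised by their standard presentation: \<open>presented s gen Rel\<close> says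
  that the linear map from the free module on the generators (the finitely supported functions
  \<open>'g \<Rightarrow>\<^sub>0 'r\<close>) determined by \<open>gen\<close> is surjective with kernel the submodule spanned by the
  relations \<open>Rel\<close>. This determines the module with its generators up to unique isomorphism.
\<close>

definition free_scale :: "'r::comm_ring_1 \<Rightarrow> ('g \<Rightarrow>\<^sub>0 'r) \<Rightarrow> ('g \<Rightarrow>\<^sub>0 'r)"
  where "free_scale a c = Poly_Mapping.map (\<lambda>b. a * b) c"

definition lincomb ::
    "('r::comm_ring_1 \<Rightarrow> 't::ab_group_add \<Rightarrow> 't) \<Rightarrow> ('g \<Rightarrow> 't) \<Rightarrow> ('g \<Rightarrow>\<^sub>0 'r) \<Rightarrow> 't"
  where "lincomb s gen c = (\<Sum>g\<in>Poly_Mapping.keys c. s (Poly_Mapping.lookup c g) (gen g))"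

definition presented ::
    "('r::comm_ring_1 \<Rightarrow> 't::ab_group_add \<Rightarrow> 't) \<Rightarrow> ('g \<Rightarrow> 't) \<Rightarrow> ('g \<Rightarrow>\<^sub>0 'r) set \<Rightarrow> bool"
  where "presented s gen Rel \<longleftrightarrow> module s \<and>
    (\<forall>x. \<exists>c. x = lincomb s gen c) \<and>
    (\<forall>c. lincomb s gen c = 0 \<longleftrightarrow> c \<in> module.span free_scale Rel)"

definition free_gen :: "'g \<Rightarrow> ('g \<Rightarrow>\<^sub>0 'r::comm_ring_1)"
  where "free_gen g = Poly_Mapping.single g 1"

text \<open>
  The elements expressing linearity, in one argument, of the map \<open>p\<close> into a free module.
\<close>

definition linearity_rels ::
    "('r::comm_ring_1 \<Rightarrow> 'a::ab_group_add \<Rightarrow> 'a) \<Rightarrow> ('a \<Rightarrow> ('g \<Rightarrow>\<^sub>0 'r)) \<Rightarrow> ('g \<Rightarrow>\<^sub>0 'r) set"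
  where "linearity_rels s p =
    {p (x + y) - p x - p y | x y. True} \<union> {p (s a x) - free_scale a (p x) | a x. True}"

definition is_tensor_product ::
    "('r::comm_ring_1 \<Rightarrow> 'a::ab_group_add \<Rightarrow> 'a) \<Rightarrow> ('r \<Rightarrow> 'b::ab_group_add \<Rightarrow> 'b) \<Rightarrow>
     ('r \<Rightarrow> 't::ab_group_add \<Rightarrow> 't) \<Rightarrow> ('a \<Rightarrow> 'b \<Rightarrow> 't) \<Rightarrow> bool"
  where "is_tensor_product s t u tens \<longleftrightarrow> presented u (\<lambda>(x, y). tens x y)
    ((\<Union>y. linearity_rels s (\<lambda>x. free_gen (x, y))) \<union> (\<Union>x. linearity_rels t (\<lambda>y. free_gen (x, y))))"

definition is_exterior_square ::
    "('r::comm_ring_1 \<Rightarrow> 'a::ab_group_add \<Rightarrow> 'a) \<Rightarrow> ('r \<Rightarrow> 't::ab_group_add \<Rightarrow> 't) \<Rightarrow>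
     ('a \<Rightarrow> 'a \<Rightarrow> 't) \<Rightarrow> bool"
  where "is_exterior_square s u wedge \<longleftrightarrow> presented u (\<lambda>(x, y). wedge x y)
    ((\<Union>y. linearity_rels s (\<lambda>x. free_gen (x, y))) \<union> (\<Union>x. linearity_rels s (\<lambda>y. free_gen (x, y))) \<union>
     {free_gen (x, x) | x. True})"

definition is_exterior_cube ::
    "('r::comm_ring_1 \<Rightarrow> 'a::ab_group_add \<Rightarrow> 'a) \<Rightarrow> ('r \<Rightarrow> 't::ab_group_add \<Rightarrow> 't) \<Rightarrow>
     ('a \<Rightarrow> 'a \<Rightarrow> 'a \<Rightarrow> 't) \<Rightarrow> bool"
  where "is_exterior_cube s u wedge \<longleftrightarrow> presented u (\<lambda>(x, y, z). wedge x y z)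
    ((\<Union>y z. linearity_rels s (\<lambda>x. free_gen (x, y, z))) \<union>
     (\<Union>x z. linearity_rels s (\<lambda>y. free_gen (x, y, z))) \<union>
     (\<Union>x y. linearity_rels s (\<lambda>z. free_gen (x, y, z))) \<union>
     {free_gen (x, y, z) | x y z. x = y \<or> x = z \<or> y = z})"

text \<open>
  The second divided power \<open>D\<^sub>2\<close>, generated by the \<open>x\<^sup>(\<^sup>2\<^sup>)\<close>. The product \<open>x y\<close> in \<open>D\<^sub>2\<close> is
  \<open>(x + y)\<^sup>(\<^sup>2\<^sup>) - x\<^sup>(\<^sup>2\<^sup>) - y\<^sup>(\<^sup>2\<^sup>)\<close>; the relations are \<open>(a x)\<^sup>(\<^sup>2\<^sup>) = a\<^sup>2 x\<^sup>(\<^sup>2\<^sup>)\<close> and the bilinearity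
  of the product.
\<close>

definition is_divided_square ::
    "('r::comm_ring_1 \<Rightarrow> 'a::ab_group_add \<Rightarrow> 'a) \<Rightarrow> ('r \<Rightarrow> 't::ab_group_add \<Rightarrow> 't) \<Rightarrow> ('a \<Rightarrow> 't) \<Rightarrow> bool"
  where "is_divided_square s u dp \<longleftrightarrow> presented u dp
    ({free_gen (s a x) - free_scale (a\<^sup>2) (free_gen x) | a x. True} \<union>
     (\<Union>y. linearity_rels s (\<lambda>x. free_gen (x + y) - free_gen x - free_gen y)))"

section \<open>Ideals, grade and perfection\<close>

definition is_ideal :: "'r::comm_ring_1 set \<Rightarrow> bool"
  where "is_ideal J \<longleftrightarrow> module.subspace (*) J"

definition ideal_generated :: "'r::comm_ring_1 set \<Rightarrow> 'r set"
  where "ideal_generated A = module.span (*) A"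

definition noetherian_ring :: "'r::comm_ring_1 itself \<Rightarrow> bool"
  where "noetherian_ring (_ :: 'r itself) \<longleftrightarrow>
    (\<forall>J :: 'r set. is_ideal J \<longrightarrow> (\<exists>A. finite A \<and> J = ideal_generated A))"

definition regular_sequence :: "'r::comm_ring_1 list \<Rightarrow> bool"
  where "regular_sequence xs \<longleftrightarrow>
    (\<forall>i<length xs. \<forall>a. xs ! i * a \<in> ideal_generated (set (take i xs)) \<longrightarrow>
       a \<in> ideal_generated (set (take i xs))) \<and>
    ideal_generated (set xs) \<noteq> UNIV"

definition has_grade :: "'r::comm_ring_1 set \<Rightarrow> nat \<Rightarrow> bool"
  where "has_grade I g \<longleftrightarrow> is_ideal I \<and> I \<noteq> UNIV \<and>
    (\<exists>xs. regular_sequence xs \<and> set xs \<subseteq> I \<and> length xs = g) \<and>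
    (\<forall>xs. regular_sequence xs \<and> set xs \<subseteq> I \<longrightarrow> length xs \<le> g)"

text \<open>
  Finitely generated projective modules are represented as direct summands of some \<open>R\<^sup>N\<close>, the
  latter being the functions \<open>nat \<Rightarrow> 'r\<close> vanishing from \<open>N\<close> on. Over a Noetherian ring these
  suffice to compute the projective dimension of the finitely generated module \<open>R/I\<close>.
\<close>

definition fun_scale :: "'r::comm_ring_1 \<Rightarrow> ('i \<Rightarrow> 'r) \<Rightarrow> ('i \<Rightarrow> 'r)"
  where "fun_scale a v = (\<lambda>i. a * v i)"

definition fg_projective :: "(nat \<Rightarrow> 'r::comm_ring_1) set \<Rightarrow> bool"
  where "fg_projective P \<longleftrightarrow> (\<exists>N Q. direct_sum_decomp fun_scale {v. \<forall>i\<ge>N. v i = 0} P Q)"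

text \<open>
  A projective resolution \<open>0 \<rightarrow> P\<^sub>n \<rightarrow> \<dots> \<rightarrow> P\<^sub>0 \<rightarrow> R/I \<rightarrow> 0\<close>; the augmentation is given by a linear
  lift \<open>\<epsilon> : P\<^sub>0 \<rightarrow> R\<close>, which exists because \<open>P\<^sub>0\<close> is projective.
\<close>

definition quotient_pd_le :: "'r::comm_ring_1 set \<Rightarrow> nat \<Rightarrow> bool"
  where "quotient_pd_le I n \<longleftrightarrow>
    (\<exists>P :: nat \<Rightarrow> (nat \<Rightarrow> 'r) set. \<exists>\<delta> \<epsilon>.
      (\<forall>i. fg_projective (P i)) \<and> (\<forall>i>n. P i = {0}) \<and>
      (\<forall>i. linear_on fun_scale fun_scale (P (Suc i)) (P i) (\<delta> (Suc i))) \<and>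
      linear_on fun_scale (*) (P 0) UNIV \<epsilon> \<and>
      (\<forall>b. \<exists>x\<in>P 0. b - \<epsilon> x \<in> I) \<and>
      \<delta> (Suc 0) ` P (Suc 0) = {x \<in> P 0. \<epsilon> x \<in> I} \<and>
      (\<forall>i. \<delta> (Suc (Suc i)) ` P (Suc (Suc i)) = {x \<in> P (Suc i). \<delta> (Suc i) x = 0}))"

definition perfect_of_grade :: "'r::comm_ring_1 set \<Rightarrow> nat \<Rightarrow> bool"
  where "perfect_of_grade I g \<longleftrightarrow> has_grade I g \<and>
    quotient_pd_le I g \<and> (\<forall>n<g. \<not> quotient_pd_le I n)"

section \<open>DG algebras\<close>

text \<open>
  A DG algebra is given by its total module, the graded pieces \<open>F i\<close> of which it is the internal
  direct sum, the differential and the multiplication.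
\<close>

locale dg_algebra = module scale
  for scale :: "'r::comm_ring_1 \<Rightarrow> 'x::ab_group_add \<Rightarrow> 'x" +
  fixes F :: "nat \<Rightarrow> 'x set" and d :: "'x \<Rightarrow> 'x" and mult :: "'x \<Rightarrow> 'x \<Rightarrow> 'x" and unit :: 'x
  assumes pieces: "fg_free scale (F i)"
    and direct_sum: "\<exists>!c. (\<forall>i. c i \<in> F i) \<and> finite {i. c i \<noteq> 0} \<and> x = (\<Sum>i | c i \<noteq> 0. c i)"
    and d_linear: "module_hom scale scale d"
    and d_degree_0: "x \<in> F 0 \<Longrightarrow> d x = 0"
    and d_degree: "x \<in> F (Suc i) \<Longrightarrow> d x \<in> F i"
    and d_d: "d (d x) = 0"
    and mult_bilinear: "bilinear_map scale scale scale mult"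
    and mult_degree: "x \<in> F i \<Longrightarrow> y \<in> F j \<Longrightarrow> mult x y \<in> F (i + j)"
    and unit_degree: "unit \<in> F 0"
    and unit_left: "mult unit x = x"
    and unit_right: "mult x unit = x"
    and mult_assoc: "mult (mult x y) z = mult x (mult y z)"
    and leibniz: "x \<in> F i \<Longrightarrow> y \<in> F j \<Longrightarrow>
      d (mult x y) = mult (d x) y + scale ((-1) ^ i) (mult x (d y))"
    and mult_commute: "x \<in> F i \<Longrightarrow> y \<in> F j \<Longrightarrow> mult x y = scale ((-1) ^ (i * j)) (mult y x)"
    and odd_square: "odd i \<Longrightarrow> x \<in> F i \<Longrightarrow> mult x x = 0"

text \<open>
  \<open>dpow k x\<close> is the divided power \<open>x\<^sup>(\<^sup>k\<^sup>)\<close>; it is only meaningful for homogeneous \<open>x\<close> of positive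
  even degree.
\<close>

locale dg_gamma_algebra = dg_algebra scale F d mult unit
  for scale :: "'r::comm_ring_1 \<Rightarrow> 'x::ab_group_add \<Rightarrow> 'x"
    and F :: "nat \<Rightarrow> 'x set" and d :: "'x \<Rightarrow> 'x" and mult :: "'x \<Rightarrow> 'x \<Rightarrow> 'x" and unit :: 'x +
  fixes dpow :: "nat \<Rightarrow> 'x \<Rightarrow> 'x"
  assumes dpow_degree: "0 < i \<Longrightarrow> even i \<Longrightarrow> x \<in> F i \<Longrightarrow> dpow k x \<in> F (i * k)"
    and dpow_0: "0 < i \<Longrightarrow> even i \<Longrightarrow> x \<in> F i \<Longrightarrow> dpow 0 x = unit"
    and dpow_1: "0 < i \<Longrightarrow> even i \<Longrightarrow> x \<in> F i \<Longrightarrow> dpow 1 x = x"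
    and dpow_mult: "0 < i \<Longrightarrow> even i \<Longrightarrow> x \<in> F i \<Longrightarrow>
      mult (dpow p x) (dpow q x) = scale (of_nat ((p + q) choose p)) (dpow (p + q) x)"
    and dpow_add: "0 < i \<Longrightarrow> even i \<Longrightarrow> x \<in> F i \<Longrightarrow> y \<in> F i \<Longrightarrow>
      dpow k (x + y) = (\<Sum>j\<le>k. mult (dpow j x) (dpow (k - j) y))"
    and dpow_product_odd: "odd i \<Longrightarrow> odd j \<Longrightarrow> x \<in> F i \<Longrightarrow> y \<in> F j \<Longrightarrow> 2 \<le> k \<Longrightarrow>
      dpow k (mult x y) = 0"
    and dpow_product_even: "even i \<Longrightarrow> even j \<Longrightarrow> 0 < j \<Longrightarrow> x \<in> F i \<Longrightarrow> y \<in> F j \<Longrightarrow>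
      dpow k (mult x y) = mult ((mult x ^^ k) unit) (dpow k y)"
    and dpow_dpow: "0 < i \<Longrightarrow> even i \<Longrightarrow> x \<in> F i \<Longrightarrow> 0 < p \<Longrightarrow>
      dpow q (dpow p x) = scale (of_nat (fact (p * q) div (fact q * fact p ^ q))) (dpow (p * q) x)"
    and dpow_d: "0 < i \<Longrightarrow> even i \<Longrightarrow> x \<in> F i \<Longrightarrow> 0 < k \<Longrightarrow>
      d (dpow k x) = mult (d x) (dpow (k - 1) x)"

definition perfect_pairing_on ::
    "('r \<Rightarrow> 'x::plus \<Rightarrow> 'x) \<Rightarrow> 'x set \<Rightarrow> 'x set \<Rightarrow> 'x set \<Rightarrow> ('x \<Rightarrow> 'x \<Rightarrow> 'x) \<Rightarrow> bool"
  where "perfect_pairing_on s V W U mult \<longleftrightarrow>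
    (\<forall>g. linear_on s s W U g \<longrightarrow> (\<exists>!x. x \<in> V \<and> (\<forall>y\<in>W. mult x y = g y))) \<and>
    (\<forall>g. linear_on s s V U g \<longrightarrow> (\<exists>!y. y \<in> W \<and> (\<forall>x\<in>V. mult x y = g x)))"

definition exhibits_poincare_duality ::
    "('r::comm_ring_1 \<Rightarrow> 'x::ab_group_add \<Rightarrow> 'x) \<Rightarrow> (nat \<Rightarrow> 'x set) \<Rightarrow> ('x \<Rightarrow> 'x \<Rightarrow> 'x) \<Rightarrow> bool"
  where "exhibits_poincare_duality s F mult \<longleftrightarrow>
    (\<exists>m. (\<forall>i>m. F i = {0}) \<and>
      (\<exists>\<phi>. linear_on s (*) (F m) (UNIV :: 'r set) \<phi> \<and> bij_betw \<phi> (F m) UNIV) \<and>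
      (\<forall>i\<le>m. perfect_pairing_on s (F i) (F (m - i)) (F m) mult))"

definition dg_algebra_hom ::
    "('r::comm_ring_1 \<Rightarrow> 'x::ab_group_add \<Rightarrow> 'x) \<Rightarrow> (nat \<Rightarrow> 'x set) \<Rightarrow> ('x \<Rightarrow> 'x) \<Rightarrow> ('x \<Rightarrow> 'x \<Rightarrow> 'x) \<Rightarrow> 'x \<Rightarrow>
     ('r \<Rightarrow> 'y::ab_group_add \<Rightarrow> 'y) \<Rightarrow> (nat \<Rightarrow> 'y set) \<Rightarrow> ('y \<Rightarrow> 'y) \<Rightarrow> ('y \<Rightarrow> 'y \<Rightarrow> 'y) \<Rightarrow> 'y \<Rightarrow>
     ('x \<Rightarrow> 'y) \<Rightarrow> bool"
  where "dg_algebra_hom s F d mult unit s' F' d' mult' unit' f \<longleftrightarrow>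
    module_hom s s' f \<and> (\<forall>i. f ` F i \<subseteq> F' i) \<and> (\<forall>x. f (d x) = d' (f x)) \<and>
    (\<forall>x y. f (mult x y) = mult' (f x) (f y)) \<and> f unit = unit'"

section \<open>Algebras of length three and four given degree by degree\<close>

text \<open>
  Data of an algebra with degree \<open>0\<close> piece \<open>R\<close> and pieces of degrees \<open>1,\<dots>,3\<close>, respectively
  \<open>1,\<dots>,4\<close>: scalar multiplications \<open>sc\<^sub>i\<close>, differentials \<open>df\<^sub>i\<close> from degree \<open>i\<close> to degree \<open>i - 1\<close>
  and products \<open>mu\<^sub>i\<^sub>j\<close> of elements of degrees \<open>i \<le> j\<close>. Elements of \<open>R\<close> act by scalar multiplication, products
  for \<open>i > j\<close> are determined by graded commutativity, and all others are zero.
\<close>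

record ('r, 'a1, 'a2, 'a3) alg3 =
  sc1 :: "'r \<Rightarrow> 'a1 \<Rightarrow> 'a1"
  sc2 :: "'r \<Rightarrow> 'a2 \<Rightarrow> 'a2"
  sc3 :: "'r \<Rightarrow> 'a3 \<Rightarrow> 'a3"
  df1 :: "'a1 \<Rightarrow> 'r"
  df2 :: "'a2 \<Rightarrow> 'a1"
  df3 :: "'a3 \<Rightarrow> 'a2"
  mu11 :: "'a1 \<Rightarrow> 'a1 \<Rightarrow> 'a2"
  mu12 :: "'a1 \<Rightarrow> 'a2 \<Rightarrow> 'a3"

record ('r, 'a1, 'a2, 'a3, 'a4) alg4 = "('r, 'a1, 'a2, 'a3) alg3" +
  sc4 :: "'r \<Rightarrow> 'a4 \<Rightarrow> 'a4"
  df4 :: "'a4 \<Rightarrow> 'a3"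
  mu13 :: "'a1 \<Rightarrow> 'a3 \<Rightarrow> 'a4"
  mu22 :: "'a2 \<Rightarrow> 'a2 \<Rightarrow> 'a4"

definition mu21 :: "('r, 'a1, 'a2, 'a3, 'z) alg3_scheme \<Rightarrow> 'a2 \<Rightarrow> 'a1 \<Rightarrow> 'a3"
  where "mu21 A x y = mu12 A y x"

definition mu31 :: "('r, 'a1, 'a2, 'a3, 'a4::uminus) alg4 \<Rightarrow> 'a3 \<Rightarrow> 'a1 \<Rightarrow> 'a4"
  where "mu31 A x y = - mu13 A y x"

type_synonym ('r, 'a1, 'a2, 'a3) total3 = "'r \<times> 'a1 \<times> 'a2 \<times> 'a3"
type_synonym ('r, 'a1, 'a2, 'a3, 'a4) total4 = "'r \<times> 'a1 \<times> 'a2 \<times> 'a3 \<times> 'a4"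

definition piece3 :: "nat \<Rightarrow> ('r::zero, 'a1::zero, 'a2::zero, 'a3::zero) total3 set"
  where "piece3 n = {(a, x1, x2, x3).
    (n \<noteq> 0 \<longrightarrow> a = 0) \<and> (n \<noteq> 1 \<longrightarrow> x1 = 0) \<and> (n \<noteq> 2 \<longrightarrow> x2 = 0) \<and> (n \<noteq> 3 \<longrightarrow> x3 = 0)}"

definition piece4 :: "nat \<Rightarrow> ('r::zero, 'a1::zero, 'a2::zero, 'a3::zero, 'a4::zero) total4 set"
  where "piece4 n = {(a, x1, x2, x3, x4).
    (n \<noteq> 0 \<longrightarrow> a = 0) \<and> (n \<noteq> 1 \<longrightarrow> x1 = 0) \<and> (n \<noteq> 2 \<longrightarrow> x2 = 0) \<and> (n \<noteq> 3 \<longrightarrow> x3 = 0) \<and>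
    (n \<noteq> 4 \<longrightarrow> x4 = 0)}"

definition scale3 ::
    "('r::comm_ring_1, 'a1, 'a2, 'a3) alg3 \<Rightarrow> 'r \<Rightarrow>
     ('r, 'a1, 'a2, 'a3) total3 \<Rightarrow> ('r, 'a1, 'a2, 'a3) total3"
  where "scale3 A = (*) \<oplus>\<^sub>s sc1 A \<oplus>\<^sub>s sc2 A \<oplus>\<^sub>s sc3 A"

definition scale4 ::
    "('r::comm_ring_1, 'a1, 'a2, 'a3, 'a4) alg4 \<Rightarrow> 'r \<Rightarrow>
     ('r, 'a1, 'a2, 'a3, 'a4) total4 \<Rightarrow> ('r, 'a1, 'a2, 'a3, 'a4) total4"
  where "scale4 A = (*) \<oplus>\<^sub>s sc1 A \<oplus>\<^sub>s sc2 A \<oplus>\<^sub>s sc3 A \<oplus>\<^sub>s sc4 A"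

fun diff3 ::
    "('r, 'a1, 'a2, 'a3::zero) alg3 \<Rightarrow>
     ('r, 'a1, 'a2, 'a3) total3 \<Rightarrow> ('r, 'a1, 'a2, 'a3) total3"
  where "diff3 A (a, x1, x2, x3) = (df1 A x1, df2 A x2, df3 A x3, 0)"

fun diff4 ::
    "('r, 'a1, 'a2, 'a3, 'a4::zero) alg4 \<Rightarrow>
     ('r, 'a1, 'a2, 'a3, 'a4) total4 \<Rightarrow> ('r, 'a1, 'a2, 'a3, 'a4) total4"
  where "diff4 A (a, x1, x2, x3, x4) = (df1 A x1, df2 A x2, df3 A x3, df4 A x4, 0)"

fun mult3 ::
    "('r::comm_ring_1, 'a1::ab_group_add, 'a2::ab_group_add, 'a3::ab_group_add) alg3 \<Rightarrow>
     ('r, 'a1, 'a2, 'a3) total3 \<Rightarrow> ('r, 'a1, 'a2, 'a3) total3 \<Rightarrow> ('r, 'a1, 'a2, 'a3) total3"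
  where "mult3 A (a, x1, x2, x3) (b, y1, y2, y3) =
    (a * b,
     sc1 A a y1 + sc1 A b x1,
     sc2 A a y2 + mu11 A x1 y1 + sc2 A b x2,
     sc3 A a y3 + mu12 A x1 y2 + mu21 A x2 y1 + sc3 A b x3)"

fun mult4 ::
    "('r::comm_ring_1, 'a1::ab_group_add, 'a2::ab_group_add, 'a3::ab_group_add, 'a4::ab_group_add) alg4 \<Rightarrow>
     ('r, 'a1, 'a2, 'a3, 'a4) total4 \<Rightarrow> ('r, 'a1, 'a2, 'a3, 'a4) total4 \<Rightarrow> ('r, 'a1, 'a2, 'a3, 'a4) total4"
  where "mult4 A (a, x1, x2, x3, x4) (b, y1, y2, y3, y4) =
    (a * b,
     sc1 A a y1 + sc1 A b x1,
     sc2 A a y2 + mu11 A x1 y1 + sc2 A b x2,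
     sc3 A a y3 + mu12 A x1 y2 + mu21 A x2 y1 + sc3 A b x3,
     sc4 A a y4 + mu13 A x1 y3 + mu22 A x2 y2 + mu31 A x3 y1 + sc4 A b x4)"

abbreviation unit3 :: "('r::comm_ring_1, 'a1::zero, 'a2::zero, 'a3::zero) total3"
  where "unit3 \<equiv> (1, 0, 0, 0)"

abbreviation unit4 :: "('r::comm_ring_1, 'a1::zero, 'a2::zero, 'a3::zero, 'a4::zero) total4"
  where "unit4 \<equiv> (1, 0, 0, 0, 0)"

text \<open>
  In length four a divided power structure amounts to a single map \<open>\<gamma>\<close> from degree \<open>2\<close> to degree
  \<open>4\<close>, \<open>\<gamma> x = x\<^sup>(\<^sup>2\<^sup>)\<close>: all other divided powers of order at least \<open>2\<close> lie in degrees above \<open>4\<close>.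
\<close>

fun dpow4 ::
    "('a2 \<Rightarrow> 'a4) \<Rightarrow> nat \<Rightarrow> ('r::comm_ring_1, 'a1::zero, 'a2::zero, 'a3::zero, 'a4::zero) total4 \<Rightarrow>
     ('r, 'a1, 'a2, 'a3, 'a4) total4"
  where "dpow4 \<gamma> k (a, x1, x2, x3, x4) =
    (if k = 0 then unit4 else if k = 1 then (a, x1, x2, x3, x4)
     else if k = 2 then (0, 0, 0, 0, \<gamma> x2) else 0)"

definition is_dg_algebra4 ::
    "('r::comm_ring_1, 'a1::ab_group_add, 'a2::ab_group_add, 'a3::ab_group_add, 'a4::ab_group_add) alg4 \<Rightarrow> bool"
  where "is_dg_algebra4 A \<longleftrightarrow> dg_algebra (scale4 A) piece4 (diff4 A) (mult4 A) unit4"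

definition is_dg_gamma_algebra4 ::
    "('r::comm_ring_1, 'a1::ab_group_add, 'a2::ab_group_add, 'a3::ab_group_add, 'a4::ab_group_add) alg4 \<Rightarrow>
     ('a2 \<Rightarrow> 'a4) \<Rightarrow> bool"
  where "is_dg_gamma_algebra4 A \<gamma> \<longleftrightarrow>
    dg_gamma_algebra (scale4 A) piece4 (diff4 A) (mult4 A) unit4 (dpow4 \<gamma>)"

definition has_poincare_duality4 ::
    "('r::comm_ring_1, 'a1::ab_group_add, 'a2::ab_group_add, 'a3::ab_group_add, 'a4::ab_group_add) alg4 \<Rightarrow> bool"
  where "has_poincare_duality4 A \<longleftrightarrow> exhibits_poincare_duality (scale4 A) piece4 (mult4 A)"

section \<open>Gorenstein ideals and Koszul complexes\<close>

definition resolves_quotient ::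
    "('r::comm_ring_1, 'a1::ab_group_add, 'a2::ab_group_add, 'a3::ab_group_add, 'a4::ab_group_add) alg4 \<Rightarrow>
     'r set \<Rightarrow> bool"
  where "resolves_quotient M I \<longleftrightarrow>
    range (df1 M) = I \<and>
    range (df2 M) = {x. df1 M x = 0} \<and>
    range (df3 M) = {x. df2 M x = 0} \<and>
    range (df4 M) = {x. df3 M x = 0} \<and>
    inj (df4 M)"

text \<open>
  \<open>Ext\<^sup>4(R/I, R) \<cong> R/I\<close>, where \<open>Ext\<^sup>4(R/I, R)\<close> is the fourth cohomology \<open>Hom(M\<^sub>4, R) / Hom(M\<^sub>3, R) m\<^sub>4\<close>
  of the dual of the free resolution \<open>M\<close> of \<open>R/I\<close>.
\<close>

definition ext4_isomorphic_quotient ::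
    "('r::comm_ring_1, 'a1::ab_group_add, 'a2::ab_group_add, 'a3::ab_group_add, 'a4::ab_group_add) alg4 \<Rightarrow>
     'r set \<Rightarrow> bool"
  where "ext4_isomorphic_quotient M I \<longleftrightarrow>
    quotients_isomorphic
      fun_scale {u. module_hom (sc4 M) (*) u} {v \<circ> df4 M | v. module_hom (sc3 M) (*) v}
      (*) UNIV I"

definition koszul3 ::
    "('r::comm_ring_1, 'k1::ab_group_add, 'k2::ab_group_add, 'k3::ab_group_add) alg3 \<Rightarrow> 'r list \<Rightarrow> bool"
  where "koszul3 K xs \<longleftrightarrow> length xs = 3 \<and>
    module (sc1 K) \<and> module_hom (sc1 K) (*) (df1 K) \<and>
    (\<exists>e. inj_on e {..<3} \<and> has_basis (sc1 K) UNIV (e ` {..<3}) \<and> (\<forall>i<3. df1 K (e i) = xs ! i)) \<and>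
    is_exterior_square (sc1 K) (sc2 K) (mu11 K) \<and>
    bilinear_map (sc1 K) (sc2 K) (sc3 K) (mu12 K) \<and>
    is_exterior_cube (sc1 K) (sc3 K) (\<lambda>x y z. mu12 K x (mu11 K y z)) \<and>
    module_hom (sc2 K) (sc1 K) (df2 K) \<and> module_hom (sc3 K) (sc2 K) (df3 K) \<and>
    (\<forall>x y. df2 K (mu11 K x y) = sc1 K (df1 K x) y - sc1 K (df1 K y) x) \<and>
    (\<forall>x y z. df3 K (mu12 K x (mu11 K y z)) =
       sc2 K (df1 K x) (mu11 K y z) - sc2 K (df1 K y) (mu11 K x z) + sc2 K (df1 K z) (mu11 K x y))"

definition is_orientation ::
    "('r::comm_ring_1 \<Rightarrow> 'a::ab_group_add \<Rightarrow> 'a) \<Rightarrow> ('a \<Rightarrow> 'r) \<Rightarrow> bool"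
  where "is_orientation s br \<longleftrightarrow> module_hom s (*) br \<and> bij br"

section \<open>The maps \<open>\<alpha>\<close> and \<open>\<beta>\<close>\<close>

text \<open>The components of \<open>\<alpha> : K \<rightarrow> M\<close>, respectively \<open>\<beta>\<close>, in degrees \<open>1,2,3\<close>, respectively \<open>1,\<dots>,4\<close>.\<close>

record ('k1, 'k2, 'k3, 'm1, 'm2, 'm3) alpha_maps =
  al1 :: "'k1 \<Rightarrow> 'm1"
  al2 :: "'k2 \<Rightarrow> 'm2"
  al3 :: "'k3 \<Rightarrow> 'm3"

record ('r, 'k1, 'k2, 'k3, 'm1, 'm2, 'm3, 'm4) beta_maps =
  be1 :: "'m1 \<Rightarrow> 'r"
  be2 :: "'m2 \<Rightarrow> 'k1"
  be3 :: "'m3 \<Rightarrow> 'k2"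
  be4 :: "'m4 \<Rightarrow> 'k3"

definition is_alpha ::
    "('r::comm_ring_1, 'k1::ab_group_add, 'k2::ab_group_add, 'k3::ab_group_add) alg3 \<Rightarrow>
     ('r, 'm1::ab_group_add, 'm2::ab_group_add, 'm3::ab_group_add, 'm4::ab_group_add) alg4 \<Rightarrow>
     ('k1, 'k2, 'k3, 'm1, 'm2, 'm3) alpha_maps \<Rightarrow> bool"
  where "is_alpha K M \<alpha> \<longleftrightarrow>
    dg_algebra_hom (scale3 K) piece3 (diff3 K) (mult3 K) unit3
                   (scale4 M) piece4 (diff4 M) (mult4 M) unit4
                   (\<lambda>(a, x1, x2, x3). (a, al1 \<alpha> x1, al2 \<alpha> x2, al3 \<alpha> x3, 0))"

text \<open>\<open>[\<beta>\<^sub>i(\<theta>\<^sub>i) \<phi>\<^sub>4\<^sub>-\<^sub>i]\<^sub>K = (-1)\<^sup>i\<^sup>+\<^sup>1 [\<theta>\<^sub>i \<alpha>\<^sub>4\<^sub>-\<^sub>i(\<phi>\<^sub>4\<^sub>-\<^sub>i)]\<^sub>M\<close> for \<open>i = 1,\<dots>,4\<close>.\<close>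

definition is_beta ::
    "('r::comm_ring_1, 'k1::ab_group_add, 'k2::ab_group_add, 'k3::ab_group_add) alg3 \<Rightarrow>
     ('r, 'm1::ab_group_add, 'm2::ab_group_add, 'm3::ab_group_add, 'm4::ab_group_add) alg4 \<Rightarrow>
     ('k1, 'k2, 'k3, 'm1, 'm2, 'm3) alpha_maps \<Rightarrow> ('k3 \<Rightarrow> 'r) \<Rightarrow> ('m4 \<Rightarrow> 'r) \<Rightarrow>
     ('r, 'k1, 'k2, 'k3, 'm1, 'm2, 'm3, 'm4) beta_maps \<Rightarrow> bool"
  where "is_beta K M \<alpha> brK brM \<beta> \<longleftrightarrow>
    (\<forall>\<theta> \<phi>. brK (sc3 K (be1 \<beta> \<theta>) \<phi>) = (-1) ^ 2 * brM (mu13 M \<theta> (al3 \<alpha> \<phi>))) \<and>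
    (\<forall>\<theta> \<phi>. brK (mu12 K (be2 \<beta> \<theta>) \<phi>) = (-1) ^ 3 * brM (mu22 M \<theta> (al2 \<alpha> \<phi>))) \<and>
    (\<forall>\<theta> \<phi>. brK (mu21 K (be3 \<beta> \<theta>) \<phi>) = (-1) ^ 4 * brM (mu31 M \<theta> (al1 \<alpha> \<phi>))) \<and>
    (\<forall>\<theta> a. brK (sc3 K a (be4 \<beta> \<theta>)) = (-1) ^ 5 * brM (sc4 M a \<theta>))"

section \<open>The complex \<open>B\<close>, the map \<open>c\<close> and the homotopy \<open>h\<close>\<close>

text \<open>
  The modules \<open>E2, E3, T12, U22, D2, T13, V12, U23\<close> are
  \<open>\<And>\<^sup>2M\<^sub>1\<close>, \<open>\<And>\<^sup>3M\<^sub>1\<close>, \<open>M\<^sub>1 \<otimes> M\<^sub>2\<close>, \<open>\<And>\<^sup>2M\<^sub>1 \<otimes> M\<^sub>2\<close>, \<open>D\<^sub>2M\<^sub>2\<close>, \<open>M\<^sub>1 \<otimes> M\<^sub>3\<close>, \<open>M\<^sub>1 \<otimes> D\<^sub>2M\<^sub>2\<close>, \<open>\<And>\<^sup>2M\<^sub>1 \<otimes> M\<^sub>3\<close>,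
  each with its scalar multiplication and its canonical map; \<open>dB\<^sub>i\<close> is the differential out of
  \<open>B\<^sub>i\<close>.
\<close>

record ('r, 'm1, 'm2, 'm3, 'e2, 'e3, 't12, 'u22, 'd2, 't13, 'v12, 'u23) complex_B =
  scE2 :: "'r \<Rightarrow> 'e2 \<Rightarrow> 'e2"
  scE3 :: "'r \<Rightarrow> 'e3 \<Rightarrow> 'e3"
  scT12 :: "'r \<Rightarrow> 't12 \<Rightarrow> 't12"
  scU22 :: "'r \<Rightarrow> 'u22 \<Rightarrow> 'u22"
  scD2 :: "'r \<Rightarrow> 'd2 \<Rightarrow> 'd2"
  scT13 :: "'r \<Rightarrow> 't13 \<Rightarrow> 't13"
  scV12 :: "'r \<Rightarrow> 'v12 \<Rightarrow> 'v12"
  scU23 :: "'r \<Rightarrow> 'u23 \<Rightarrow> 'u23"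
  wedge2 :: "'m1 \<Rightarrow> 'm1 \<Rightarrow> 'e2"
  wedge3 :: "'m1 \<Rightarrow> 'm1 \<Rightarrow> 'm1 \<Rightarrow> 'e3"
  tenT12 :: "'m1 \<Rightarrow> 'm2 \<Rightarrow> 't12"
  tenU22 :: "'e2 \<Rightarrow> 'm2 \<Rightarrow> 'u22"
  divsq :: "'m2 \<Rightarrow> 'd2"
  tenT13 :: "'m1 \<Rightarrow> 'm3 \<Rightarrow> 't13"
  tenV12 :: "'m1 \<Rightarrow> 'd2 \<Rightarrow> 'v12"
  tenU23 :: "'e2 \<Rightarrow> 'm3 \<Rightarrow> 'u23"
  dB1 :: "'m1 \<Rightarrow> 'r"
  dB2 :: "'e2 \<times> 'm2 \<Rightarrow> 'm1"
  dB3 :: "'e3 \<times> 't12 \<times> 'm3 \<Rightarrow> 'e2 \<times> 'm2"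
  dB4 :: "'u22 \<times> 'd2 \<times> 't13 \<Rightarrow> 'e3 \<times> 't12 \<times> 'm3"
  dB5 :: "'v12 \<times> 'u23 \<Rightarrow> 'u22 \<times> 'd2 \<times> 't13"

definition scaleB2 where "scaleB2 M B = scE2 B \<oplus>\<^sub>s sc2 M"
definition scaleB3 where "scaleB3 M B = scE3 B \<oplus>\<^sub>s scT12 B \<oplus>\<^sub>s sc3 M"
definition scaleB4 where "scaleB4 M B = scU22 B \<oplus>\<^sub>s scD2 B \<oplus>\<^sub>s scT13 B"
definition scaleB5 where "scaleB5 M B = scV12 B \<oplus>\<^sub>s scU23 B"

definition is_complex_B ::
    "('r::comm_ring_1, 'm1::ab_group_add, 'm2::ab_group_add, 'm3::ab_group_add, 'm4::ab_group_add) alg4 \<Rightarrow>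
     ('r, 'm1, 'm2, 'm3, 'e2::ab_group_add, 'e3::ab_group_add, 't12::ab_group_add, 'u22::ab_group_add,
      'd2::ab_group_add, 't13::ab_group_add, 'v12::ab_group_add, 'u23::ab_group_add) complex_B \<Rightarrow> bool"
  where "is_complex_B M B \<longleftrightarrow>
    is_exterior_square (sc1 M) (scE2 B) (wedge2 B) \<and>
    is_exterior_cube (sc1 M) (scE3 B) (wedge3 B) \<and>
    is_tensor_product (sc1 M) (sc2 M) (scT12 B) (tenT12 B) \<and>
    is_tensor_product (scE2 B) (sc2 M) (scU22 B) (tenU22 B) \<and>
    is_divided_square (sc2 M) (scD2 B) (divsq B) \<and>
    is_tensor_product (sc1 M) (sc3 M) (scT13 B) (tenT13 B) \<and>
    is_tensor_product (sc1 M) (scD2 B) (scV12 B) (tenV12 B) \<and>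
    is_tensor_product (scE2 B) (sc3 M) (scU23 B) (tenU23 B) \<and>
    dB1 B = df1 M \<and>
    module_hom (scaleB2 M B) (sc1 M) (dB2 B) \<and>
    (\<forall>x y. dB2 B (wedge2 B x y, 0) = sc1 M (df1 M x) y - sc1 M (df1 M y) x) \<and>
    (\<forall>t. dB2 B (0, t) = df2 M t) \<and>
    module_hom (scaleB3 M B) (scaleB2 M B) (dB3 B) \<and>
    (\<forall>x y z. dB3 B (wedge3 B x y z, 0, 0) =
       (scE2 B (df1 M x) (wedge2 B y z) - scE2 B (df1 M y) (wedge2 B x z)
          + scE2 B (df1 M z) (wedge2 B x y), 0)) \<and>
    (\<forall>x t. dB3 B (0, tenT12 B x t, 0) = (- wedge2 B x (df2 M t), sc2 M (df1 M x) t)) \<and>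
    (\<forall>u. dB3 B (0, 0, u) = (0, df3 M u)) \<and>
    module_hom (scaleB4 M B) (scaleB3 M B) (dB4 B) \<and>
    (\<forall>x y t. dB4 B (tenU22 B (wedge2 B x y) t, 0, 0) =
       (wedge3 B x y (df2 M t),
        scT12 B (df1 M x) (tenT12 B y t) - scT12 B (df1 M y) (tenT12 B x t), 0)) \<and>
    (\<forall>t. dB4 B (0, divsq B t, 0) = (0, tenT12 B (df2 M t) t, 0)) \<and>
    (\<forall>x u. dB4 B (0, 0, tenT13 B x u) = (0, - tenT12 B x (df3 M u), sc3 M (df1 M x) u)) \<and>
    module_hom (scaleB5 M B) (scaleB4 M B) (dB5 B) \<and>
    (\<forall>x t. dB5 B (tenV12 B x (divsq B t), 0) =
       (- tenU22 B (wedge2 B x (df2 M t)) t, scD2 B (df1 M x) (divsq B t), 0)) \<and>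
    (\<forall>x y u. dB5 B (0, tenU23 B (wedge2 B x y) u) =
       (tenU22 B (wedge2 B x y) (df3 M u), 0,
        scT13 B (df1 M x) (tenT13 B y u) - scT13 B (df1 M y) (tenT13 B x u)))"

text \<open>
  The components \<open>c\<^sub>3, c\<^sub>4, c\<^sub>5\<close> of \<open>c\<^sub>i : B\<^sub>i \<rightarrow> K\<^sub>i\<^sub>-\<^sub>2\<close> (\<open>c\<^sub>0, c\<^sub>1, c\<^sub>2\<close> are zero), and \<open>h\<^sub>1,\<dots>,h\<^sub>4\<close> of
  \<open>h\<^sub>i : B\<^sub>i \<rightarrow> K\<^sub>i\<^sub>-\<^sub>1\<close> (the targets of \<open>h\<^sub>0\<close> and \<open>h\<^sub>5\<close> are zero).
\<close>

record ('k1, 'k2, 'k3, 'm3, 'e3, 't12, 'u22, 'd2, 't13, 'v12, 'u23) c_maps =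
  cc3 :: "'e3 \<times> 't12 \<times> 'm3 \<Rightarrow> 'k1"
  cc4 :: "'u22 \<times> 'd2 \<times> 't13 \<Rightarrow> 'k2"
  cc5 :: "'v12 \<times> 'u23 \<Rightarrow> 'k3"

record ('r, 'k1, 'k2, 'k3, 'm1, 'm2, 'm3, 'e2, 'e3, 't12, 'u22, 'd2, 't13) h_maps =
  hh1 :: "'m1 \<Rightarrow> 'r"
  hh2 :: "'e2 \<times> 'm2 \<Rightarrow> 'k1"
  hh3 :: "'e3 \<times> 't12 \<times> 'm3 \<Rightarrow> 'k2"
  hh4 :: "'u22 \<times> 'd2 \<times> 't13 \<Rightarrow> 'k3"

definition is_c ::
    "('r::comm_ring_1, 'k1::ab_group_add, 'k2::ab_group_add, 'k3::ab_group_add) alg3 \<Rightarrow>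
     ('r, 'm1::ab_group_add, 'm2::ab_group_add, 'm3::ab_group_add, 'm4::ab_group_add) alg4 \<Rightarrow>
     ('m2 \<Rightarrow> 'm4) \<Rightarrow> ('r, 'k1, 'k2, 'k3, 'm1, 'm2, 'm3, 'm4) beta_maps \<Rightarrow>
     ('r, 'm1, 'm2, 'm3, 'e2::ab_group_add, 'e3::ab_group_add, 't12::ab_group_add, 'u22::ab_group_add,
      'd2::ab_group_add, 't13::ab_group_add, 'v12::ab_group_add, 'u23::ab_group_add) complex_B \<Rightarrow>
     ('k1, 'k2, 'k3, 'm3, 'e3, 't12, 'u22, 'd2, 't13, 'v12, 'u23) c_maps \<Rightarrow> bool"
  where "is_c K M \<gamma> \<beta> B c \<longleftrightarrow>
    module_hom (scaleB3 M B) (sc1 K) (cc3 c) \<and>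
    (\<forall>x y z. cc3 c (wedge3 B x y z, 0, 0) =
       sc1 K (be1 \<beta> z) (be2 \<beta> (mu11 M x y)) - sc1 K (be1 \<beta> y) (be2 \<beta> (mu11 M x z))
         + sc1 K (be1 \<beta> x) (be2 \<beta> (mu11 M y z))) \<and>
    (\<forall>v. cc3 c (0, v, 0) = 0) \<and> (\<forall>u. cc3 c (0, 0, u) = 0) \<and>
    module_hom (scaleB4 M B) (sc2 K) (cc4 c) \<and>
    (\<forall>x y t. cc4 c (tenU22 B (wedge2 B x y) t, 0, 0) =
       sc2 K (be1 \<beta> y) (be3 \<beta> (mu12 M x t)) - sc2 K (be1 \<beta> x) (be3 \<beta> (mu12 M y t))
         - mu11 K (be2 \<beta> (mu11 M x y)) (be2 \<beta> t)) \<and>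
    (\<forall>v. cc4 c (0, v, 0) = 0) \<and> (\<forall>u. cc4 c (0, 0, u) = 0) \<and>
    module_hom (scaleB5 M B) (sc3 K) (cc5 c) \<and>
    (\<forall>x t. cc5 c (tenV12 B x (divsq B t), 0) =
       sc3 K (be1 \<beta> x) (be4 \<beta> (\<gamma> t)) - mu21 K (be3 \<beta> (mu12 M x t)) (be2 \<beta> t)) \<and>
    (\<forall>x y u. cc5 c (0, tenU23 B (wedge2 B x y) u) =
       - sc3 K (be1 \<beta> y) (be4 \<beta> (mu13 M x u)) + sc3 K (be1 \<beta> x) (be4 \<beta> (mu13 M y u))
         + mu12 K (be2 \<beta> (mu11 M x y)) (be3 \<beta> u))"

text \<open>The homotopy equation \<open>c\<^sub>i = k\<^sub>i\<^sub>-\<^sub>1 h\<^sub>i + h\<^sub>i\<^sub>-\<^sub>1 d\<^sub>i\<close>, which is void for \<open>i = 0, 1\<close>.\<close>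

definition is_homotopy ::
    "('r::comm_ring_1, 'k1::ab_group_add, 'k2::ab_group_add, 'k3::ab_group_add) alg3 \<Rightarrow>
     ('r, 'm1::ab_group_add, 'm2::ab_group_add, 'm3::ab_group_add, 'm4::ab_group_add) alg4 \<Rightarrow>
     ('r, 'm1, 'm2, 'm3, 'e2::ab_group_add, 'e3::ab_group_add, 't12::ab_group_add, 'u22::ab_group_add,
      'd2::ab_group_add, 't13::ab_group_add, 'v12::ab_group_add, 'u23::ab_group_add) complex_B \<Rightarrow>
     ('k1, 'k2, 'k3, 'm3, 'e3, 't12, 'u22, 'd2, 't13, 'v12, 'u23) c_maps \<Rightarrow>
     ('r, 'k1, 'k2, 'k3, 'm1, 'm2, 'm3, 'e2, 'e3, 't12, 'u22, 'd2, 't13) h_maps \<Rightarrow> bool"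
  where "is_homotopy K M B c h \<longleftrightarrow>
    module_hom (sc1 M) (*) (hh1 h) \<and> module_hom (scaleB2 M B) (sc1 K) (hh2 h) \<and>
    module_hom (scaleB3 M B) (sc2 K) (hh3 h) \<and> module_hom (scaleB4 M B) (sc3 K) (hh4 h) \<and>
    (\<forall>b. 0 = df1 K (hh2 h b) + hh1 h (dB2 B b)) \<and>
    (\<forall>b. cc3 c b = df2 K (hh3 h b) + hh2 h (dB3 B b)) \<and>
    (\<forall>b. cc4 c b = df3 K (hh4 h b) + hh3 h (dB4 B b)) \<and>
    (\<forall>b. cc5 c b = hh4 h (dB5 B b))"

definition is_normalized_homotopy ::
    "('r::comm_ring_1, 'k1::ab_group_add, 'k2::ab_group_add, 'k3::ab_group_add) alg3 \<Rightarrow>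
     ('r, 'm1::ab_group_add, 'm2::ab_group_add, 'm3::ab_group_add, 'm4::ab_group_add) alg4 \<Rightarrow>
     ('k1, 'k2, 'k3, 'm1, 'm2, 'm3) alpha_maps \<Rightarrow>
     ('r, 'm1, 'm2, 'm3, 'e2::ab_group_add, 'e3::ab_group_add, 't12::ab_group_add, 'u22::ab_group_add,
      'd2::ab_group_add, 't13::ab_group_add, 'v12::ab_group_add, 'u23::ab_group_add) complex_B \<Rightarrow>
     ('k1, 'k2, 'k3, 'm3, 'e3, 't12, 'u22, 'd2, 't13, 'v12, 'u23) c_maps \<Rightarrow>
     ('r, 'k1, 'k2, 'k3, 'm1, 'm2, 'm3, 'e2, 'e3, 't12, 'u22, 'd2, 't13) h_maps \<Rightarrow> bool"
  where "is_normalized_homotopy K M \<alpha> B c h \<longleftrightarrow> is_homotopy K M B c h \<and>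
    (\<forall>x. hh1 h x = 0) \<and>
    (\<forall>w. hh2 h (w, 0) = 0) \<and> (\<forall>t. hh2 h (0, t) = 0) \<and>
    (\<forall>v. hh3 h (0, v, 0) = 0) \<and> (\<forall>u. hh3 h (0, 0, u) = 0) \<and>
    (\<forall>v. hh4 h (0, v, 0) = 0) \<and> (\<forall>u. hh4 h (0, 0, u) = 0) \<and>
    (\<forall>x y \<phi>. hh3 h (wedge3 B x y (al1 \<alpha> \<phi>), 0, 0) = 0) \<and>
    (\<forall>x \<phi> t. hh4 h (tenU22 B (wedge2 B x (al1 \<alpha> \<phi>)) t, 0, 0) = 0) \<and>
    (\<forall>w \<phi>. hh4 h (tenU22 B w (al2 \<alpha> \<phi>), 0, 0) = 0) \<and>
    (\<forall>x y \<phi>. hh4 h (tenU22 B (wedge2 B x y) (mu11 M (al1 \<alpha> \<phi>) x), 0, 0) = 0) \<and>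
    (\<forall>x y z \<phi>. hh4 h (tenU22 B (wedge2 B x y) (mu11 M (al1 \<alpha> \<phi>) z)
                     + tenU22 B (wedge2 B z y) (mu11 M (al1 \<alpha> \<phi>) x), 0, 0) = 0)"

section \<open>The maps \<open>X\<close> and \<open>X\<^sup>t\<close>\<close>

definition is_X ::
    "('r::comm_ring_1, 'm1::ab_group_add, 'm2::ab_group_add, 'm3::ab_group_add, 'm4::ab_group_add) alg4 \<Rightarrow>
     ('r, 'k1, 'k2, 'k3, 'm1, 'm2, 'm3, 'm4) beta_maps \<Rightarrow>
     ('r, 'm1, 'm2, 'm3, 'e2::ab_group_add, 'e3::ab_group_add, 't12::ab_group_add, 'u22::ab_group_add,
      'd2::ab_group_add, 't13::ab_group_add, 'v12::ab_group_add, 'u23::ab_group_add) complex_B \<Rightarrow>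
     ('r, 'k1, 'k2, 'k3, 'm1, 'm2, 'm3, 'e2, 'e3, 't12, 'u22, 'd2, 't13) h_maps \<Rightarrow>
     ('e2 \<Rightarrow> 'm2) \<Rightarrow> ('t12 \<Rightarrow> 'm3) \<Rightarrow> bool"
  where "is_X M \<beta> B h X Xt \<longleftrightarrow>
    module_hom (scE2 B) (sc2 M) X \<and> module_hom (scT12 B) (sc3 M) Xt \<and>
    (\<forall>x y t. mu22 M (X (wedge2 B x y)) t = inv (be4 \<beta>) (hh4 h (tenU22 B (wedge2 B x y) t, 0, 0))) \<and>
    (\<forall>x y t. inv (be4 \<beta>) (hh4 h (tenU22 B (wedge2 B x y) t, 0, 0)) = mu13 M x (Xt (tenT12 B y t)))"

section \<open>The big from small complex with its multiplication\<close>

text \<open>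
  \<open>F\<^sub>1 = K\<^sub>1 \<oplus> M\<^sub>1\<close>, \<open>F\<^sub>2 = K\<^sub>2 \<oplus> M\<^sub>2 \<oplus> K\<^sub>1\<close>, \<open>F\<^sub>3 = M\<^sub>3 \<oplus> K\<^sub>2\<close>, \<open>F\<^sub>4 = M\<^sub>4\<close>. The fields \<open>df\<^sub>i\<close> are the
  differentials \<open>f\<^sub>i\<close> of the complex \<open>F(\<alpha>, r)\<close>, the fields \<open>mu\<^sub>i\<^sub>j\<close> are the products.
\<close>

definition big_from_small ::
    "('r::comm_ring_1, 'k1::ab_group_add, 'k2::ab_group_add, 'k3::ab_group_add) alg3 \<Rightarrow>
     ('r, 'm1::ab_group_add, 'm2::ab_group_add, 'm3::ab_group_add, 'm4::ab_group_add) alg4 \<Rightarrow>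
     ('k1, 'k2, 'k3, 'm1, 'm2, 'm3) alpha_maps \<Rightarrow>
     ('r, 'k1, 'k2, 'k3, 'm1, 'm2, 'm3, 'm4) beta_maps \<Rightarrow> 'r \<Rightarrow>
     ('k3 \<Rightarrow> 'r) \<Rightarrow> 'm4 \<Rightarrow> ('m1 \<Rightarrow> 'm1 \<Rightarrow> 'm2) \<Rightarrow> ('m1 \<Rightarrow> 'm2 \<Rightarrow> 'm3) \<Rightarrow>
     ('r, 'k1 \<times> 'm1, 'k2 \<times> 'm2 \<times> 'k1, 'm3 \<times> 'k2, 'm4) alg4"
  where "big_from_small K M \<alpha> \<beta> r brK \<eta> X Xt = \<lparr>
    sc1 = sc1 K \<oplus>\<^sub>s sc1 M,
    sc2 = sc2 K \<oplus>\<^sub>s sc2 M \<oplus>\<^sub>s sc1 K,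
    sc3 = sc3 M \<oplus>\<^sub>s sc2 K,
    df1 = (\<lambda>(\<phi>1, \<theta>1). df1 K \<phi>1 + (be1 \<beta> \<theta>1 + r * df1 M \<theta>1)),
    df2 = (\<lambda>(\<phi>2, \<theta>2, \<phi>1).
      (df2 K \<phi>2 + be2 \<beta> \<theta>2 + sc1 K r \<phi>1,
       - df2 M \<theta>2 - al1 \<alpha> \<phi>1)),
    df3 = (\<lambda>(\<theta>3, \<phi>2).
      (be3 \<beta> \<theta>3 - sc2 K r \<phi>2,
       - df3 M \<theta>3 - al2 \<alpha> \<phi>2,
       df2 K \<phi>2)),
    mu11 = (\<lambda>(\<phi>1, \<theta>1) (\<phi>1', \<theta>1').
      (mu11 K \<phi>1 \<phi>1',
       - mu11 M (al1 \<alpha> \<phi>1) \<theta>1' - mu11 M \<theta>1 (al1 \<alpha> \<phi>1') - sc2 M r (mu11 M \<theta>1 \<theta>1') + X \<theta>1 \<theta>1',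
       sc1 K (df1 M \<theta>1) \<phi>1' - sc1 K (df1 M \<theta>1') \<phi>1 + be2 \<beta> (mu11 M \<theta>1 \<theta>1'))),
    mu12 = (\<lambda>(\<phi>1, \<theta>1) (\<phi>2, \<theta>2, \<phi>1').
      (mu12 M \<theta>1 (al2 \<alpha> \<phi>2) - sc3 M (brK (mu12 K \<phi>1 \<phi>2)) (df4 M \<eta>) - mu12 M (al1 \<alpha> \<phi>1) \<theta>2
         - sc3 M r (mu12 M \<theta>1 \<theta>2) + Xt \<theta>1 \<theta>2,
       mu11 K \<phi>1 \<phi>1' - sc2 K (df1 M \<theta>1) \<phi>2 - be3 \<beta> (mu12 M \<theta>1 \<theta>2))),
    sc4 = sc4 M,
    df4 = (\<lambda>\<theta>4. (al3 \<alpha> (be4 \<beta> \<theta>4) - sc3 M r (df4 M \<theta>4), - df3 K (be4 \<beta> \<theta>4))),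
    mu13 = (\<lambda>(\<phi>1, \<theta>1) (\<theta>3, \<phi>2). sc4 M (brK (mu12 K \<phi>1 \<phi>2)) \<eta> - mu13 M \<theta>1 \<theta>3),
    mu22 = (\<lambda>(\<phi>2, \<theta>2, \<phi>1) (\<phi>2', \<theta>2', \<phi>1').
      sc4 M (brK (mu21 K \<phi>2 \<phi>1')) \<eta> + sc4 M (brK (mu12 K \<phi>1 \<phi>2')) \<eta> - mu22 M \<theta>2 \<theta>2') \<rparr>"

end

theory Submission
  imports Defs
begin

text \<open>
  The point is associativity. Since \<open>M\<close> and \<open>K\<close> have perfect pairings, an identity in \<open>M\<^sub>i\<close> may be
  tested in \<open>M\<^sub>4\<close>, where \<open>k\<^sub>3\<beta>\<^sub>4\<close> is injective because the first element of the regular sequence is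
  a nonzerodivisor. The degree five part of the homotopy equation determines \<open>m\<^sub>2X\<close> and \<open>m\<^sub>3X\<^sup>t\<close>, hence,
  by \<open>k\<^sub>3\<beta>\<^sub>4 = \<beta>\<^sub>3m\<^sub>4\<close> and the Leibniz rule, it expresses \<open>k\<^sub>3\<beta>\<^sub>4(X(x \<and> y) t)\<close> through the form
  \<open>L(x, y, z) = \<beta>\<^sub>3(x X(y \<and> z))\<close> and \<open>\<beta>\<close>. The normalisation of \<open>h\<close> makes \<open>L\<close> alternating, and this yields
  that \<open>x X(y \<and> z) + X\<^sup>t(x \<otimes> y z)\<close> and \<open>X\<^sup>t(x \<otimes> X(y \<and> z))\<close> are cyclic in \<open>x, y, z\<close>, which is what
  associativity of \<open>F\<^sub>1 \<otimes> F\<^sub>1 \<otimes> F\<^sub>1 \<rightarrow> F\<^sub>3\<close> amounts to.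
\<close>

section \<open>Linear and bilinear maps\<close>

text \<open>The corrections \<open>X\<close> and \<open>Xt\<close> are forced by the Leibniz rule:
  the \<beta>-summands of the differential of F leave defects such as \<beta>_1(x) y - \<beta>_1(y)
  x, and the formulas for m_2 X and m_3 X^t say that these defects are absorbed. Divided powers
  matter because the degree five equation on M_1 \<otimes> D_2 M_2 is quadratic in M_2. Polarising
  it turns \<open>\<gamma>\<close> into the product of M, so nothing is divided by 2. Duality of F
  involves neither r nor \<open>X\<close>: the pairings into M_4 are, up to sign and order of
  summands, orthogonal sums of the pairings of K and M, because \<phi> \<mapsto> [\<phi>]_K \<eta>
  is minus the inverse of \<beta>_4. A last obstacle lies in the encoding: the axioms for the total
  algebra do not quite determine the separate products of M. All computations therefore use a
  normalised copy of M, and at the end the total algebra of F is seen not to notice the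
  difference.\<close>

lemma module_ring: "module ((*) :: 'r::comm_ring_1 \<Rightarrow> 'r \<Rightarrow> 'r)"
  by (simp add: module_def distrib_left distrib_right mult.assoc)

lemma module_laws:
  assumes "module s"
  shows "s a (x + y) = s a x + s a y" "s (a + b) x = s a x + s b x" "s a (s b x) = s (a * b) x"
    "s 1 x = x" "s 0 x = 0" "s a 0 = 0" "s (- a) x = - s a x" "s a (- x) = - s a x"
    "s (a - b) x = s a x - s b x" "s a (x - y) = s a x - s a y"
proof -
  interpret module s by fact
  show "s a (x + y) = s a x + s a y" "s (a + b) x = s a x + s b x" "s a (s b x) = s (a * b) x"
    "s 1 x = x" "s 0 x = 0" "s a 0 = 0" "s (- a) x = - s a x" "s a (- x) = - s a x"
    "s (a - b) x = s a x - s b x" "s a (x - y) = s a x - s a y"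
    by (simp_all add: scale_right_distrib scale_left_distrib scale_left_diff_distrib scale_right_diff_distrib)
qed

lemma module_hom_laws:
  assumes "module_hom s t f"
  shows "f (x + y) = f x + f y" "f (s a x) = t a (f x)" "f 0 = 0" "f (- x) = - f x" "f (x - y) = f x - f y"
proof -
  interpret module_hom s t f by fact
  show "f (x + y) = f x + f y" "f (s a x) = t a (f x)" "f 0 = 0" "f (- x) = - f x" "f (x - y) = f x - f y"
    by (rule add scale zero neg diff)+
qed

lemma module_homI:
  assumes "module s" "module t" "\<And>x y. f (x + y) = f x + f y" "\<And>a x. f (s a x) = t a (f x)"
  shows "module_hom s t f"
  using assms by (simp add: module_hom_def module_hom_axioms_def)

lemma module_hom_modules:
  assumes "module_hom s t f"
  shows "module s" "module t"
  using assms by (auto simp: module_hom_def)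

lemma bilinear_map_laws:
  assumes "bilinear_map s t u f"
  shows "f (x + x') y = f x y + f x' y" "f (s a x) y = u a (f x y)" "f 0 y = 0"
    "f (- x) y = - f x y" "f (x - x') y = f x y - f x' y"
    "f x (y + y') = f x y + f x y'" "f x (t a y) = u a (f x y)" "f x 0 = 0"
    "f x (- y) = - f x y" "f x (y - y') = f x y - f x y'"
proof -
  have 1: "module_hom t u (\<lambda>y. f x y)" for x using assms by (simp add: bilinear_map_def)
  have 2: "module_hom s u (\<lambda>x. f x y)" for y using assms by (simp add: bilinear_map_def)
  show "f (x + x') y = f x y + f x' y" "f (s a x) y = u a (f x y)" "f 0 y = 0"
    "f (- x) y = - f x y" "f (x - x') y = f x y - f x' y"
    using module_hom_laws[OF 2[of y]] by blast+
  show "f x (y + y') = f x y + f x y'" "f x (t a y) = u a (f x y)" "f x 0 = 0"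
    "f x (- y) = - f x y" "f x (y - y') = f x y - f x y'"
    using module_hom_laws[OF 1[of x]] by blast+
qed

lemma bilinear_mapI:
  assumes "module s" "module t" "module u"
    "\<And>x x' y. f (x + x') y = f x y + f x' y" "\<And>a x y. f (s a x) y = u a (f x y)"
    "\<And>x y y'. f x (y + y') = f x y + f x y'" "\<And>a x y. f x (t a y) = u a (f x y)"
  shows "bilinear_map s t u f"
  unfolding bilinear_map_def using assms by (auto intro!: module_homI)

lemma alternating_anticommute:
  fixes f :: "'a::ab_group_add \<Rightarrow> 'a \<Rightarrow> 'b::ab_group_add"
  assumes "\<And>x y z. f (x + y) z = f x z + f y z" "\<And>x y z. f x (y + z) = f x y + f x z" "\<And>x. f x x = 0"
  shows "f x y = - f y x"
proof -
  have "0 = f (x + y) (x + y)" by (simp add: assms(3))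
  also have "\<dots> = f x y + f y x"
    by (simp only: assms(1,2)) (simp add: assms(3))
  finally show ?thesis by (simp add: eq_neg_iff_add_eq_0)
qed

lemma prod_scale_Pair [simp]: "(s \<oplus>\<^sub>s t) a (x, y) = (s a x, t a y)"
  by (simp add: prod_scale_def)

lemma prod_scale_sel [simp]: "fst ((s \<oplus>\<^sub>s t) a z) = s a (fst z)" "snd ((s \<oplus>\<^sub>s t) a z) = t a (snd z)"
  by (cases z; simp)+

lemma module_prod:
  assumes "module s" "module t"
  shows "module (s \<oplus>\<^sub>s t)"
  unfolding module_def
  by (auto simp: module_laws[OF assms(1)] module_laws[OF assms(2)])

section \<open>Free modules\<close>

lemma has_basis_iff:
  fixes s :: "'r::comm_ring_1 \<Rightarrow> 'a::ab_group_add \<Rightarrow> 'a"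
  assumes "module s" "finite B"
  shows "has_basis s V B \<longleftrightarrow>
    (\<forall>u. (\<Sum>b\<in>B. s (u b) b) = 0 \<longrightarrow> (\<forall>b\<in>B. u b = 0)) \<and> V = range (\<lambda>u. \<Sum>b\<in>B. s (u b) b)"
proof -
  interpret module s by fact
  show ?thesis
    unfolding has_basis_def dependent_finite[OF assms(2)] span_finite[OF assms(2)] by blast
qed

lemma fg_free_image:
  assumes f: "module_hom s t f" and inj: "inj_on f V" and V: "fg_free s V"
  shows "fg_free t (f ` V)"
proof -
  interpret module_hom s t f by fact
  obtain B where B: "finite B" "m1.independent B" "m1.span B = V"
    using V by (auto simp: fg_free_def has_basis_def)
  have "m2.independent (f ` B)"
    by (rule independent_injective_image) (use B inj in auto)
  moreover have "m2.span (f ` B) = f ` V" using span_image[of B] B by simp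
  ultimately show ?thesis using B(1) unfolding fg_free_def has_basis_def by blast
qed

text \<open>The families \<open>(b, 0)\<close> and \<open>(0, c)\<close> can meet only at 0, and 0
  lies in no basis over a nontrivial ring. Over the zero ring every module is zero and the empty
  basis serves, hence the case split.\<close>

lemma fg_free_prod:
  fixes s :: "'r::comm_ring_1 \<Rightarrow> 'a::ab_group_add \<Rightarrow> 'a" and t :: "'r \<Rightarrow> 'b::ab_group_add \<Rightarrow> 'b"
  assumes m: "module s" "module t" and s: "fg_free s UNIV" and t: "fg_free t UNIV"
  shows "fg_free (s \<oplus>\<^sub>s t) UNIV"
proof -
  obtain B where B: "finite B" "has_basis s UNIV B" using s unfolding fg_free_def by blast
  obtain C where C: "finite C" "has_basis t UNIV C" using t unfolding fg_free_def by blast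
  let ?f = "\<lambda>b. (b, 0 :: 'b)" and ?g = "\<lambda>c. (0 :: 'a, c)"
  interpret s: module s by fact
  interpret t: module t by fact
  have ms: "module (s \<oplus>\<^sub>s t)" by (rule module_prod[OF m])
  have B': "\<And>u. (\<Sum>b\<in>B. s (u b) b) = 0 \<Longrightarrow> \<forall>b\<in>B. u b = 0" "UNIV = range (\<lambda>u. \<Sum>b\<in>B. s (u b) b)"
    using B unfolding has_basis_iff[OF m(1) B(1)] by blast+
  have C': "\<And>u. (\<Sum>b\<in>C. t (u b) b) = 0 \<Longrightarrow> \<forall>b\<in>C. u b = 0" "UNIV = range (\<lambda>u. \<Sum>b\<in>C. t (u b) b)"
    using C unfolding has_basis_iff[OF m(2) C(1)] by blast+
  have 0: "0 \<notin> B" if "(1::'r) \<noteq> 0"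
  proof
    assume "0 \<in> B"
    moreover have "(\<Sum>b\<in>B. s (if b = 0 then 1 else 0) b) = 0"
      by (rule sum.neutral) auto
    ultimately show False using B'(1)[of "\<lambda>b. if b = 0 then 1 else 0"] that by auto
  qed
  have sumeq: "(\<Sum>x\<in>?f ` B \<union> ?g ` C. (s \<oplus>\<^sub>s t) (u x) x) =
    ((\<Sum>b\<in>B. s (u (?f b)) b), (\<Sum>c\<in>C. t (u (?g c)) c))" if "(1::'r) \<noteq> 0" for u
  proof -
    have "?f ` B \<inter> ?g ` C = {}" using 0[OF that] by auto
    then have "(\<Sum>x\<in>?f ` B \<union> ?g ` C. (s \<oplus>\<^sub>s t) (u x) x) =
      (\<Sum>x\<in>?f ` B. (s \<oplus>\<^sub>s t) (u x) x) + (\<Sum>x\<in>?g ` C. (s \<oplus>\<^sub>s t) (u x) x)"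
      by (intro sum.union_disjoint) (use B C in auto)
    also have "(\<Sum>x\<in>?f ` B. (s \<oplus>\<^sub>s t) (u x) x) = (\<Sum>b\<in>B. (s \<oplus>\<^sub>s t) (u (?f b)) (?f b))"
      by (subst sum.reindex) (auto simp: inj_on_def)
    also have "\<dots> = (\<Sum>b\<in>B. s (u (?f b)) b, 0)" by (simp add: prod_eq_iff fst_sum snd_sum)
    also have "(\<Sum>x\<in>?g ` C. (s \<oplus>\<^sub>s t) (u x) x) = (\<Sum>c\<in>C. (s \<oplus>\<^sub>s t) (u (?g c)) (?g c))"
      by (subst sum.reindex) (auto simp: inj_on_def)
    also have "\<dots> = (0, \<Sum>c\<in>C. t (u (?g c)) c)" by (simp add: prod_eq_iff fst_sum snd_sum)
    finally show ?thesis by simp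
  qed
  show ?thesis
  proof (cases "(1::'r) = 0")
    case True
    then have z: "x = 0" for x :: "'a \<times> 'b"
      using module_laws(4,5)[OF ms, of x] True by simp
    then show ?thesis unfolding fg_free_def
      by (intro exI[of _ "{}"])
        (auto simp: has_basis_def module.span_empty[OF ms] module.independent_empty[OF ms])
  next
    case False
    have fin: "finite (?f ` B \<union> ?g ` C)" using B C by simp
    show ?thesis unfolding fg_free_def
    proof (intro exI conjI)
      show "finite (?f ` B \<union> ?g ` C)" by fact
      show "has_basis (s \<oplus>\<^sub>s t) UNIV (?f ` B \<union> ?g ` C)"
        unfolding has_basis_iff[OF ms fin] sumeq[OF False]
      proof (intro conjI allI impI)
        fix u :: "'a \<times> 'b \<Rightarrow> 'r"
        assume "((\<Sum>b\<in>B. s (u (?f b)) b), (\<Sum>c\<in>C. t (u (?g c)) c)) = 0"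
        then show "\<forall>x\<in>?f ` B \<union> ?g ` C. u x = 0"
          using B'(1)[of "\<lambda>b. u (?f b)"] C'(1)[of "\<lambda>c. u (?g c)"] by (auto simp: prod_eq_iff)
      next
        show "UNIV = range (\<lambda>u. ((\<Sum>b\<in>B. s (u (?f b)) b), (\<Sum>c\<in>C. t (u (?g c)) c)))"
        proof (intro equalityI subsetI)
          fix z :: "'a \<times> 'b"
          obtain v where v: "fst z = (\<Sum>b\<in>B. s (v b) b)" using B'(2) by blast
          obtain w where w: "snd z = (\<Sum>c\<in>C. t (w c) c)" using C'(2) by blast
          let ?u = "\<lambda>x. if x \<in> ?f ` B then v (fst x) else w (snd x)"
          have "(\<Sum>b\<in>B. s (?u (?f b)) b) = fst z" unfolding v by (rule sum.cong) auto
          moreover have "(\<Sum>c\<in>C. t (?u (?g c)) c) = snd z"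
            unfolding w by (rule sum.cong) (use 0[OF False] in auto)
          ultimately show "z \<in> range (\<lambda>u. ((\<Sum>b\<in>B. s (u (?f b)) b), (\<Sum>c\<in>C. t (u (?g c)) c)))"
            by (intro image_eqI[of _ _ ?u]) auto
        qed auto
      qed
    qed
  qed
qed

lemma fg_free_ring: "fg_free ((*) :: 'r::comm_ring_1 \<Rightarrow> 'r \<Rightarrow> 'r) UNIV"
  unfolding fg_free_def
proof (intro exI conjI)
  show "has_basis (*) UNIV {1 :: 'r}"
    by (subst has_basis_iff) (auto simp: module_ring image_def intro: exI[of _ "\<lambda>_. _"])
qed simp

section \<open>Presented modules\<close>

lemma lincomb_superset:
  fixes s :: "'r::comm_ring_1 \<Rightarrow> 't::ab_group_add \<Rightarrow> 't"
  assumes "module s" "finite A" "Poly_Mapping.keys c \<subseteq> A"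
  shows "lincomb s gen c = (\<Sum>g\<in>A. s (Poly_Mapping.lookup c g) (gen g))"
  unfolding lincomb_def
  by (rule sum.mono_neutral_left) (use assms in \<open>auto simp: in_keys_iff module_laws\<close>)

lemma lookup_free_scale: "Poly_Mapping.lookup (free_scale a c) g = a * Poly_Mapping.lookup c g"
  by (simp add: free_scale_def Poly_Mapping.map.rep_eq when_def)

lemma lincomb_add:
  assumes "module s"
  shows "lincomb s gen (c + c') = lincomb s gen c + lincomb s gen c'"
proof -
  let ?A = "Poly_Mapping.keys c \<union> Poly_Mapping.keys c'"
  have k: "Poly_Mapping.keys (c + c') \<subseteq> ?A" by (rule Poly_Mapping.keys_add)
  show ?thesis
    by (subst (1 2 3) lincomb_superset[OF assms, of ?A])
      (use k in \<open>auto simp: lookup_add module_laws[OF assms] sum.distrib\<close>)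
qed

lemma lincomb_free_scale:
  assumes "module s"
  shows "lincomb s gen (free_scale a c) = s a (lincomb s gen c)"
proof -
  have k: "Poly_Mapping.keys (free_scale a c) \<subseteq> Poly_Mapping.keys c"
    by (auto simp: in_keys_iff lookup_free_scale)
  interpret module s by fact
  show ?thesis
    by (subst (1 2) lincomb_superset[OF assms, of "Poly_Mapping.keys c"])
      (use k in \<open>auto simp: lookup_free_scale scale_sum_right\<close>)
qed

lemma lincomb_free_gen: "module s \<Longrightarrow> lincomb s gen (free_gen g) = gen g"
  by (simp add: lincomb_def free_gen_def module_laws)

lemma lincomb_uminus:
  assumes "module s"
  shows "lincomb s gen (- c) = - lincomb s gen c"
proof -
  have "lincomb s gen 0 = 0" by (simp add: lincomb_def)
  then show ?thesis using lincomb_add[OF assms, of gen c "- c"] by (simp add: eq_neg_iff_add_eq_0 add.commute)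
qed

lemma lincomb_diff:
  assumes "module s"
  shows "lincomb s gen (c - c') = lincomb s gen c - lincomb s gen c'"
  using lincomb_add[OF assms, of gen c "- c'"] lincomb_uminus[OF assms, of gen c'] by simp

lemma module_free_scale: "module (free_scale :: 'r::comm_ring_1 \<Rightarrow> ('g \<Rightarrow>\<^sub>0 'r) \<Rightarrow> _)"
  by unfold_locales (auto intro!: poly_mapping_eqI simp: lookup_free_scale lookup_add algebra_simps)

lemma presented_relation:
  assumes "presented s gen Rel" "c \<in> Rel"
  shows "lincomb s gen c = 0"
  using assms module.span_base[OF module_free_scale] by (auto simp: presented_def)

lemma presented_module: "presented s gen Rel \<Longrightarrow> module s"
  by (simp add: presented_def)

lemma presented_induct [consumes 2, case_names generator add]:
  assumes p: "presented s gen Rel" and P: "\<And>a b. P a \<Longrightarrow> P b \<Longrightarrow> P (a + b)"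
    and gen: "\<And>a g. P (s a (gen g))" and 0: "P 0"
  shows "P x"
proof -
  obtain c where "x = lincomb s gen c" using p by (auto simp: presented_def)
  moreover have "P (\<Sum>g\<in>A. s (u g) (gen g))" if "finite A" for A u
    using that by induction (auto intro: 0 P gen)
  ultimately show ?thesis by (simp add: lincomb_def)
qed

text \<open>Each slot of a presentation contributes its relations through
  \<open>linearity_rels\<close>, with \<open>q\<close> the map that puts an argument into that slot.
  One statement thus serves every slot.\<close>

lemma presented_linearity_relation:
  assumes p: "presented s gen Rel" and "linearity_rels t q \<subseteq> Rel"
  shows "lincomb s gen (q (x + y)) = lincomb s gen (q x) + lincomb s gen (q y)"
    and "lincomb s gen (q (t a x)) = s a (lincomb s gen (q x))"
proof -
  note m = presented_module[OF p]
  have "q (x + y) - q x - q y \<in> Rel" "q (t a x) - free_scale a (q x) \<in> Rel"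
    using assms(2) by (auto simp: linearity_rels_def)
  from this[THEN presented_relation[OF p]]
  show "lincomb s gen (q (x + y)) = lincomb s gen (q x) + lincomb s gen (q y)"
    "lincomb s gen (q (t a x)) = s a (lincomb s gen (q x))"
    by (simp_all add: lincomb_add[OF m] lincomb_diff[OF m] lincomb_free_scale[OF m] diff_diff_eq)
qed

lemma tensor_product_bilinear:
  assumes t: "is_tensor_product s t u tens" and m: "module s" "module t"
  shows "bilinear_map s t u tens"
proof (rule bilinear_mapI)
  note p = t[unfolded is_tensor_product_def]
  show mu: "module u" by (rule presented_module[OF p])
  note g = lincomb_free_gen[OF mu, of "\<lambda>(x, y). tens x y"]
  show "tens (x + x') y = tens x y + tens x' y" for x x' y
    using presented_linearity_relation(1)[OF p, of s "\<lambda>x. free_gen (x, y)" x x'] by (auto simp: g)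
  show "tens (s a x) y = u a (tens x y)" for a x y
    using presented_linearity_relation(2)[OF p, of s "\<lambda>x. free_gen (x, y)" a x] by (auto simp: g)
  show "tens x (y + y') = tens x y + tens x y'" for x y y'
    using presented_linearity_relation(1)[OF p, of t "\<lambda>y. free_gen (x, y)" y y'] by (auto simp: g)
  show "tens x (t a y) = u a (tens x y)" for x a y
    using presented_linearity_relation(2)[OF p, of t "\<lambda>y. free_gen (x, y)" a y] by (auto simp: g)
qed (use m in auto)

lemma exterior_square_alternating:
  assumes t: "is_exterior_square s u wedge" and m: "module s"
  shows "bilinear_map s s u wedge" and "wedge x x = 0"
proof -
  note p = t[unfolded is_exterior_square_def]
  have mu: "module u" by (rule presented_module[OF p])
  note g = lincomb_free_gen[OF mu, of "\<lambda>(x, y). wedge x y"]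
  show "bilinear_map s s u wedge"
  proof (rule bilinear_mapI)
    show "wedge (x + x') y = wedge x y + wedge x' y" for x x' y
      using presented_linearity_relation(1)[OF p, of s "\<lambda>x. free_gen (x, y)" x x'] by (auto simp: g)
    show "wedge (s a x) y = u a (wedge x y)" for a x y
      using presented_linearity_relation(2)[OF p, of s "\<lambda>x. free_gen (x, y)" a x] by (auto simp: g)
    show "wedge x (y + y') = wedge x y + wedge x y'" for x y y'
      using presented_linearity_relation(1)[OF p, of s "\<lambda>y. free_gen (x, y)" y y'] by (auto simp: g)
    show "wedge x (s a y) = u a (wedge x y)" for x a y
      using presented_linearity_relation(2)[OF p, of s "\<lambda>y. free_gen (x, y)" a y] by (auto simp: g)
  qed (use m mu in auto)
  show "wedge x x = 0"
    using presented_relation[OF p, of "free_gen (x, x)"] by (auto simp: g)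
qed

lemma exterior_cube_alternating:
  assumes t: "is_exterior_cube s u wedge"
  shows "wedge x x y = 0" "wedge x y x = 0" "wedge x y y = 0"
proof -
  note p = t[unfolded is_exterior_cube_def]
  have mu: "module u" by (rule presented_module[OF p])
  note g = lincomb_free_gen[OF mu, of "\<lambda>(x, y, z). wedge x y z"]
  have *: "wedge x y z = 0" if "x = y \<or> x = z \<or> y = z" for x y z
  proof -
    have "lincomb u (\<lambda>(x, y, z). wedge x y z) (free_gen (x, y, z)) = 0"
      by (rule presented_relation[OF p]) (use that in blast)
    then show ?thesis by (simp add: g)
  qed
  show "wedge x x y = 0" "wedge x y x = 0" "wedge x y y = 0" by (rule *; simp)+
qed

section \<open>Algebras of length four, degree by degree\<close>

text \<open>Degreewise form of \<open>is_dg_algebra4\<close>. As \<open>mu21\<close> is defined by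
  commutation, (x y) z in degree 3 reads \<open>mu12 A z (mu11 A x y)\<close>, which gives
  \<open>assoc111\<close> its shape. \<open>leibniz14\<close> and \<open>leibniz23\<close> are the
  Leibniz rules for products of degree 5, which vanish.\<close>

locale dga4 =
  fixes A :: "('r::comm_ring_1, 'a1::ab_group_add, 'a2::ab_group_add, 'a3::ab_group_add, 'a4::ab_group_add) alg4"
  assumes free: "fg_free (sc1 A) UNIV" "fg_free (sc2 A) UNIV" "fg_free (sc3 A) UNIV" "fg_free (sc4 A) UNIV"
    and df_hom: "module_hom (sc1 A) (*) (df1 A)" "module_hom (sc2 A) (sc1 A) (df2 A)"
      "module_hom (sc3 A) (sc2 A) (df3 A)" "module_hom (sc4 A) (sc3 A) (df4 A)"
    and df_df: "df1 A (df2 A t) = 0" "df2 A (df3 A u) = 0" "df3 A (df4 A w) = 0"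
    and mu_bilinear: "bilinear_map (sc1 A) (sc1 A) (sc2 A) (mu11 A)"
      "bilinear_map (sc1 A) (sc2 A) (sc3 A) (mu12 A)"
      "bilinear_map (sc1 A) (sc3 A) (sc4 A) (mu13 A)"
      "bilinear_map (sc2 A) (sc2 A) (sc4 A) (mu22 A)"
    and mu11_self: "mu11 A x x = 0"
    and mu22_commute: "mu22 A t s = mu22 A s t"
    and assoc111: "mu12 A z (mu11 A x y) = mu12 A x (mu11 A y z)"
    and assoc112: "mu22 A (mu11 A x y) t = mu13 A x (mu12 A y t)"
    and leibniz11: "df2 A (mu11 A x y) = sc1 A (df1 A x) y - sc1 A (df1 A y) x"
    and leibniz12: "df3 A (mu12 A x t) = sc2 A (df1 A x) t - mu11 A x (df2 A t)"
    and leibniz13: "df4 A (mu13 A x u) = sc3 A (df1 A x) u - mu12 A x (df3 A u)"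
    and leibniz22: "df4 A (mu22 A s t) = mu12 A (df2 A s) t + mu12 A (df2 A t) s"
    and leibniz14: "mu13 A x (df4 A w) = sc4 A (df1 A x) w"
    and leibniz23: "mu22 A t (df3 A u) = - mu13 A (df2 A t) u"
begin

lemma modules: "module (sc1 A)" "module (sc2 A)" "module (sc3 A)" "module (sc4 A)"
  using df_hom by (auto intro: module_hom_modules)

lemmas lin =
  module_laws[OF modules(1)] module_laws[OF modules(2)] module_laws[OF modules(3)] module_laws[OF modules(4)]
  module_hom_laws[OF df_hom(1)] module_hom_laws[OF df_hom(2)] module_hom_laws[OF df_hom(3)] module_hom_laws[OF df_hom(4)]
  bilinear_map_laws[OF mu_bilinear(1)] bilinear_map_laws[OF mu_bilinear(2)]
  bilinear_map_laws[OF mu_bilinear(3)] bilinear_map_laws[OF mu_bilinear(4)]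

lemma mu11_anticommute: "mu11 A y x = - mu11 A x y"
  by (rule alternating_anticommute) (simp_all add: lin mu11_self)

lemma mu13_mu12_anticommute: "mu13 A y (mu12 A x t) = - mu13 A x (mu12 A y t)"
  using assoc112[of x y t] assoc112[of y x t] mu11_anticommute[of y x] by (simp add: lin)

text \<open>In degree 4 the patterns 1,2,1 and 2,1,1 reduce to \<open>assoc112\<close> by
  anticommutativity of the degree 1 factors and symmetry of \<open>mu22\<close>.\<close>

lemma mult4_assoc: "mult4 A (mult4 A x y) z = mult4 A x (mult4 A y z)"
proof (cases x; cases y; cases z)
  fix a x1 x2 x3 x4 b y1 y2 y3 y4 c z1 z2 z3 z4
  assume [simp]: "x = (a, x1, x2, x3, x4)" "y = (b, y1, y2, y3, y4)" "z = (c, z1, z2, z3, z4)"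
  have 1: "mu13 A z1 (mu12 A x1 y2) = - mu22 A (mu11 A x1 z1) y2"
    using mu13_mu12_anticommute[of z1 x1 y2] assoc112[of x1 z1 y2] by simp
  have 2: "mu13 A z1 (mu12 A y1 x2) = - mu22 A x2 (mu11 A y1 z1)"
    using mu13_mu12_anticommute[of z1 y1 x2] assoc112[of y1 z1 x2] mu22_commute by simp
  have 3: "mu13 A x1 (mu12 A z1 y2) = mu22 A (mu11 A x1 z1) y2" "mu13 A x1 (mu12 A y1 z2) = mu22 A (mu11 A x1 y1) z2"
    using assoc112 by simp_all
  show "mult4 A (mult4 A x y) z = mult4 A x (mult4 A y z)"
    by (simp add: mu21_def mu31_def lin 1 2 3 assoc111[of z1 x1 y1] algebra_simps)
qed

lemma piece4_cases:
  assumes "x \<in> piece4 i"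
  obtains (0) a where "i = 0" "x = (a, 0, 0, 0, 0)" | (1) x1 where "i = 1" "x = (0, x1, 0, 0, 0)"
    | (2) x2 where "i = 2" "x = (0, 0, x2, 0, 0)" | (3) x3 where "i = 3" "x = (0, 0, 0, x3, 0)"
    | (4) x4 where "i = 4" "x = (0, 0, 0, 0, x4)" | (gt) "i > 4" "x = 0"
proof -
  obtain a x1 x2 x3 x4 where x: "x = (a, x1, x2, x3, x4)" by (cases x)
  consider "i = 0" | "i = 1" | "i = 2" | "i = 3" | "i = 4" | "i > 4" by linarith
  then show thesis
    using assms by cases (auto simp: x piece4_def zero_prod_def intro: that)
qed

lemma module_scale4: "module (scale4 A)"
  unfolding scale4_def by (intro module_prod module_ring modules)

lemma fg_free_piece4: "fg_free (scale4 A) (piece4 i)"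
proof -
  note m = module_scale4
  consider "i = 0" | "i = 1" | "i = 2" | "i = 3" | "i = 4" | "i > 4" by linarith
  then show ?thesis
  proof cases
    case 1
    have "fg_free (scale4 A) (range (\<lambda>x. (x, 0, 0, 0, 0)))"
      by (rule fg_free_image[OF _ _ fg_free_ring])
        (auto intro!: module_homI m[unfolded scale4_def] module_ring simp: scale4_def inj_on_def lin)
    also have "range (\<lambda>x. (x, 0, 0, 0, 0)) = piece4 i" using 1 by (auto simp: piece4_def)
    finally show ?thesis .
  next
    case 2
    have "fg_free (scale4 A) (range (\<lambda>x. (0, x, 0, 0, 0)))"
      by (rule fg_free_image[OF _ _ free(1)])
        (auto intro!: module_homI m[unfolded scale4_def] modules simp: scale4_def inj_on_def lin)
    also have "range (\<lambda>x. (0, x, 0, 0, 0)) = piece4 i" using 2 by (auto simp: piece4_def)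
    finally show ?thesis .
  next
    case 3
    have "fg_free (scale4 A) (range (\<lambda>x. (0, 0, x, 0, 0)))"
      by (rule fg_free_image[OF _ _ free(2)])
        (auto intro!: module_homI m[unfolded scale4_def] modules simp: scale4_def inj_on_def lin)
    also have "range (\<lambda>x. (0, 0, x, 0, 0)) = piece4 i" using 3 by (auto simp: piece4_def)
    finally show ?thesis .
  next
    case 4
    have "fg_free (scale4 A) (range (\<lambda>x. (0, 0, 0, x, 0)))"
      by (rule fg_free_image[OF _ _ free(3)])
        (auto intro!: module_homI m[unfolded scale4_def] modules simp: scale4_def inj_on_def lin)
    also have "range (\<lambda>x. (0, 0, 0, x, 0)) = piece4 i" using 4 by (auto simp: piece4_def)
    finally show ?thesis .
  next
    case 5
    have "fg_free (scale4 A) (range (\<lambda>x. (0, 0, 0, 0, x)))"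
      by (rule fg_free_image[OF _ _ free(4)])
        (auto intro!: module_homI m[unfolded scale4_def] modules simp: scale4_def inj_on_def lin)
    also have "range (\<lambda>x. (0, 0, 0, 0, x)) = piece4 i" using 5 by (auto simp: piece4_def)
    finally show ?thesis .
  next
    case 6
    then have "piece4 i = {0 :: ('r, 'a1, 'a2, 'a3, 'a4) total4}" by (auto simp: piece4_def zero_prod_def)
    then show ?thesis unfolding fg_free_def has_basis_def
      by (intro exI[of _ "{}"])
        (auto simp: has_basis_def module.span_empty[OF m] module.independent_empty[OF m])
  qed
qed

lemma piece4_direct_sum:
  fixes x :: "('r, 'a1, 'a2, 'a3, 'a4) total4"
  shows "\<exists>!c. (\<forall>i. c i \<in> piece4 i) \<and> finite {i. c i \<noteq> 0} \<and> x = (\<Sum>i | c i \<noteq> 0. c i)"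
proof -
  obtain a x1 x2 x3 x4 where x: "x = (a, x1, x2, x3, x4)" by (cases x)
  have sum: "(\<Sum>i | c i \<noteq> 0. c i) = c 0 + c 1 + c 2 + c 3 + c 4"
    and fin: "finite {i. c i \<noteq> 0}"
    if c: "\<forall>i. c i \<in> piece4 i" for c :: "nat \<Rightarrow> ('r, 'a1, 'a2, 'a3, 'a4) total4"
  proof -
    have z: "c i = 0" if "i > 4" for i using c[rule_format, of i] that
      by (auto simp: piece4_def zero_prod_def)
    then have sub: "{i. c i \<noteq> 0} \<subseteq> {0,1,2,3,4}"
    proof -
      have "i \<in> {0,1,2,3,4}" if "c i \<noteq> 0" for i
      proof -
        have "i \<le> 4" using z[of i] that by force
        then show ?thesis by auto
      qed
      then show ?thesis by blast
    qed
    show "finite {i. c i \<noteq> 0}" by (rule finite_subset[OF sub]) simp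
    have "(\<Sum>i | c i \<noteq> 0. c i) = (\<Sum>i\<in>{0,1,2,3,4}. c i)"
      by (rule sum.mono_neutral_left) (use sub in auto)
    then show "(\<Sum>i | c i \<noteq> 0. c i) = c 0 + c 1 + c 2 + c 3 + c 4" by (simp add: add.assoc)
  qed
  define e where "e = (\<lambda>i::nat. if i = 0 then (a, 0, 0, 0, 0) else if i = 1 then (0, x1, 0, 0, 0)
    else if i = 2 then (0, 0, x2, 0, 0) else if i = 3 then (0, 0, 0, x3, 0)
    else if i = 4 then (0, 0, 0, 0, x4) else 0)"
  show ?thesis
  proof (rule ex1I[of _ e])
    have e: "\<forall>i. e i \<in> piece4 i" by (auto simp: e_def piece4_def zero_prod_def)
    show "(\<forall>i. e i \<in> piece4 i) \<and> finite {i. e i \<noteq> 0} \<and> x = (\<Sum>i | e i \<noteq> 0. e i)"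
      unfolding sum[OF e] using e fin[OF e] by (auto simp: e_def x)
  next
    fix c :: "nat \<Rightarrow> ('r, 'a1, 'a2, 'a3, 'a4) total4"
    assume "(\<forall>i. c i \<in> piece4 i) \<and> finite {i. c i \<noteq> 0} \<and> x = (\<Sum>i | c i \<noteq> 0. c i)"
    then have c: "\<forall>i. c i \<in> piece4 i" and xc: "x = c 0 + c 1 + c 2 + c 3 + c 4"
      using sum[of c] by auto
    obtain a' where c0: "c 0 = (a', 0, 0, 0, 0)" using c[rule_format, of 0] by (auto simp: piece4_def)
    obtain x1' where c1: "c 1 = (0, x1', 0, 0, 0)" using c[rule_format, of 1] by (auto simp: piece4_def)
    obtain x2' where c2: "c 2 = (0, 0, x2', 0, 0)" using c[rule_format, of 2] by (auto simp: piece4_def)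
    obtain x3' where c3: "c 3 = (0, 0, 0, x3', 0)" using c[rule_format, of 3] by (auto simp: piece4_def)
    obtain x4' where c4: "c 4 = (0, 0, 0, 0, x4')" using c[rule_format, of 4] by (auto simp: piece4_def)
    have eqs: "a' = a" "x1' = x1" "x2' = x2" "x3' = x3" "x4' = x4"
      using xc unfolding x c0 c1 c2 c3 c4 by simp_all
    have z: "c i = 0" if "i > 4" for i using c[rule_format, of i] that
      by (auto simp: piece4_def zero_prod_def)
    show "c = e"
    proof
      fix i :: nat
      consider "i = 0" | "i = 1" | "i = 2" | "i = 3" | "i = 4" | "i > 4" by linarith
      then show "c i = e i"
        by cases (use c0 c1 c2 c3 c4 z[of i] in \<open>simp_all add: e_def eqs\<close>)
    qed
  qed
qed

lemma mult4_zero: "mult4 A x 0 = 0" "mult4 A 0 x = 0"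
  by (cases x; simp add: zero_prod_def lin mu21_def mu31_def)+

lemma leibniz23': "mu22 A (df3 A u) t = - mu13 A (df2 A t) u"
  using leibniz23 mu22_commute by metis

theorem is_dg_algebra4: "is_dg_algebra4 A"
  unfolding is_dg_algebra4_def dg_algebra_def dg_algebra_axioms_def
proof (intro conjI allI impI module_scale4 fg_free_piece4 piece4_direct_sum mult4_assoc)
  show "module_hom (scale4 A) (scale4 A) (diff4 A)"
    by (rule module_homI) (auto simp: module_scale4, auto simp: scale4_def lin)
  show "bilinear_map (scale4 A) (scale4 A) (scale4 A) (mult4 A)"
    by (rule bilinear_mapI; (rule module_scale4)?)
      (auto simp: scale4_def lin mu21_def mu31_def algebra_simps)
  show "diff4 A (diff4 A x) = 0" for x
    by (cases x) (simp add: df_df lin zero_prod_def)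
  show "mult4 A unit4 x = x" for x by (cases x) (simp add: lin mu21_def mu31_def)
  show "mult4 A x unit4 = x" for x by (cases x) (simp add: lin mu21_def mu31_def)
  show "unit4 \<in> piece4 0" by (simp add: piece4_def)
  show "diff4 A x = 0" if "x \<in> piece4 0" for x
    using that by (cases rule: piece4_cases) (auto simp: lin zero_prod_def)
  show "diff4 A x \<in> piece4 i" if "x \<in> piece4 (Suc i)" for x i
    using that by (cases rule: piece4_cases) (auto simp: lin zero_prod_def piece4_def)
  show "mult4 A x y \<in> piece4 (i + j)" if "x \<in> piece4 i" "y \<in> piece4 j" for x y i j
    using that(1) by (cases rule: piece4_cases; use that(2) in \<open>cases rule: piece4_cases\<close>)
      (auto simp: lin zero_prod_def piece4_def mu21_def mu31_def mult4_zero[unfolded zero_prod_def])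
  show "mult4 A x x = 0" if "odd i" "x \<in> piece4 i" for x i
    using that(2) by (cases rule: piece4_cases)
      (use that(1) in \<open>auto simp: lin zero_prod_def mu11_self mu21_def mu31_def\<close>)
  show "mult4 A x y = scale4 A ((-1) ^ (i * j)) (mult4 A y x)" if "x \<in> piece4 i" "y \<in> piece4 j" for x y i j
    using that(1) by (cases rule: piece4_cases; use that(2) in \<open>cases rule: piece4_cases\<close>)
      (auto simp: lin zero_prod_def scale4_def mu21_def mu31_def mult4_zero[unfolded zero_prod_def] mult.commute
        intro: mu11_anticommute mu22_commute)
  show "diff4 A (mult4 A x y) = mult4 A (diff4 A x) y + scale4 A ((-1) ^ i) (mult4 A x (diff4 A y))"
    if "x \<in> piece4 i" "y \<in> piece4 j" for x y i j
    using that(1) by (cases rule: piece4_cases; use that(2) in \<open>cases rule: piece4_cases\<close>)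
      (auto simp: lin zero_prod_def scale4_def mu21_def mu31_def mult4_zero[unfolded zero_prod_def] mult.commute
        leibniz11 leibniz12 leibniz13 leibniz22 leibniz14 leibniz23 leibniz23' mu11_anticommute[of "df2 A _"])
qed

end

section \<open>From the total algebra back to its homogeneous products\<close>

lemma is_dg_algebra4_imp_modules:
  assumes "is_dg_algebra4 A"
  shows "module (sc1 A)" "module (sc2 A)" "module (sc3 A)" "module (sc4 A)"
proof -
  have "module (scale4 A)"
    using assms by (simp add: is_dg_algebra4_def dg_algebra_def)
  note m = module_laws[OF this, unfolded scale4_def]
  have 1: "sc1 A a (x1 + y1) = sc1 A a x1 + sc1 A a y1 \<and> sc2 A a (x2 + y2) = sc2 A a x2 + sc2 A a y2 \<and>
    sc3 A a (x3 + y3) = sc3 A a x3 + sc3 A a y3 \<and> sc4 A a (x4 + y4) = sc4 A a x4 + sc4 A a y4"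
    for a x1 y1 x2 y2 x3 y3 x4 y4
    using m(1)[of a "(0, x1, x2, x3, x4)" "(0, y1, y2, y3, y4)"] by simp
  have 2: "sc1 A (a + b) x1 = sc1 A a x1 + sc1 A b x1 \<and> sc2 A (a + b) x2 = sc2 A a x2 + sc2 A b x2 \<and>
    sc3 A (a + b) x3 = sc3 A a x3 + sc3 A b x3 \<and> sc4 A (a + b) x4 = sc4 A a x4 + sc4 A b x4"
    for a b x1 x2 x3 x4
    using m(2)[of a b "(0, x1, x2, x3, x4)"] by simp
  have 3: "sc1 A a (sc1 A b x1) = sc1 A (a * b) x1 \<and> sc2 A a (sc2 A b x2) = sc2 A (a * b) x2 \<and>
    sc3 A a (sc3 A b x3) = sc3 A (a * b) x3 \<and> sc4 A a (sc4 A b x4) = sc4 A (a * b) x4"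
    for a b x1 x2 x3 x4
    using m(3)[of a b "(0, x1, x2, x3, x4)"] by simp
  have 4: "sc1 A 1 x1 = x1 \<and> sc2 A 1 x2 = x2 \<and> sc3 A 1 x3 = x3 \<and> sc4 A 1 x4 = x4" for x1 x2 x3 x4
    using m(4)[of "(0, x1, x2, x3, x4)"] by simp
  show "module (sc1 A)" "module (sc2 A)" "module (sc3 A)" "module (sc4 A)"
    using 1 2 3 4 by (simp_all add: module_def)
qed

text \<open>
  In the total multiplication \<open>mu12\<close> enters only through \<open>mu12 x\<^sub>1 y\<^sub>2 + mu12 y\<^sub>1 x\<^sub>2\<close>, and \<open>mu13\<close> only
  through \<open>mu13 x\<^sub>1 y\<^sub>3 - mu13 y\<^sub>1 x\<^sub>3\<close>. Hence the axioms determine \<open>mu12\<close> only up to a constant \<open>e\<close> with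
  \<open>e + e = 0\<close> and \<open>mu13\<close> only up to a constant, and the products at \<open>0\<close> have to be normalised.
\<close>

theorem is_dg_algebra4_imp_dga4:
  fixes A :: "('r::comm_ring_1, 'a1::ab_group_add, 'a2::ab_group_add, 'a3::ab_group_add, 'a4::ab_group_add) alg4"
  assumes A: "is_dg_algebra4 A" and norm: "mu12 A 0 0 = 0" "mu13 A 0 0 = 0"
  shows "dga4 A"
proof -
  note modules = is_dg_algebra4_imp_modules[OF A]
  note lin = module_laws[OF modules(1)] module_laws[OF modules(2)] module_laws[OF modules(3)] module_laws[OF modules(4)]
  interpret D: dg_algebra "scale4 A" piece4 "diff4 A" "mult4 A" unit4
    using A by (simp add: is_dg_algebra4_def)
  note ms = D.module_axioms
  note d = module_hom_laws[OF D.d_linear]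
  note mu = bilinear_map_laws[OF D.mult_bilinear]
  have dhom: "module_hom (sc1 A) (*) (df1 A)" "module_hom (sc2 A) (sc1 A) (df2 A)"
      "module_hom (sc3 A) (sc2 A) (df3 A)" "module_hom (sc4 A) (sc3 A) (df4 A)"
    using d(1)[of "(0, x1, x2, x3, x4)" "(0, y1, y2, y3, y4)" for x1 x2 x3 x4 y1 y2 y3 y4]
      d(2)[of a "(0, x1, x2, x3, x4)" for a x1 x2 x3 x4]
    by (auto intro!: module_homI modules module_ring simp: scale4_def)
  note lin = lin module_hom_laws[OF dhom(1)] module_hom_laws[OF dhom(2)] module_hom_laws[OF dhom(3)] module_hom_laws[OF dhom(4)]
  \<comment> \<open>A component of the total product is a sum of several homogeneous products. These
    must first be shown to vanish when an argument is 0; only then can each of them be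
    isolated.\<close>
  have z12: "mu12 A x 0 = 0" "mu12 A 0 t = 0" for x t
    using mu(8)[of "(0, x, 0, 0, 0)"] mu(8)[of "(0, 0, t, 0, 0)"] norm
    by (auto simp: zero_prod_def lin mu21_def mu31_def)
  have z11: "mu11 A x 0 = 0" "mu11 A 0 x = 0" for x
    using mu(8)[of "(0, x, 0, 0, 0)"] mu(3)[of "(0, x, 0, 0, 0)"]
    by (auto simp: zero_prod_def lin mu21_def mu31_def)
  have z22: "mu22 A 0 0 = 0"
    using mu(8)[of 0] norm by (auto simp: zero_prod_def lin mu21_def mu31_def)
  have z: "mu13 A x 0 = 0" "mu22 A t 0 = 0" "mu22 A 0 t = 0" "mu13 A 0 u = 0" for x t u
    using mu(8)[of "(0, x, 0, 0, 0)"] mu(8)[of "(0, 0, t, 0, 0)"] mu(8)[of "(0, 0, 0, u, 0)"]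
      mu(3)[of "(0, 0, t, 0, 0)"] norm z22
    by (auto simp: zero_prod_def lin mu21_def mu31_def)
  note z = z z11 z12
  have b: "bilinear_map (sc1 A) (sc1 A) (sc2 A) (mu11 A)"
    using mu(1)[of "(0, x, 0, 0, 0)" "(0, y, 0, 0, 0)" "(0, z, 0, 0, 0)" for x y z]
      mu(2)[of _ "(0, x, 0, 0, 0)" "(0, y, 0, 0, 0)" for x y]
      mu(6)[of "(0, x, 0, 0, 0)" "(0, y, 0, 0, 0)" "(0, z, 0, 0, 0)" for x y z]
      mu(7)[of "(0, x, 0, 0, 0)" _ "(0, y, 0, 0, 0)" for x y]
    by (intro bilinear_mapI modules) (auto simp: lin scale4_def)
  have b12: "bilinear_map (sc1 A) (sc2 A) (sc3 A) (mu12 A)"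
    using mu(1)[of "(0, x, 0, 0, 0)" "(0, y, 0, 0, 0)" "(0, 0, z, 0, 0)" for x y z]
      mu(2)[of _ "(0, x, 0, 0, 0)" "(0, 0, y, 0, 0)" for x y]
      mu(6)[of "(0, x, 0, 0, 0)" "(0, 0, y, 0, 0)" "(0, 0, z, 0, 0)" for x y z]
      mu(7)[of "(0, x, 0, 0, 0)" _ "(0, 0, y, 0, 0)" for x y]
    by (intro bilinear_mapI modules) (auto simp: lin scale4_def z mu21_def)
  have b13: "bilinear_map (sc1 A) (sc3 A) (sc4 A) (mu13 A)"
    using mu(1)[of "(0, x, 0, 0, 0)" "(0, y, 0, 0, 0)" "(0, 0, 0, z, 0)" for x y z]
      mu(2)[of _ "(0, x, 0, 0, 0)" "(0, 0, 0, y, 0)" for x y]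
      mu(6)[of "(0, x, 0, 0, 0)" "(0, 0, 0, y, 0)" "(0, 0, 0, z, 0)" for x y z]
      mu(7)[of "(0, x, 0, 0, 0)" _ "(0, 0, 0, y, 0)" for x y]
    by (intro bilinear_mapI modules) (auto simp: lin scale4_def z mu21_def mu31_def)
  have b22: "bilinear_map (sc2 A) (sc2 A) (sc4 A) (mu22 A)"
    using mu(1)[of "(0, 0, x, 0, 0)" "(0, 0, y, 0, 0)" "(0, 0, z, 0, 0)" for x y z]
      mu(2)[of _ "(0, 0, x, 0, 0)" "(0, 0, y, 0, 0)" for x y]
      mu(6)[of "(0, 0, x, 0, 0)" "(0, 0, y, 0, 0)" "(0, 0, z, 0, 0)" for x y z]
      mu(7)[of "(0, 0, x, 0, 0)" _ "(0, 0, y, 0, 0)" for x y]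
    by (intro bilinear_mapI modules) (auto simp: lin scale4_def z mu21_def mu31_def)
  have p1: "(0, x, 0, 0, 0) \<in> piece4 1" and p2: "(0, 0, t, 0, 0) \<in> piece4 2"
    and p3: "(0, 0, 0, u, 0) \<in> piece4 3" and p4: "(0, 0, 0, 0, w) \<in> piece4 4" for x t u w
    by (simp_all add: piece4_def)
  note lz = lin z mu21_def mu31_def scale4_def zero_prod_def
    bilinear_map_laws[OF b] bilinear_map_laws[OF b12] bilinear_map_laws[OF b13] bilinear_map_laws[OF b22]
  have self: "mu11 A x x = 0" for x
    using D.odd_square[OF _ p1, of x] by (auto simp: lz)
  have commute22: "mu22 A s t = mu22 A t s" for s t
    using D.mult_commute[OF p2 p2, of s t] by (simp add: lz)
  let ?P = "piece4 :: nat \<Rightarrow> ('r, 'a1, 'a2, 'a3, 'a4) total4 set"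
  have f1: "fg_free (sc1 A) ((fst \<circ> snd) ` ?P 1)"
    by (rule fg_free_image[OF _ _ D.pieces])
      (auto intro!: module_homI ms[unfolded scale4_def] modules simp: inj_on_def piece4_def scale4_def)
  have f2: "fg_free (sc2 A) ((fst \<circ> snd \<circ> snd) ` ?P 2)"
    by (rule fg_free_image[OF _ _ D.pieces])
      (auto intro!: module_homI ms[unfolded scale4_def] modules simp: inj_on_def piece4_def scale4_def)
  have f3: "fg_free (sc3 A) ((fst \<circ> snd \<circ> snd \<circ> snd) ` ?P 3)"
    by (rule fg_free_image[OF _ _ D.pieces])
      (auto intro!: module_homI ms[unfolded scale4_def] modules simp: inj_on_def piece4_def scale4_def)
  have f4: "fg_free (sc4 A) ((snd \<circ> snd \<circ> snd \<circ> snd) ` ?P 4)"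
    by (rule fg_free_image[OF _ _ D.pieces])
      (auto intro!: module_homI ms[unfolded scale4_def] modules simp: inj_on_def piece4_def scale4_def)
  have im: "(fst \<circ> snd) ` (piece4 1 :: ('r, 'a1, 'a2, 'a3, 'a4) total4 set) = UNIV"
    "(fst \<circ> snd \<circ> snd) ` (piece4 2 :: ('r, 'a1, 'a2, 'a3, 'a4) total4 set) = UNIV"
    "(fst \<circ> snd \<circ> snd \<circ> snd) ` (piece4 3 :: ('r, 'a1, 'a2, 'a3, 'a4) total4 set) = UNIV"
    "(snd \<circ> snd \<circ> snd \<circ> snd) ` (piece4 4 :: ('r, 'a1, 'a2, 'a3, 'a4) total4 set) = UNIV"
    by (auto simp: piece4_def image_def)
  note free = f1[unfolded im] f2[unfolded im] f3[unfolded im] f4[unfolded im]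
  show ?thesis
  proof (rule dga4.intro)
    show "df1 A (df2 A t) = 0" for t using D.d_d[of "(0, 0, t, 0, 0)"] by (simp add: lz)
    show "df2 A (df3 A u) = 0" for u using D.d_d[of "(0, 0, 0, u, 0)"] by (simp add: lz)
    show "df3 A (df4 A w) = 0" for w using D.d_d[of "(0, 0, 0, 0, w)"] by (simp add: lz)
    show "mu12 A z (mu11 A x y) = mu12 A x (mu11 A y z)" for x y z
      using D.mult_assoc[of "(0, x, 0, 0, 0)" "(0, y, 0, 0, 0)" "(0, z, 0, 0, 0)"] by (simp add: lz)
    show "mu22 A (mu11 A x y) t = mu13 A x (mu12 A y t)" for x y t
      using D.mult_assoc[of "(0, x, 0, 0, 0)" "(0, y, 0, 0, 0)" "(0, 0, t, 0, 0)"] by (simp add: lz)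
    show "df2 A (mu11 A x y) = sc1 A (df1 A x) y - sc1 A (df1 A y) x" for x y
      using D.leibniz[OF p1 p1, of x y] by (simp add: lz)
    show "df3 A (mu12 A x t) = sc2 A (df1 A x) t - mu11 A x (df2 A t)" for x t
      using D.leibniz[OF p1 p2, of x t] by (simp add: lz)
    show "df4 A (mu13 A x u) = sc3 A (df1 A x) u - mu12 A x (df3 A u)" for x u
      using D.leibniz[OF p1 p3, of x u] by (simp add: lz)
    show "df4 A (mu22 A s t) = mu12 A (df2 A s) t + mu12 A (df2 A t) s" for s t
      using D.leibniz[OF p2 p2, of s t] by (simp add: lz)
    show "mu13 A x (df4 A w) = sc4 A (df1 A x) w" for x w
      using D.leibniz[OF p1 p4, of x w] by (simp add: lz)
    show "mu22 A t (df3 A u) = - mu13 A (df2 A t) u" for t u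
      using D.leibniz[OF p2 p3, of t u] by (simp add: lz eq_neg_iff_add_eq_0 add.commute)
  qed (fact self commute22 free dhom b b12 b13 b22)+
qed

section \<open>Perfect pairings\<close>

text \<open>Both adjoint maps to the dual modules are bijective. Values are taken in the ring,
  through an orientation, so that pairings of K and of M, which end in different modules, can be
  added.\<close>

definition perfect ::
    "('r::comm_ring_1 \<Rightarrow> 'a::ab_group_add \<Rightarrow> 'a) \<Rightarrow> ('r \<Rightarrow> 'b::ab_group_add \<Rightarrow> 'b) \<Rightarrow> ('a \<Rightarrow> 'b \<Rightarrow> 'r) \<Rightarrow> bool"
  where "perfect s t p \<longleftrightarrow>
    (\<forall>g. module_hom t (*) g \<longrightarrow> (\<exists>!x. \<forall>y. p x y = g y)) \<and>
    (\<forall>g. module_hom s (*) g \<longrightarrow> (\<exists>!y. \<forall>x. p x y = g x))"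

lemma perfect_swap: "perfect s t p \<Longrightarrow> perfect t s (\<lambda>y x. p x y)"
  unfolding perfect_def by blast

lemma perfect_uminus:
  fixes p :: "'a::ab_group_add \<Rightarrow> 'b::ab_group_add \<Rightarrow> 'r::comm_ring_1"
  assumes "perfect s t p" "module s" "module t"
  shows "perfect s t (\<lambda>x y. - p x y)"
proof -
  have *: "- a = b \<longleftrightarrow> a = - b" for a b :: 'r by auto
  show ?thesis
    unfolding perfect_def
  proof (intro conjI allI impI)
    fix g assume "module_hom t (*) g"
    then have "module_hom t (*) (\<lambda>y. - g y)"
      by (intro module_pair.module_hom_neg) (auto simp: module_pair_def assms module_ring)
    then have "\<exists>!x. \<forall>y. p x y = - g y" using assms(1) unfolding perfect_def by blast
    then show "\<exists>!x. \<forall>y. - p x y = g y" by (simp add: *)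
  next
    fix g assume "module_hom s (*) g"
    then have "module_hom s (*) (\<lambda>y. - g y)"
      by (intro module_pair.module_hom_neg) (auto simp: module_pair_def assms module_ring)
    then have "\<exists>!y. \<forall>x. p x y = - g x" using assms(1) unfolding perfect_def by blast
    then show "\<exists>!y. \<forall>x. - p x y = g x" by (simp add: *)
  qed
qed

text \<open>A functional on a direct sum is the sum of its restrictions. Only one of the two
  adjoints is treated, so that the lemma can be applied again to the transposed pairings.\<close>

lemma perfect_prod_half:
  fixes p :: "'a::ab_group_add \<Rightarrow> 'b::ab_group_add \<Rightarrow> 'r::comm_ring_1"
    and q :: "'c::ab_group_add \<Rightarrow> 'd::ab_group_add \<Rightarrow> 'r"
  assumes p: "\<And>g. module_hom t (*) g \<Longrightarrow> \<exists>!x. \<forall>y. p x y = g y"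
    and q: "\<And>g. module_hom v (*) g \<Longrightarrow> \<exists>!x. \<forall>y. q x y = g y"
    and p0: "\<And>x. p x 0 = 0" and q0: "\<And>x. q x 0 = 0"
    and g: "module_hom (t \<oplus>\<^sub>s v) (*) g" and m: "module t" "module v"
  shows "\<exists>!x. \<forall>y. (case x of (x1, x2) \<Rightarrow> case y of (y1, y2) \<Rightarrow> p x1 y1 + q x2 y2) = g y"
proof -
  note gl = module_hom_laws[OF g]
  have g1: "module_hom t (*) (\<lambda>y. g (y, 0))"
  proof (intro module_homI m module_ring)
    show "g (x + y, 0) = g (x, 0) + g (y, 0)" for x y using gl(1)[of "(x, 0)" "(y, 0)"] by simp
    show "g (t a x, 0) = a * g (x, 0)" for a x
      using gl(2)[of a "(x, 0)"] by (simp add: module_laws[OF m(2)])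
  qed
  have g2: "module_hom v (*) (\<lambda>y. g (0, y))"
  proof (intro module_homI m module_ring)
    show "g (0, x + y) = g (0, x) + g (0, y)" for x y using gl(1)[of "(0, x)" "(0, y)"] by simp
    show "g (0, v a x) = a * g (0, x)" for a x
      using gl(2)[of a "(0, x)"] by (simp add: module_laws[OF m(1)])
  qed
  have gs: "g (y1, y2) = g (y1, 0) + g (0, y2)" for y1 y2 using gl(1)[of "(y1, 0)" "(0, y2)"] by simp
  obtain x1 where x1: "\<forall>y. p x1 y = g (y, 0)" "\<And>x. \<forall>y. p x y = g (y, 0) \<Longrightarrow> x = x1"
    using p[OF g1] by blast
  obtain x2 where x2: "\<forall>y. q x2 y = g (0, y)" "\<And>x. \<forall>y. q x y = g (0, y) \<Longrightarrow> x = x2"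
    using q[OF g2] by blast
  show ?thesis
  proof (rule ex1I[of _ "(x1, x2)"])
    show "\<forall>y. (case (x1, x2) of (x1, x2) \<Rightarrow> case y of (y1, y2) \<Rightarrow> p x1 y1 + q x2 y2) = g y"
    proof
      fix y show "(case (x1, x2) of (x1, x2) \<Rightarrow> case y of (y1, y2) \<Rightarrow> p x1 y1 + q x2 y2) = g y"
        using x1(1) x2(1) by (cases y) (metis gs prod.case)
    qed
  next
    fix x assume x: "\<forall>y. (case x of (x1, x2) \<Rightarrow> case y of (y1, y2) \<Rightarrow> p x1 y1 + q x2 y2) = g y"
    have "p (fst x) y = g (y, 0)" for y using x[rule_format, of "(y, 0)"] q0 by (auto simp: case_prod_beta)
    moreover have "q (snd x) y = g (0, y)" for y using x[rule_format, of "(0, y)"] p0 by (auto simp: case_prod_beta)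
    ultimately show "x = (x1, x2)" using x1(2)[of "fst x"] x2(2)[of "snd x"] by (simp add: prod_eq_iff)
  qed
qed

lemma perfect_prod:
  assumes p: "perfect s t p" and q: "perfect u v q"
    and p0: "\<And>x. p x 0 = 0" "\<And>y. p 0 y = 0" and q0: "\<And>x. q x 0 = 0" "\<And>y. q 0 y = 0"
    and m: "module s" "module t" "module u" "module v"
  shows "perfect (s \<oplus>\<^sub>s u) (t \<oplus>\<^sub>s v) (\<lambda>(x1, x2) (y1, y2). p x1 y1 + q x2 y2)"
  unfolding perfect_def
proof (intro conjI allI impI)
  fix g assume g: "module_hom (t \<oplus>\<^sub>s v) (*) g"
  have "\<exists>!x. \<forall>y. (case x of (x1, x2) \<Rightarrow> case y of (y1, y2) \<Rightarrow> p x1 y1 + q x2 y2) = g y"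
    by (rule perfect_prod_half[where p = p and q = q])
      (use p q p0 q0 g m in \<open>auto simp: perfect_def\<close>)
  then show "\<exists>!x. \<forall>y. (case x of (x1, x2) \<Rightarrow> \<lambda>(y1, y2). p x1 y1 + q x2 y2) y = g y"
    by (simp add: case_prod_beta)
next
  fix g assume g: "module_hom (s \<oplus>\<^sub>s u) (*) g"
  have "\<exists>!x. \<forall>y. (case x of (x1, x2) \<Rightarrow> case y of (y1, y2) \<Rightarrow> p y1 x1 + q y2 x2) = g y"
    by (rule perfect_prod_half[where p = "\<lambda>x y. p y x" and q = "\<lambda>x y. q y x"])
      (use p q p0 q0 g m in \<open>auto simp: perfect_def\<close>)
  then show "\<exists>!y. \<forall>x. (case x of (x1, x2) \<Rightarrow> \<lambda>(y1, y2). p x1 y1 + q x2 y2) y = g x"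
    by (simp add: case_prod_beta)
qed

lemma orientation_laws:
  assumes "is_orientation s br"
  shows "br (x + y) = br x + br y" "br (s a x) = a * br x" "br 0 = 0" "br (- x) = - br x" "br (x - y) = br x - br y"
    and "br x = br y \<longleftrightarrow> x = y"
proof -
  have "module_hom s (*) br" "inj br" using assms by (auto simp: is_orientation_def bij_def)
  from module_hom_laws[OF this(1)] inj_eq[OF this(2)]
  show "br (x + y) = br x + br y" "br (s a x) = a * br x" "br 0 = 0" "br (- x) = - br x"
    "br (x - y) = br x - br y" "br x = br y \<longleftrightarrow> x = y" by blast+
qed

text \<open>Both \<open>x\<close> and \<open>x'\<close> represent the functional \<open>p x\<close>,
  and representatives are unique. This is how equations in lower degrees are tested by
  multiplication into the top degree.\<close>

lemma perfect_eqI: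
  assumes "perfect s t p" "module_hom t (*) (p x)" "\<And>y. p x y = p x' y"
  shows "x = x'"
proof -
  have "\<exists>!x'. \<forall>y. p x' y = p x y" using assms(1,2) unfolding perfect_def by blast
  moreover have "\<forall>y. p x y = p x y" "\<forall>y. p x' y = p x y" using assms(3) by simp_all
  ultimately show ?thesis by blast
qed

section \<open>Poincare duality, degree by degree\<close>

text \<open>A functional \<open>g\<close> on the graded piece \<open>range j\<close> with values in
  the top piece corresponds to a ring-valued \<open>g'\<close> by
  \<open>g (j y) = k (inv br (g' y))\<close>. The embeddings are parameters so that one proof covers
  all degrees and both adjoints.\<close>

lemma pairing_half_iff:
  fixes s :: "'r::comm_ring_1 \<Rightarrow> 'a::ab_group_add \<Rightarrow> 'a" and t :: "'r \<Rightarrow> 'b::ab_group_add \<Rightarrow> 'b"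
    and u :: "'r \<Rightarrow> 'c::ab_group_add \<Rightarrow> 'c" and S :: "'r \<Rightarrow> 'x::ab_group_add \<Rightarrow> 'x"
  assumes j: "module_hom t S j" and k: "module_hom u S k" and inj: "inj i" "inj j" "inj k"
    and br: "is_orientation u br" and mult: "\<And>x y. mult (i x) (j y) = k (p x y)"
  shows "(\<forall>g. linear_on S S (range j) (range k) g \<longrightarrow> (\<exists>!x. x \<in> range i \<and> (\<forall>y\<in>range j. mult x y = g y))) \<longleftrightarrow>
    (\<forall>g. module_hom t (*) g \<longrightarrow> (\<exists>!x. \<forall>y. br (p x y) = g y))" (is "?L = ?R")
proof -
  note jl = module_hom_laws[OF j] and kl = module_hom_laws[OF k] and bl = orientation_laws[OF br]
  have bij: "bij br" using br by (simp add: is_orientation_def)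
  have bi: "br (inv br a) = a" "inv br (br w) = w" for a w
    using bij by (simp_all add: bij_is_surj surj_f_inv_f bij_is_inj)
  have key: "(\<exists>!x. x \<in> range i \<and> (\<forall>y\<in>range j. mult x y = g y)) \<longleftrightarrow> (\<exists>!x. \<forall>y. br (p x y) = g' y)"
    if g: "\<And>y. g (j y) = k (inv br (g' y))" for g g'
  proof -
    have "(\<forall>y\<in>range j. mult (i x) y = g y) \<longleftrightarrow> (\<forall>y. br (p x y) = g' y)" for x
    proof -
      have "mult (i x) (j y) = g (j y) \<longleftrightarrow> br (p x y) = g' y" for y
      proof -
        have "mult (i x) (j y) = g (j y) \<longleftrightarrow> br (p x y) = br (inv br (g' y))"
          unfolding mult g inj_eq[OF inj(3)] bl(6) ..
        then show ?thesis unfolding bi .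
      qed
      then show ?thesis by blast
    qed
    note eq = this
    show ?thesis
    proof
      assume "\<exists>!x. x \<in> range i \<and> (\<forall>y\<in>range j. mult x y = g y)"
      then obtain x where x: "\<forall>y\<in>range j. mult (i x) y = g y"
        and u: "\<And>x'. \<forall>y\<in>range j. mult (i x') y = g y \<Longrightarrow> i x' = i x"
        by (elim ex1E) blast
      show "\<exists>!x. \<forall>y. br (p x y) = g' y"
        by (rule ex1I[of _ x]) (use x u eq injD[OF inj(1)] in blast)+
    next
      assume "\<exists>!x. \<forall>y. br (p x y) = g' y"
      then obtain x where x: "\<forall>y. br (p x y) = g' y" and u: "\<And>x'. \<forall>y. br (p x' y) = g' y \<Longrightarrow> x' = x"
        by blast
      show "\<exists>!x. x \<in> range i \<and> (\<forall>y\<in>range j. mult x y = g y)"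
        by (rule ex1I[of _ "i x"]) (use x u eq in blast)+
    qed
  qed
  show ?thesis
  proof
    assume L: ?L
    show ?R
    proof (intro allI impI)
      fix g' assume g': "module_hom t (*) g'"
      note gl = module_hom_laws[OF g']
      let ?g = "\<lambda>z. k (inv br (g' (inv j z)))"
      have ij: "inv j (j y) = y" for y using inj(2) by simp
      have ja: "j x + j y = j (x + y)" "S a (j x) = j (t a x)" for x y a by (simp_all add: jl)
      have ib: "inv br (a + b) = inv br a + inv br b" "inv br (a * b) = u a (inv br b)" for a b
        by (subst bl(6)[symmetric], simp only: bi bl(1-5))+
      have "linear_on S S (range j) (range k) ?g"
        by (auto simp: linear_on_def ja ij gl ib kl)
      then have "\<exists>!x. x \<in> range i \<and> (\<forall>y\<in>range j. mult x y = ?g y)" using L by blast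
      then show "\<exists>!x. \<forall>y. br (p x y) = g' y" using key[of ?g g'] ij by simp
    qed
  next
    assume R: ?R
    show ?L
    proof (intro allI impI)
      fix g assume g: "linear_on S S (range j) (range k) g"
      let ?g = "\<lambda>y. br (inv k (g (j y)))"
      have ki: "k (inv k (g (j y))) = g (j y)" for y
        using g by (auto simp: linear_on_def intro!: f_inv_into_f)
      have "module_hom t (*) ?g"
      proof (intro module_homI module_ring)
        show "module t" using j by (rule module_hom_modules)
        have a: "inv k (g (j (x + y))) = inv k (g (j x)) + inv k (g (j y))" for x y
          by (rule injD[OF inj(3)], unfold ki kl(1,2)) (use g in \<open>simp add: jl linear_on_def\<close>)
        show "?g (x + y) = ?g x + ?g y" for x y by (simp add: a bl)
        have a: "inv k (g (j (t a x))) = u a (inv k (g (j x)))" for a x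
          by (rule injD[OF inj(3)], unfold ki kl(1,2)) (use g in \<open>simp add: jl linear_on_def\<close>)
        show "?g (t a x) = a * ?g x" for a x by (simp add: a bl)
      qed
      then have "\<exists>!x. \<forall>y. br (p x y) = ?g y" using R by blast
      then show "\<exists>!x. x \<in> range i \<and> (\<forall>y\<in>range j. mult x y = g y)"
        using key[of g ?g] ki bi by simp
    qed
  qed
qed

lemma perfect_pairing_on_iff:
  assumes "module_hom s S i" "module_hom t S j" "module_hom u S k" "inj i" "inj j" "inj k"
    and "is_orientation u br" "\<And>x y. mult (i x) (j y) = k (p x y)"
  shows "perfect_pairing_on S (range i) (range j) (range k) mult \<longleftrightarrow> perfect s t (\<lambda>x y. br (p x y))"
  unfolding perfect_pairing_on_def perfect_def
  using pairing_half_iff[of t S j u k i br mult p] pairing_half_iff[of s S i u k j br "\<lambda>y x. mult x y" "\<lambda>y x. p x y"]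
    assms by simp

lemma perfect_scale:
  assumes m: "module u" and br: "is_orientation u br"
  shows "perfect (*) u (\<lambda>a w. br (u a w))"
proof -
  note bl = orientation_laws[OF br]
  have "surj br" using br by (simp add: is_orientation_def bij_is_surj)
  then obtain e where e: "br e = 1" by (metis surj_def)
  \<comment> \<open>An element of orientation 1 generates the top module, with \<open>br\<close> as
    coordinate.\<close>
  have we: "w = u (br w) e" for w by (subst bl(6)[symmetric]) (simp add: bl(1-5) e)
  show ?thesis unfolding perfect_def
  proof (intro conjI allI impI)
    fix g assume "module_hom u (*) g"
    note gl = module_hom_laws[OF this]
    show "\<exists>!a. \<forall>w. br (u a w) = g w"
    proof (rule ex1I[of _ "g e"])
      show "\<forall>w. br (u (g e) w) = g w"
      proof
        fix w
        have "g w = br w * g e" by (subst we[of w]) (simp add: gl)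
        then show "br (u (g e) w) = g w" by (simp add: bl mult.commute)
      qed
      fix a assume "\<forall>w. br (u a w) = g w"
      from this[rule_format, of e] show "a = g e" by (simp add: bl e)
    qed
  next
    fix g :: "'a \<Rightarrow> 'a" assume "module_hom (*) (*) g"
    note gl = module_hom_laws[OF this]
    show "\<exists>!w. \<forall>a. br (u a w) = g a"
    proof (rule ex1I[of _ "u (g 1) e"])
      show "\<forall>a. br (u a (u (g 1) e)) = g a"
      proof
        fix a show "br (u a (u (g 1) e)) = g a" using gl(2)[of a 1] by (simp add: bl e)
      qed
      fix w assume "\<forall>a. br (u a w) = g a"
      from this[rule_format, of 1] show "w = u (g 1) e" using we[of w] by (simp add: module_laws[OF m])
    qed
  qed
qed

context dga4
begin

lemma piece4_perfect_pairing_iff: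
  fixes br :: "'a4 \<Rightarrow> 'r"
  assumes br: "is_orientation (sc4 A) br"
  shows "perfect_pairing_on (scale4 A) (piece4 0) (piece4 4) (piece4 4) (mult4 A)"
    and "perfect_pairing_on (scale4 A) (piece4 4) (piece4 0) (piece4 4) (mult4 A)"
    and "perfect_pairing_on (scale4 A) (piece4 1) (piece4 3) (piece4 4) (mult4 A) \<longleftrightarrow>
      perfect (sc1 A) (sc3 A) (\<lambda>x u. br (mu13 A x u))"
    and "perfect_pairing_on (scale4 A) (piece4 2) (piece4 2) (piece4 4) (mult4 A) \<longleftrightarrow>
      perfect (sc2 A) (sc2 A) (\<lambda>s t. br (mu22 A s t))"
    and "perfect_pairing_on (scale4 A) (piece4 3) (piece4 1) (piece4 4) (mult4 A) \<longleftrightarrow>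
      perfect (sc3 A) (sc1 A) (\<lambda>u x. br (- mu13 A x u))"
proof -
  let ?T = "piece4 :: nat \<Rightarrow> ('r, 'a1, 'a2, 'a3, 'a4) total4 set"
  have r: "?T 0 = range (\<lambda>x. (x, 0, 0, 0, 0))" "?T 1 = range (\<lambda>x. (0, x, 0, 0, 0))"
    "?T 2 = range (\<lambda>x. (0, 0, x, 0, 0))" "?T 3 = range (\<lambda>x. (0, 0, 0, x, 0))" "?T 4 = range (\<lambda>x. (0, 0, 0, 0, x))"
    by (auto simp: piece4_def)
  note m = module_scale4[unfolded scale4_def]
  note h = module_homI modules module_ring m
  have p: "perfect (*) (sc4 A) (\<lambda>a w. br (sc4 A a w))" by (rule perfect_scale[OF modules(4) br])
  show "perfect_pairing_on (scale4 A) (?T 0) (?T 4) (?T 4) (mult4 A)"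
    unfolding r
    by (subst perfect_pairing_on_iff[where s = "(*)" and t = "sc4 A" and u = "sc4 A" and br = br
          and p = "\<lambda>a w. sc4 A a w"])
      (use p in \<open>auto intro!: h br simp: scale4_def inj_on_def lin mu21_def mu31_def\<close>)
  show "perfect_pairing_on (scale4 A) (?T 4) (?T 0) (?T 4) (mult4 A)"
    unfolding r
    by (subst perfect_pairing_on_iff[where t = "(*)" and s = "sc4 A" and u = "sc4 A" and br = br
          and p = "\<lambda>w a. sc4 A a w"])
      (use perfect_swap[OF p] in \<open>auto intro!: h br simp: scale4_def inj_on_def lin mu21_def mu31_def\<close>)
  show "perfect_pairing_on (scale4 A) (?T 1) (?T 3) (?T 4) (mult4 A) \<longleftrightarrow>
      perfect (sc1 A) (sc3 A) (\<lambda>x u. br (mu13 A x u))"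
    unfolding r
    by (rule perfect_pairing_on_iff)
      (auto intro!: h br simp: scale4_def inj_on_def lin mu21_def mu31_def)
  show "perfect_pairing_on (scale4 A) (?T 2) (?T 2) (?T 4) (mult4 A) \<longleftrightarrow>
      perfect (sc2 A) (sc2 A) (\<lambda>s t. br (mu22 A s t))"
    unfolding r
    by (rule perfect_pairing_on_iff)
      (auto intro!: h br simp: scale4_def inj_on_def lin mu21_def mu31_def)
  show "perfect_pairing_on (scale4 A) (?T 3) (?T 1) (?T 4) (mult4 A) \<longleftrightarrow>
      perfect (sc3 A) (sc1 A) (\<lambda>u x. br (- mu13 A x u))"
    unfolding r
    by (rule perfect_pairing_on_iff)
      (auto intro!: h br simp: scale4_def inj_on_def lin mu21_def mu31_def)
qed

theorem has_poincare_duality4I: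
  fixes br :: "'a4 \<Rightarrow> 'r"
  assumes br: "is_orientation (sc4 A) br"
    and p: "perfect (sc1 A) (sc3 A) (\<lambda>x u. br (mu13 A x u))" "perfect (sc2 A) (sc2 A) (\<lambda>s t. br (mu22 A s t))"
  shows "has_poincare_duality4 A"
  unfolding has_poincare_duality4_def exhibits_poincare_duality_def
proof (intro exI[of _ "4::nat"] conjI allI impI)
  note bl = orientation_laws[OF br]
  let ?T = "piece4 :: nat \<Rightarrow> ('r, 'a1, 'a2, 'a3, 'a4) total4 set"
  show "?T i = {0}" if "4 < i" for i using that by (auto simp: piece4_def zero_prod_def)
  have "bij br" using br by (simp add: is_orientation_def)
  moreover have "bij_betw (snd \<circ> snd \<circ> snd \<circ> snd) (?T 4) UNIV"
    by (auto simp: bij_betw_def inj_on_def piece4_def image_def)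
  ultimately have "bij_betw (br \<circ> (snd \<circ> snd \<circ> snd \<circ> snd)) (?T 4) UNIV"
    using bij_betw_trans by blast
  moreover have "linear_on (scale4 A) (*) (?T 4) UNIV (br \<circ> (snd \<circ> snd \<circ> snd \<circ> snd))"
    by (auto simp: linear_on_def scale4_def bl)
  ultimately show "\<exists>\<phi>. linear_on (scale4 A) (*) (?T 4) UNIV \<phi> \<and> bij_betw \<phi> (?T 4) UNIV" by blast
  have 3: "perfect (sc3 A) (sc1 A) (\<lambda>u x. br (- mu13 A x u))"
    using perfect_uminus[OF perfect_swap[OF p(1)] modules(3,1)] by (simp add: bl)
  show "perfect_pairing_on (scale4 A) (?T i) (?T (4 - i)) (?T 4) (mult4 A)" if "i \<le> 4" for i
  proof -
    have i: "i = 0 \<or> i = 1 \<or> i = 2 \<or> i = 3 \<or> i = 4" using that by linarith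
    show ?thesis using i
      by (elim disjE) (use piece4_perfect_pairing_iff[OF br] p 3 in simp_all)
  qed
qed

text \<open>The top degree m is only asserted to exist, so m = 4 has to be proved. For m < 4 the
  piece of degree 4 would be zero although \<open>br\<close> maps it onto the ring; for m > 4 the
  zero piece of degree m would be isomorphic to the ring. Both are absurd over a nontrivial
  ring.\<close>

theorem has_poincare_duality4D:
  fixes br :: "'a4 \<Rightarrow> 'r"
  assumes pd: "has_poincare_duality4 A" and br: "is_orientation (sc4 A) br" and nontrivial: "(1::'r) \<noteq> 0"
  shows "perfect (sc1 A) (sc3 A) (\<lambda>x u. br (mu13 A x u))" "perfect (sc2 A) (sc2 A) (\<lambda>s t. br (mu22 A s t))"
proof -
  let ?T = "piece4 :: nat \<Rightarrow> ('r, 'a1, 'a2, 'a3, 'a4) total4 set"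
  obtain m and \<phi> :: "('r, 'a1, 'a2, 'a3, 'a4) total4 \<Rightarrow> 'r" where m: "\<forall>i>m. ?T i = {0}" "bij_betw \<phi> (?T m) UNIV"
    and pp: "\<forall>i\<le>m. perfect_pairing_on (scale4 A) (?T i) (?T (m - i)) (?T m) (mult4 A)"
    using pd unfolding has_poincare_duality4_def exhibits_poincare_duality_def by blast
  have "\<not> m < 4"
  proof
    assume "m < 4"
    then have z: "?T 4 = {0}" using m(1) by blast
    have "w = 0" for w :: 'a4
    proof -
      have "(0, 0, 0, 0, w) \<in> ?T 4" by (simp add: piece4_def)
      then show ?thesis unfolding z by (simp add: zero_prod_def)
    qed
    then have "br e = br e'" for e e' by metis
    moreover have "surj br" using br by (simp add: is_orientation_def bij_is_surj)
    then obtain e e' where "br e = 1" "br e' = 0" by (metis surj_def)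
    ultimately show False using nontrivial by metis
  qed
  moreover have "\<not> m > 4"
  proof
    assume "m > 4"
    then have "?T m = {0}" by (auto simp: piece4_def zero_prod_def)
    then have "(UNIV :: 'r set) = {\<phi> 0}" using m(2) by (auto simp: bij_betw_def)
    then show False using nontrivial by (metis UNIV_I singletonD)
  qed
  ultimately have "m = 4" by simp
  then have "perfect_pairing_on (scale4 A) (?T 1) (?T 3) (?T 4) (mult4 A)"
    "perfect_pairing_on (scale4 A) (?T 2) (?T 2) (?T 4) (mult4 A)"
    using pp[rule_format, of 1] pp[rule_format, of 2] by simp_all
  then show "perfect (sc1 A) (sc3 A) (\<lambda>x u. br (mu13 A x u))" "perfect (sc2 A) (sc2 A) (\<lambda>s t. br (mu22 A s t))"
    using piece4_perfect_pairing_iff[OF br] by simp_all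
qed

end

section \<open>Dual generating triples\<close>

definition generated3 ::
    "('r::comm_ring_1 \<Rightarrow> 'a::ab_group_add \<Rightarrow> 'a) \<Rightarrow> 'a \<Rightarrow> 'a \<Rightarrow> 'a \<Rightarrow> bool"
  where "generated3 s e0 e1 e2 \<longleftrightarrow> (\<forall>x. \<exists>a b c. x = s a e0 + s b e1 + s c e2)"

text \<open>Generating triples whose matrix of pairings is a unit \<open>v\<close> times the
  identity. A unit is allowed instead of 1 because an orientation of K_3 sends the product of three
  basis elements to an arbitrary unit.\<close>

locale dual_triples =
  fixes s :: "'r::comm_ring_1 \<Rightarrow> 'a::ab_group_add \<Rightarrow> 'a" and t :: "'r \<Rightarrow> 'b::ab_group_add \<Rightarrow> 'b"
    and p :: "'a \<Rightarrow> 'b \<Rightarrow> 'r" and e0 e1 e2 E0 E1 E2 and v w :: 'r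
  assumes modules: "module s" "module t" and p: "bilinear_map s t (*) p"
    and gen: "generated3 s e0 e1 e2" "generated3 t E0 E1 E2"
    and dual: "p e0 E0 = v" "p e0 E1 = 0" "p e0 E2 = 0"
      "p e1 E0 = 0" "p e1 E1 = v" "p e1 E2 = 0"
      "p e2 E0 = 0" "p e2 E1 = 0" "p e2 E2 = v"
    and unit: "w * v = 1"
begin

lemma swap: "dual_triples t s (\<lambda>y x. p x y) E0 E1 E2 e0 e1 e2 v w"
  using modules p gen dual unit by unfold_locales (auto simp: bilinear_map_def module_laws)

lemma perfect_half:
  assumes g: "module_hom t (*) g"
  shows "\<exists>!x. \<forall>y. p x y = g y"
proof (rule ex1I[of _ "s (w * g E0) e0 + s (w * g E1) e1 + s (w * g E2) e2"])
  note pl = bilinear_map_laws[OF p]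
  note gl = module_hom_laws[OF g]
  have u: "a * (w * c) * v = a * c" "w * c * v = c" "w * (c * v) = c" for a c
    using unit by (metis mult.assoc mult.commute mult.left_neutral)+
  show "\<forall>y. p (s (w * g E0) e0 + s (w * g E1) e1 + s (w * g E2) e2) y = g y"
  proof
    fix y
    obtain a b c where y: "y = t a E0 + t b E1 + t c E2" using gen(2) unfolding generated3_def by blast
    show "p (s (w * g E0) e0 + s (w * g E1) e1 + s (w * g E2) e2) y = g y"
      unfolding y by (simp add: pl gl dual u)
  qed
  fix x assume x: "\<forall>y. p x y = g y"
  obtain a b c where y: "x = s a e0 + s b e1 + s c e2" using gen(1) unfolding generated3_def by blast
  have "g E0 = a * v" "g E1 = b * v" "g E2 = c * v"
    unfolding x[rule_format, symmetric] y by (simp_all add: pl dual)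
  then show "x = s (w * g E0) e0 + s (w * g E1) e1 + s (w * g E2) e2" unfolding y by (simp add: u)
qed

lemma perfect: "perfect s t p"
  unfolding perfect_def using perfect_half dual_triples.perfect_half[OF swap] by blast

text \<open>Pairing a combination of the \<open>E\<close>s with \<open>e0\<close>,
  \<open>e1\<close>, \<open>e2\<close> reads off its coefficients times \<open>v\<close>.
  Nontriviality makes the three generators distinct, so that they form a set of three
  elements.\<close>

lemma fg_free_right: "fg_free t UNIV" if nontrivial: "(1::'r) \<noteq> 0"
proof -
  note pl = bilinear_map_laws[OF p]
  have v: "v \<noteq> 0" using unit nontrivial by auto
  have d: "E0 \<noteq> E1" "E0 \<noteq> E2" "E1 \<noteq> E2" using dual v by auto
  show ?thesis unfolding fg_free_def
  proof (intro exI conjI)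
    show "has_basis t UNIV {E0, E1, E2}"
    proof (subst has_basis_iff)
      have sum: "(\<Sum>b\<in>{E0, E1, E2}. t (u b) b) = t (u E0) E0 + t (u E1) E1 + t (u E2) E2" for u
        using d by (simp add: add.assoc)
      have cancel: "a = 0" if "a * v = 0" for a
      proof -
        have "a = w * (a * v)" using unit by (metis mult.assoc mult.commute mult.left_neutral)
        then show ?thesis using that by simp
      qed
      show "(\<forall>u. (\<Sum>b\<in>{E0, E1, E2}. t (u b) b) = 0 \<longrightarrow> (\<forall>b\<in>{E0, E1, E2}. u b = 0)) \<and>
        UNIV = range (\<lambda>u. \<Sum>b\<in>{E0, E1, E2}. t (u b) b)"
        unfolding sum
      proof (intro conjI allI impI)
        fix u assume z: "t (u E0) E0 + t (u E1) E1 + t (u E2) E2 = 0"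
        have "p e0 (t (u E0) E0 + t (u E1) E1 + t (u E2) E2) = 0"
          "p e1 (t (u E0) E0 + t (u E1) E1 + t (u E2) E2) = 0"
          "p e2 (t (u E0) E0 + t (u E1) E1 + t (u E2) E2) = 0" unfolding z by (simp_all add: pl)
        then show "\<forall>b\<in>{E0, E1, E2}. u b = 0" by (simp add: pl(6,7) dual cancel)
      next
        show "UNIV = range (\<lambda>u. t (u E0) E0 + t (u E1) E1 + t (u E2) E2)"
        proof (intro equalityI subsetI)
          fix y
          obtain a b c where y: "y = t a E0 + t b E1 + t c E2" using gen(2) unfolding generated3_def by blast
          show "y \<in> range (\<lambda>u. t (u E0) E0 + t (u E1) E1 + t (u E2) E2)"
            by (rule image_eqI[of _ _ "\<lambda>z. if z = E0 then a else if z = E1 then b else c"])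
              (use d in \<open>auto simp: y\<close>)
        qed simp
      qed
    qed (use modules in auto)
  qed simp
qed

end

section \<open>The Koszul complex\<close>

locale koszul =
  fixes K :: "('r::comm_ring_1, 'k1::ab_group_add, 'k2::ab_group_add, 'k3::ab_group_add) alg3"
    and xs :: "'r list" and brK :: "'k3 \<Rightarrow> 'r"
  assumes K: "koszul3 K xs" and regular: "regular_sequence xs" and brK: "is_orientation (sc3 K) brK"
begin

lemma square: "is_exterior_square (sc1 K) (sc2 K) (mu11 K)"
  and cube: "is_exterior_cube (sc1 K) (sc3 K) (\<lambda>x y z. mu12 K x (mu11 K y z))"
  using K unfolding koszul3_def by blast+

lemma hom: "module_hom (sc1 K) (*) (df1 K)" "module_hom (sc2 K) (sc1 K) (df2 K)" "module_hom (sc3 K) (sc2 K) (df3 K)"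
  using K unfolding koszul3_def by blast+

lemma modules: "module (sc1 K)" "module (sc2 K)" "module (sc3 K)"
  using hom module_hom_modules by blast+

lemma bilinear: "bilinear_map (sc1 K) (sc1 K) (sc2 K) (mu11 K)" "bilinear_map (sc1 K) (sc2 K) (sc3 K) (mu12 K)"
  using K exterior_square_alternating(1)[OF square modules(1)] unfolding koszul3_def by blast+

lemmas lin =
  module_laws[OF modules(1)] module_laws[OF modules(2)] module_laws[OF modules(3)]
  module_hom_laws[OF hom(1)] module_hom_laws[OF hom(2)] module_hom_laws[OF hom(3)]
  bilinear_map_laws[OF bilinear(1)] bilinear_map_laws[OF bilinear(2)]

lemma mu11_self: "mu11 K x x = 0"
  by (rule exterior_square_alternating(2)[OF square modules(1)])

lemma mu11_anticommute: "mu11 K y x = - mu11 K x y"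
  by (rule alternating_anticommute) (simp_all add: lin mu11_self)

lemma mu12_mu11_anticommute: "mu12 K y (mu11 K x z) = - mu12 K x (mu11 K y z)"
  by (rule alternating_anticommute[of "\<lambda>x y. mu12 K x (mu11 K y z)"])
    (simp_all add: lin exterior_cube_alternating[OF cube])

lemma assoc111: "mu12 K z (mu11 K x y) = mu12 K x (mu11 K y z)"
  using mu12_mu11_anticommute[of z x y] mu11_anticommute[of z y] by (simp add: lin)

lemma mu12_mu11_self: "mu12 K x (mu11 K x y) = 0" "mu12 K x (mu11 K y x) = 0" "mu12 K x (mu11 K y y) = 0"
  by (rule exterior_cube_alternating[OF cube])+

lemma leibniz11: "df2 K (mu11 K x y) = sc1 K (df1 K x) y - sc1 K (df1 K y) x"
  using K unfolding koszul3_def by blast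

lemma df3_mu12_mu11:
  "df3 K (mu12 K x (mu11 K y z)) =
    sc2 K (df1 K x) (mu11 K y z) - sc2 K (df1 K y) (mu11 K x z) + sc2 K (df1 K z) (mu11 K x y)"
  using K unfolding koszul3_def by blast

lemma K2_induct [case_names generator add]:
  assumes "\<And>x y. P (mu11 K x y)" and "\<And>a b. P a \<Longrightarrow> P b \<Longrightarrow> P (a + b)"
  shows "P t"
proof (rule presented_induct[OF square[unfolded is_exterior_square_def]])
  show "P (sc2 K a (case g of (x, y) \<Rightarrow> mu11 K x y))" for a g
    using assms(1)[of "sc1 K a (fst g)" "snd g"] by (simp add: lin case_prod_beta)
  show "P 0" using assms(1)[of 0 0] by (simp add: lin)
qed (rule assms(2))

lemma K3_induct [case_names generator add]:
  assumes "\<And>x y z. P (mu12 K x (mu11 K y z))" and "\<And>a b. P a \<Longrightarrow> P b \<Longrightarrow> P (a + b)"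
  shows "P t"
proof (rule presented_induct[OF cube[unfolded is_exterior_cube_def]])
  show "P (sc3 K a (case g of (x, y, z) \<Rightarrow> mu12 K x (mu11 K y z)))" for a g
    using assms(1)[of "sc1 K a (fst g)" "fst (snd g)" "snd (snd g)"] by (simp add: lin case_prod_beta)
  show "P 0" using assms(1)[of 0 0 0] by (simp add: lin)
qed (rule assms(2))

lemma leibniz12: "df3 K (mu12 K x t) = sc2 K (df1 K x) t - mu11 K x (df2 K t)"
  by (induction t rule: K2_induct) (simp_all add: lin df3_mu12_mu11 leibniz11 algebra_simps)

lemma df1_df2: "df1 K (df2 K t) = 0"
  by (induction t rule: K2_induct) (simp_all add: lin leibniz11)

lemma df2_df3: "df2 K (df3 K t) = 0"
  by (induction t rule: K3_induct) (simp_all add: lin df3_mu12_mu11 leibniz11 algebra_simps)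

lemma basis:
  obtains e0 e1 e2 where "generated3 (sc1 K) e0 e1 e2" "df1 K e0 = xs ! 0"
proof -
  obtain e where e: "inj_on e {..<3}" "has_basis (sc1 K) UNIV (e ` {..<3})" "\<forall>i<3. df1 K (e i) = xs ! i"
    using K unfolding koszul3_def by blast
  have s: "{..<3} = {0, 1, 2::nat}" by auto
  have u: "UNIV = range (\<lambda>u. \<Sum>b\<in>e ` {..<3}. sc1 K (u b) b)"
    using e(2) has_basis_iff[OF modules(1)] by blast
  have "\<exists>a b c. x = sc1 K a (e 0) + sc1 K b (e 1) + sc1 K c (e 2)" for x
  proof -
    obtain v where "x = (\<Sum>b\<in>e ` {..<3}. sc1 K (v b) b)" using u by blast
    then have "x = sc1 K (v (e 0)) (e 0) + sc1 K (v (e 1)) (e 1) + sc1 K (v (e 2)) (e 2)"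
      unfolding sum.reindex[OF e(1)] by (simp add: s add.assoc)
    then show ?thesis by blast
  qed
  then show thesis using that e(3) unfolding generated3_def by (metis zero_less_numeral)
qed

text \<open>A regular sequence generates a proper ideal by definition, which is impossible in the
  zero ring.\<close>

lemma nontrivial: "(1::'r) \<noteq> 0"
proof
  assume 1: "(1::'r) = 0"
  have "a \<in> ideal_generated (set xs)" for a
  proof -
    have "a = 0" using 1 by (metis mult_1 mult_zero_left)
    then show ?thesis using module.span_zero[OF module_ring] by (simp add: ideal_generated_def)
  qed
  then show False using regular unfolding regular_sequence_def by blast
qed

lemma regular_head: "xs ! 0 * a = 0 \<Longrightarrow> a = 0"
proof -
  have "0 < length xs" using K unfolding koszul3_def by simp
  then show "xs ! 0 * a = 0 \<Longrightarrow> a = 0"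
    using regular unfolding regular_sequence_def ideal_generated_def
    by (metis set_empty take0 module.span_empty[OF module_ring] singleton_iff)
qed

context
  fixes e0 e1 e2
  assumes e: "generated3 (sc1 K) e0 e1 e2"
begin

text \<open>The coefficients are the 2 by 2 minors. The cyclic order of the generators makes them
  dual to \<open>e0\<close>, \<open>e1\<close>, \<open>e2\<close> without signs.\<close>

lemma K2_generated: "generated3 (sc2 K) (mu11 K e1 e2) (mu11 K e2 e0) (mu11 K e0 e1)"
  unfolding generated3_def
proof
  fix t
  show "\<exists>a b c. t = sc2 K a (mu11 K e1 e2) + sc2 K b (mu11 K e2 e0) + sc2 K c (mu11 K e0 e1)"
  proof (induction t rule: K2_induct)
    case (generator x y)
    obtain a0 a1 a2 where x: "x = sc1 K a0 e0 + sc1 K a1 e1 + sc1 K a2 e2" using e unfolding generated3_def by blast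
    obtain b0 b1 b2 where y: "y = sc1 K b0 e0 + sc1 K b1 e1 + sc1 K b2 e2" using e unfolding generated3_def by blast
    have "mu11 K x y = sc2 K (a1 * b2 - a2 * b1) (mu11 K e1 e2) + sc2 K (a2 * b0 - a0 * b2) (mu11 K e2 e0)
        + sc2 K (a0 * b1 - a1 * b0) (mu11 K e0 e1)"
      unfolding x y
      by (simp add: lin mu11_self mu11_anticommute[of e0 e1] mu11_anticommute[of e1 e2] mu11_anticommute[of e2 e0]
          algebra_simps)
    then show ?case by blast
  next
    case (add s t)
    obtain a b c where s: "s = sc2 K a (mu11 K e1 e2) + sc2 K b (mu11 K e2 e0) + sc2 K c (mu11 K e0 e1)"
      using add by blast
    obtain a' b' c' where t: "t = sc2 K a' (mu11 K e1 e2) + sc2 K b' (mu11 K e2 e0) + sc2 K c' (mu11 K e0 e1)"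
      using add by blast
    have "s + t = sc2 K (a + a') (mu11 K e1 e2) + sc2 K (b + b') (mu11 K e2 e0) + sc2 K (c + c') (mu11 K e0 e1)"
      unfolding s t by (simp add: lin algebra_simps)
    then show ?case by blast
  qed
qed

lemma dual_basis_products:
  "mu12 K e0 (mu11 K e2 e0) = 0" "mu12 K e0 (mu11 K e0 e1) = 0"
  "mu12 K e1 (mu11 K e1 e2) = 0" "mu12 K e1 (mu11 K e2 e0) = mu12 K e0 (mu11 K e1 e2)" "mu12 K e1 (mu11 K e0 e1) = 0"
  "mu12 K e2 (mu11 K e1 e2) = 0" "mu12 K e2 (mu11 K e2 e0) = 0" "mu12 K e2 (mu11 K e0 e1) = mu12 K e0 (mu11 K e1 e2)"
  using assoc111[of e0 e1 e2] assoc111[of e2 e0 e1] by (simp_all add: mu12_mu11_self)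

lemma K3_generated: "\<exists>a. u = sc3 K a (mu12 K e0 (mu11 K e1 e2))"
proof (induction u rule: K3_induct)
  case (generator x y z)
  obtain a0 a1 a2 where x: "x = sc1 K a0 e0 + sc1 K a1 e1 + sc1 K a2 e2" using e unfolding generated3_def by blast
  obtain b0 b1 b2 where y: "mu11 K y z = sc2 K b0 (mu11 K e1 e2) + sc2 K b1 (mu11 K e2 e0) + sc2 K b2 (mu11 K e0 e1)"
    using K2_generated unfolding generated3_def by blast
  have "mu12 K x (mu11 K y z) = sc3 K (a0 * b0 + a1 * b1 + a2 * b2) (mu12 K e0 (mu11 K e1 e2))"
    unfolding x y by (simp add: lin dual_basis_products algebra_simps)
  then show ?case by blast
next
  case (add s t)
  \<comment> \<open>\<open>lin(22)\<close> is distributivity of \<open>sc3 K\<close> over a sum of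
    scalars, used to merge two multiples of the generator.\<close>
  then show ?case by (metis lin(22))
qed

lemma dual_triples:
  obtains v w where "dual_triples (sc1 K) (sc2 K) (\<lambda>x t. brK (mu12 K x t)) e0 e1 e2
    (mu11 K e1 e2) (mu11 K e2 e0) (mu11 K e0 e1) v w"
proof -
  note bl = orientation_laws[OF brK]
  have "surj brK" using brK by (simp add: is_orientation_def bij_is_surj)
  then obtain u where u: "brK u = 1" by (metis surj_def)
  \<comment> \<open>The product of the three generators generates K_3 and \<open>brK\<close> is
    onto, so its orientation is a unit; \<open>a\<close> is the inverse.\<close>
  obtain a where "u = sc3 K a (mu12 K e0 (mu11 K e1 e2))" using K3_generated by blast
  then have "a * brK (mu12 K e0 (mu11 K e1 e2)) = 1" using u by (simp add: bl)
  then have "dual_triples (sc1 K) (sc2 K) (\<lambda>x t. brK (mu12 K x t)) e0 e1 e2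
    (mu11 K e1 e2) (mu11 K e2 e0) (mu11 K e0 e1) (brK (mu12 K e0 (mu11 K e1 e2))) a"
    by unfold_locales
      (auto simp: modules module_ring e K2_generated dual_basis_products bl lin intro!: bilinear_mapI)
  then show thesis by (rule that)
qed

end

lemma perfect12: "perfect (sc1 K) (sc2 K) (\<lambda>x t. brK (mu12 K x t))"
  by (metis basis dual_triples dual_triples.perfect)

lemma free: "fg_free (sc1 K) UNIV" "fg_free (sc2 K) UNIV"
  using nontrivial basis dual_triples dual_triples.fg_free_right dual_triples.swap by metis+

text \<open>Both identities below say that a product in degree four vanishes, because the rank is three.\<close>

lemma mu12_df3: "mu12 K x (df3 K u) = sc3 K (df1 K x) u"
proof -
  obtain e0 e1 e2 where e: "generated3 (sc1 K) e0 e1 e2" by (rule basis)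
  obtain a where u: "u = sc3 K a (mu12 K e0 (mu11 K e1 e2))" using K3_generated[OF e] by blast
  obtain a0 a1 a2 where x: "x = sc1 K a0 e0 + sc1 K a1 e1 + sc1 K a2 e2" using e unfolding generated3_def by blast
  show ?thesis
    unfolding u x
    by (simp add: lin df3_mu12_mu11 dual_basis_products[OF e] mu12_mu11_self
        mu11_anticommute[of e0 e2] algebra_simps)
qed

lemma mu12_df2: "mu12 K (df2 K s) t = - mu12 K (df2 K t) s"
proof (induction s rule: K2_induct)
  case (generator a b)
  have 1: "mu12 K a (mu11 K b x) = mu12 K x (mu11 K a b)" for x using assoc111 by simp
  have "mu12 K (df2 K t) (mu11 K a b) = mu12 K a (mu11 K b (df2 K t))" by (simp add: 1)
  \<comment> \<open>The Leibniz rule trades \<open>df2 K t\<close> for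
    \<open>df3 K (mu12 K b t)\<close>, whose product with \<open>a\<close> is a scalar multiple by
    \<open>mu12_df3\<close>.\<close>
  also have "mu11 K b (df2 K t) = sc2 K (df1 K b) t - df3 K (mu12 K b t)" by (simp add: leibniz12)
  finally show ?case by (simp add: lin leibniz11 mu12_df3)
qed (simp add: lin)

lemma df3_inject: "df3 K u = df3 K u' \<Longrightarrow> u = u'"
proof -
  assume "df3 K u = df3 K u'"
  then have z: "df3 K (u - u') = 0" by (simp add: lin)
  note bl = orientation_laws[OF brK]
  obtain e0 e1 e2 where e: "df1 K e0 = xs ! 0" by (rule basis)
  \<comment> \<open>Multiplication by the basis element over the first member of the sequence turns
    the vanishing differential into a scalar equation in K_3.\<close>
  have "sc3 K (xs ! 0) (u - u') = 0" using mu12_df3[of e0 "u - u'"] unfolding z e bilinear_map_laws(8)[OF bilinear(2)] by simp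
  then have "brK (sc3 K (xs ! 0) (u - u')) = 0" by (simp only: bl)
  then have "xs ! 0 * brK (u - u') = 0" unfolding bl(2) .
  then have "brK (u - u') = 0" by (rule regular_head)
  then show "u = u'" using bl(6)[of u u'] by (simp add: bl(5))
qed

end

section \<open>The big from small construction\<close>

text \<open>The last two laws of \<open>a_mult\<close> express that K has no degree 4. In
  \<open>b_pairing\<close> the third equation has its K_1 factor moved to the left, which is free in
  K but costs a sign in M.\<close>

locale small_map = M: dga4 M + K: koszul K xs brK
  for M :: "('r::comm_ring_1, 'm1::ab_group_add, 'm2::ab_group_add, 'm3::ab_group_add, 'm4::ab_group_add) alg4"
    and K :: "('r, 'k1::ab_group_add, 'k2::ab_group_add, 'k3::ab_group_add) alg3"
    and xs :: "'r list" and brK :: "'k3 \<Rightarrow> 'r" +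
  fixes a1 :: "'k1 \<Rightarrow> 'm1" and a2 :: "'k2 \<Rightarrow> 'm2" and a3 :: "'k3 \<Rightarrow> 'm3"
    and b1 :: "'m1 \<Rightarrow> 'r" and b2 :: "'m2 \<Rightarrow> 'k1" and b3 :: "'m3 \<Rightarrow> 'k2" and b4 :: "'m4 \<Rightarrow> 'k3"
    and brM :: "'m4 \<Rightarrow> 'r" and \<eta> :: 'm4
  assumes brM: "is_orientation (sc4 M) brM" and brM_eta: "brM \<eta> = 1"
    and perfectM: "perfect (sc1 M) (sc3 M) (\<lambda>x u. brM (mu13 M x u))"
      "perfect (sc2 M) (sc2 M) (\<lambda>s t. brM (mu22 M s t))"
    and a_hom: "module_hom (sc1 K) (sc1 M) a1" "module_hom (sc2 K) (sc2 M) a2" "module_hom (sc3 K) (sc3 M) a3"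
    and df_a: "df1 M (a1 \<phi>) = df1 K \<phi>" "df2 M (a2 s) = a1 (df2 K s)" "df3 M (a3 v) = a2 (df3 K v)"
    and a_mult: "a2 (mu11 K \<phi> \<psi>) = mu11 M (a1 \<phi>) (a1 \<psi>)" "a3 (mu12 K \<phi> s) = mu12 M (a1 \<phi>) (a2 s)"
      "mu13 M (a1 \<phi>) (a3 v) = 0" "mu22 M (a2 s) (a2 s') = 0"
    and b_pairing: "brK (sc3 K (b1 x) v) = brM (mu13 M x (a3 v))"
      "brK (mu12 K (b2 t) s) = - brM (mu22 M t (a2 s))"
      "brK (mu12 K \<phi> (b3 u)) = - brM (mu13 M (a1 \<phi>) u)"
      "brK (b4 w) = - brM w"
begin

lemmas bM = orientation_laws[OF brM]
lemmas bK = orientation_laws[OF K.brK]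

lemma M1_eqI: "x = x'" if "\<And>u. mu13 M x u = mu13 M x' u"
  by (rule perfect_eqI[OF perfectM(1)])
    (auto simp: that M.lin bM intro!: module_homI M.modules module_ring)

lemma M2_eqI: "s = s'" if "\<And>t. mu22 M s t = mu22 M s' t"
  by (rule perfect_eqI[OF perfectM(2)])
    (auto simp: that M.lin bM intro!: module_homI M.modules module_ring)

lemma M3_eqI: "u = u'" if "\<And>x. mu13 M x u = mu13 M x u'"
  by (rule perfect_eqI[OF perfect_swap[OF perfectM(1)]])
    (auto simp: that M.lin bM intro!: module_homI M.modules module_ring)

lemma K1_eqI: "\<phi> = \<phi>'" if "\<And>s. mu12 K \<phi> s = mu12 K \<phi>' s"
  by (rule perfect_eqI[OF K.perfect12])
    (auto simp: that K.lin bK intro!: module_homI K.modules module_ring)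

lemma K2_eqI: "s = s'" if "\<And>\<phi>. mu12 K \<phi> s = mu12 K \<phi> s'"
  by (rule perfect_eqI[OF perfect_swap[OF K.perfect12]])
    (auto simp: that K.lin bK intro!: module_homI K.modules module_ring)

lemma b4_inject: "b4 w = b4 w' \<longleftrightarrow> w = w'"
  using bK(6)[of "b4 w" "b4 w'"] by (simp add: b_pairing bM)

lemma R_eqI: "a = a'" if "\<And>v. sc3 K a v = sc3 K a' v"
proof -
  \<comment> \<open>\<open>b4 (- \<eta>)\<close> has orientation 1, because \<open>b4\<close>
    reverses the sign of orientations.\<close>
  have "a * brK (b4 (- \<eta>)) = a' * brK (b4 (- \<eta>))" by (simp only: bK(2)[symmetric] that)
  then show ?thesis by (simp add: b_pairing(4) bM(4) brM_eta)
qed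

lemma b4_hom: "module_hom (sc4 M) (sc3 K) b4"
proof (intro module_homI M.modules K.modules)
  show "b4 (w + w') = b4 w + b4 w'" for w w'
    using bK(6)[of "b4 (w + w')" "b4 w + b4 w'"] by (simp add: bK(1-5) bM(1-5) b_pairing)
  show "b4 (sc4 M a w) = sc3 K a (b4 w)" for a w
    using bK(6)[of "b4 (sc4 M a w)" "sc3 K a (b4 w)"] by (simp add: bK(1-5) bM(1-5) b_pairing)
qed

lemmas b4_lin = module_hom_laws[OF b4_hom]

text \<open>As \<open>brK\<close> composed with \<open>b4\<close> is \<open>- brM\<close> and
  \<open>brK\<close> is injective, the defining equations of \<beta> hold in K_3 without brackets.
  In this form \<beta> is, up to sign, the adjoint of \<alpha>.\<close>

lemma b_product:
  "sc3 K (b1 x) v = - b4 (mu13 M x (a3 v))"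
  "mu12 K (b2 t) s = b4 (mu22 M t (a2 s))"
  "mu12 K \<phi> (b3 u) = b4 (mu13 M (a1 \<phi>) u)"
  by (subst bK(6)[symmetric], simp only: bK(1,3-5) b_pairing minus_minus)+

lemmas a_lin = module_hom_laws[OF a_hom(1)] module_hom_laws[OF a_hom(2)] module_hom_laws[OF a_hom(3)]

lemma b1_hom: "module_hom (sc1 M) (*) b1"
proof (intro module_homI M.modules module_ring)
  show "b1 (x + y) = b1 x + b1 y" for x y
    by (rule R_eqI) (simp add: K.lin b_product M.lin b4_lin)
  show "b1 (sc1 M a x) = a * b1 x" for a x
    by (rule R_eqI) (simp add: K.lin(3)[symmetric] K.lin(23)[symmetric] b_product M.lin b4_lin K.lin)
qed

lemma b2_hom: "module_hom (sc2 M) (sc1 K) b2"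
  by (intro module_homI M.modules K.modules; rule K1_eqI) (simp_all add: K.lin b_product M.lin b4_lin)

lemma b3_hom: "module_hom (sc3 M) (sc2 K) b3"
  by (intro module_homI M.modules K.modules; rule K2_eqI) (simp_all add: K.lin b_product M.lin b4_lin)

lemmas small_lin = M.lin K.lin a_lin b4_lin module_hom_laws[OF b1_hom] module_hom_laws[OF b2_hom] module_hom_laws[OF b3_hom]

text \<open>Projection formula: since \<alpha> is multiplicative, its adjoint \<beta> is linear over
  K up to sign. The same holds for \<open>b3_a2\<close> and \<open>b3_a1\<close>.\<close>

lemma b2_a1: "b2 (mu11 M x (a1 \<phi>)) = - sc1 K (b1 x) \<phi>" "b2 (mu11 M (a1 \<phi>) x) = sc1 K (b1 x) \<phi>"
proof -
  show *: "b2 (mu11 M x (a1 \<phi>)) = - sc1 K (b1 x) \<phi>"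
  proof (rule K1_eqI)
    fix s
    have "mu12 K (- sc1 K (b1 x) \<phi>) s = - sc3 K (b1 x) (mu12 K \<phi> s)" by (simp add: small_lin)
    then show "mu12 K (b2 (mu11 M x (a1 \<phi>))) s = mu12 K (- sc1 K (b1 x) \<phi>) s"
      by (simp add: b_product M.assoc112 a_mult)
  qed
  show "b2 (mu11 M (a1 \<phi>) x) = sc1 K (b1 x) \<phi>"
    using * by (simp add: M.mu11_anticommute[of x "a1 \<phi>"] small_lin)
qed

lemma b3_a2: "b3 (mu12 M x (a2 s)) = sc2 K (b1 x) s"
proof (rule K2_eqI)
  fix \<phi>
  have "mu12 K \<phi> (sc2 K (b1 x) s) = sc3 K (b1 x) (mu12 K \<phi> s)" by (simp add: small_lin)
  then show "mu12 K \<phi> (b3 (mu12 M x (a2 s))) = mu12 K \<phi> (sc2 K (b1 x) s)"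
    using M.mu13_mu12_anticommute[of "a1 \<phi>" x] by (simp add: b_product a_mult small_lin)
qed

lemma b3_a1: "b3 (mu12 M (a1 \<phi>) t) = mu11 K \<phi> (b2 t)"
proof (rule K2_eqI)
  fix \<psi>
  have "mu12 K \<psi> (mu11 K \<phi> (b2 t)) = mu12 K (b2 t) (mu11 K \<psi> \<phi>)" using K.assoc111 by simp
  also have "\<dots> = b4 (mu22 M t (mu11 M (a1 \<psi>) (a1 \<phi>)))" by (simp add: b_product a_mult)
  also have "\<dots> = b4 (mu13 M (a1 \<psi>) (mu12 M (a1 \<phi>) t))" by (simp add: M.mu22_commute[of t] M.assoc112)
  finally show "mu12 K \<psi> (b3 (mu12 M (a1 \<phi>) t)) = mu12 K \<psi> (mu11 K \<phi> (b2 t))" by (simp add: b_product)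
qed

text \<open>The adjoint of a chain map is a chain map: differentials can be moved across the
  multiplication on both sides, because products of degree 4 in K and of degree 5 in M
  vanish.\<close>

lemma b_df: "df1 K (b2 t) = b1 (df2 M t)" "df2 K (b3 u) = b2 (df3 M u)" "df3 K (b4 w) = b3 (df4 M w)"
proof -
  show "df1 K (b2 t) = b1 (df2 M t)"
  proof (rule R_eqI)
    fix v
    have "sc3 K (df1 K (b2 t)) v = b4 (mu22 M t (df3 M (a3 v)))" by (simp add: K.mu12_df3[symmetric] b_product df_a)
    also have "\<dots> = sc3 K (b1 (df2 M t)) v" by (simp add: b_product M.leibniz23 small_lin)
    finally show "sc3 K (df1 K (b2 t)) v = sc3 K (b1 (df2 M t)) v" .
  qed
  show "df2 K (b3 u) = b2 (df3 M u)"
  proof (rule K1_eqI)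
    fix s
    have "mu12 K (df2 K (b3 u)) s = - b4 (mu13 M (df2 M (a2 s)) u)" by (simp add: K.mu12_df2[of _ s] b_product df_a)
    also have "\<dots> = mu12 K (b2 (df3 M u)) s" by (simp add: b_product M.leibniz23' small_lin)
    finally show "mu12 K (df2 K (b3 u)) s = mu12 K (b2 (df3 M u)) s" .
  qed
  show "df3 K (b4 w) = b3 (df4 M w)"
    by (rule K2_eqI) (simp add: K.mu12_df3 b_product M.leibniz14 df_a small_lin)
qed

text \<open>Testing \<beta>\<alpha> against K yields products of \<alpha>-images that come from
  degree 4 of K, hence 0.\<close>

lemma b_a: "b1 (a1 \<phi>) = 0" "b2 (a2 s) = 0" "b3 (a3 v) = 0"
proof -
  show "b1 (a1 \<phi>) = 0" by (rule R_eqI) (simp add: b_product a_mult small_lin)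
  show "b2 (a2 s) = 0" by (rule K1_eqI) (simp add: b_product a_mult small_lin)
  show "b3 (a3 v) = 0" by (rule K2_eqI) (simp add: b_product a_mult small_lin)
qed

text \<open>Both sides correspond under \<open>b4\<close> to the product of \<open>b2 t\<close> and
  \<open>b3 u\<close> in K_3.\<close>

lemma M4_a2_b3: "mu22 M t (a2 (b3 u)) = mu13 M (a1 (b2 t)) u"
  using b_product(2)[of t "b3 u"] b_product(3)[of "b2 t" u] by (simp add: b4_inject)

lemma M4_a3_b4: "mu13 M x (a3 (b4 w)) = - sc4 M (b1 x) w"
proof -
  have "b4 (mu13 M x (a3 (b4 w))) = b4 (- sc4 M (b1 x) w)"
    using b_product(1)[of x "b4 w"] by (simp add: small_lin)
  then show ?thesis by (simp only: b4_inject)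
qed

end

text \<open>
  The homotopy enters only through identities in \<open>M\<^sub>4\<close>: \<open>X_df3\<close> and \<open>X_df2\<close> are its equation in degree
  five on the two summands of \<open>B\<^sub>5\<close>, transported by \<open>\<beta>\<^sub>4\<close> and, on \<open>M\<^sub>1 \<otimes> D\<^sub>2M\<^sub>2\<close>, polarised.
\<close>

locale big_small = small_map M K xs brK a1 a2 a3 b1 b2 b3 b4 brM \<eta>
  for M :: "('r::comm_ring_1, 'm1::ab_group_add, 'm2::ab_group_add, 'm3::ab_group_add, 'm4::ab_group_add) alg4"
    and K :: "('r, 'k1::ab_group_add, 'k2::ab_group_add, 'k3::ab_group_add) alg3"
    and xs brK a1 a2 a3 b1 b2 b3 b4 brM \<eta> +
  fixes r :: 'r
    and X :: "'m1 \<Rightarrow> 'm1 \<Rightarrow> 'm2" and Xt :: "'m1 \<Rightarrow> 'm2 \<Rightarrow> 'm3"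
  assumes X_bilinear: "bilinear_map (sc1 M) (sc1 M) (sc2 M) X" and X_self: "X x x = 0"
    and Xt_bilinear: "bilinear_map (sc1 M) (sc2 M) (sc3 M) Xt"
    and Xt_adjoint: "mu13 M x (Xt y t) = mu22 M (X x y) t"
    and X_a1': "mu22 M (X x (a1 \<phi>)) t = 0"
    and X_a2: "mu22 M (X x y) (a2 s) = 0"
    and X_a1_self: "mu22 M (X x y) (mu11 M (a1 \<phi>) x) = 0"
    and X_df3: "mu22 M (X x y) (df3 M u) =
      sc4 M (b1 x) (mu13 M y u) - sc4 M (b1 y) (mu13 M x u) + mu13 M (a1 (b2 (mu11 M x y))) u"
    and X_df2: "mu22 M (X x (df2 M t')) t + mu22 M (X x (df2 M t)) t' =
      mu13 M (a1 (b2 t)) (mu12 M x t') + mu13 M (a1 (b2 t')) (mu12 M x t) - sc4 M (b1 x) (mu22 M t' t)"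
begin

lemmas lin = small_lin bilinear_map_laws[OF X_bilinear] bilinear_map_laws[OF Xt_bilinear]

section \<open>Vanishing of X and X^t on the image of \<alpha>, and their differentials\<close>

lemma X_anticommute: "X y x = - X x y"
  by (rule alternating_anticommute) (simp_all add: lin X_self)

lemma X_a1: "X x (a1 \<phi>) = 0" "X (a1 \<phi>) x = 0"
proof -
  show *: "X x (a1 \<phi>) = 0" by (rule M2_eqI) (simp add: X_a1' lin)
  show "X (a1 \<phi>) x = 0" using X_anticommute[of "a1 \<phi>" x] * by simp
qed

lemma Xt_a: "Xt (a1 \<phi>) t = 0" "Xt x (a2 s) = 0"
  by (rule M3_eqI, simp add: Xt_adjoint X_a1 X_a2 lin)+

text \<open>By adjointness, \<beta> kills these values because their products with the image of
  \<alpha> vanish.\<close>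

lemma b_X: "b2 (X x y) = 0" "b3 (Xt x t) = 0"
proof -
  show "b2 (X x y) = 0" by (rule K1_eqI) (simp add: b_product X_a2 lin)
  show "b3 (Xt x t) = 0" by (rule K2_eqI) (simp add: b_product Xt_adjoint X_a1 lin)
qed

text \<open>\<open>leibniz23\<close> moves the differential onto the test element of M_3, where
  \<open>X_df3\<close> applies. This is what the Leibniz rule on F_1 \<times> F_1 needs: together
  with the summand \<beta>_2(x y) of the product it leaves \<beta>_1(x) y - \<beta>_1(y) x. In the
  same way \<open>df3_Xt\<close>, \<open>Xt_df3\<close> and \<open>a3_b4_mu22\<close> serve F_1
  \<times> F_2, F_1 \<times> F_3 and F_2 \<times> F_2.\<close>

lemma df2_X: "df2 M (X x y) = sc1 M (b1 y) x - sc1 M (b1 x) y - a1 (b2 (mu11 M x y))"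
proof (rule M1_eqI)
  fix u
  have "mu13 M (df2 M (X x y)) u = - mu22 M (X x y) (df3 M u)" by (simp add: M.leibniz23)
  then show "mu13 M (df2 M (X x y)) u = mu13 M (sc1 M (b1 y) x - sc1 M (b1 x) y - a1 (b2 (mu11 M x y))) u"
    by (simp add: X_df3 lin)
qed

lemma df3_Xt:
  "df3 M (Xt x s) = a2 (b3 (mu12 M x s)) - sc2 M (b1 x) s - mu11 M x (a1 (b2 s)) - X x (df2 M s)"
proof (rule M2_eqI)
  fix t
  have "mu22 M (df3 M (Xt x s)) t = mu22 M (X x (df2 M t)) s"
    using X_anticommute[of "df2 M t" x] by (simp add: M.leibniz23' Xt_adjoint lin)
  also have "\<dots> = mu13 M (a1 (b2 t)) (mu12 M x s) + mu13 M (a1 (b2 s)) (mu12 M x t) - sc4 M (b1 x) (mu22 M s t)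
      - mu22 M (X x (df2 M s)) t"
    using X_df2[of x s t] by (simp add: algebra_simps)
  also have "\<dots> = mu22 M (a2 (b3 (mu12 M x s)) - sc2 M (b1 x) s - mu11 M x (a1 (b2 s)) - X x (df2 M s)) t"
    using M.mu13_mu12_anticommute[of "a1 (b2 s)" x t]
    by (simp add: lin M.mu22_commute[of "a2 _" t] M4_a2_b3 M.assoc112)
  finally show "mu22 M (df3 M (Xt x s)) t = \<dots>" .
qed

text \<open>\<open>X_df3\<close> once more, now with the first argument of \<open>X\<close> as the
  test element; \<open>M4_a3_b4\<close> and \<open>M4_a2_b3\<close> turn its terms into images of
  \<alpha>.\<close>

lemma Xt_df3: "Xt x (df3 M u) = mu12 M x (a2 (b3 u)) - a3 (b4 (mu13 M x u)) - sc3 M (b1 x) u"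
proof (rule M3_eqI)
  fix y
  show "mu13 M y (Xt x (df3 M u)) = mu13 M y (mu12 M x (a2 (b3 u)) - a3 (b4 (mu13 M x u)) - sc3 M (b1 x) u)"
    by (simp add: lin Xt_adjoint X_df3 M4_a3_b4 M.assoc112[symmetric] M4_a2_b3)
qed

text \<open>\<open>X_df2\<close> with its M_1 argument as the test element, whereas
  \<open>df3_Xt\<close> tests with an element of M_2.\<close>

lemma a3_b4_mu22: "a3 (b4 (mu22 M s t)) =
  mu12 M (a1 (b2 s)) t + mu12 M (a1 (b2 t)) s + Xt (df2 M s) t + Xt (df2 M t) s"
proof (rule M3_eqI)
  fix y
  have "- sc4 M (b1 y) (mu22 M s t) = mu22 M (X y (df2 M s)) t + mu22 M (X y (df2 M t)) s
    - mu13 M (a1 (b2 t)) (mu12 M y s) - mu13 M (a1 (b2 s)) (mu12 M y t)"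
    by (simp add: X_df2)
  then show "mu13 M y (a3 (b4 (mu22 M s t))) =
    mu13 M y (mu12 M (a1 (b2 s)) t + mu12 M (a1 (b2 t)) s + Xt (df2 M s) t + Xt (df2 M t) s)"
    by (simp add: lin M4_a3_b4 Xt_adjoint M.mu13_mu12_anticommute[of "a1 _" y])
qed

section \<open>Symmetries of the form \<beta>_3(x X(y, z)) and the cyclic identities\<close>

lemma X_a1_swap: "mu22 M (X x y) (mu11 M (a1 \<phi>) z) = - mu22 M (X z y) (mu11 M (a1 \<phi>) x)"
  by (rule alternating_anticommute[of "\<lambda>z x. mu22 M (X z y) (mu11 M (a1 \<phi>) x)", symmetric, THEN minus_equation_iff[THEN iffD1], symmetric])
    (simp_all add: lin X_a1_self)

text \<open>Testing with an element of M_1 reduces this to \<open>X_a1_swap\<close>. It settles the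
  associativity terms with one factor from K_1 and two from M_1.\<close>

lemma Xt_a1_mult: "Xt y (mu11 M (a1 \<phi>) z) = mu12 M (a1 \<phi>) (X z y)"
proof (rule M3_eqI)
  fix x
  have "mu13 M x (mu12 M (a1 \<phi>) (X z y)) = - mu22 M (X z y) (mu11 M (a1 \<phi>) x)"
    by (simp add: M.assoc112[symmetric] M.mu22_commute[of "X z y"] M.mu11_anticommute[of x] lin)
  then show "mu13 M x (Xt y (mu11 M (a1 \<phi>) z)) = mu13 M x (mu12 M (a1 \<phi>) (X z y))"
    by (simp add: Xt_adjoint X_a1_swap[of x])
qed

text \<open>Multiplied by \<phi> in K_1, the form becomes the image under \<open>b4\<close> of X(y,
  z) times \<alpha>_1(\<phi>) x, and there \<open>X_a1_swap\<close> exchanges x and y.\<close>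

lemma b3_X_alternating:
  "b3 (mu12 M x (X z y)) = - b3 (mu12 M x (X y z))"
  "b3 (mu12 M y (X x z)) = - b3 (mu12 M x (X y z))"
proof -
  show "b3 (mu12 M x (X z y)) = - b3 (mu12 M x (X y z))" by (simp add: X_anticommute[of z y] lin)
  show "b3 (mu12 M y (X x z)) = - b3 (mu12 M x (X y z))"
  proof (rule K2_eqI)
    fix \<phi>
    have "mu12 K \<phi> (b3 (mu12 M x (X y z))) = b4 (mu22 M (X y z) (mu11 M (a1 \<phi>) x))" for x y z
      by (simp add: b_product M.assoc112[symmetric] M.mu22_commute)
    then show "mu12 K \<phi> (b3 (mu12 M y (X x z))) = mu12 K \<phi> (- b3 (mu12 M x (X y z)))"
      using X_a1_swap[of x z \<phi> y] by (simp add: lin)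
  qed
qed

lemma b3_a1_X: "b3 (mu12 M (a1 \<phi>) (X x y)) = 0"
  by (simp add: b3_a1 b_X lin)

text \<open>The last three terms are c_4 of x \<and> y \<otimes> t. The formula thus has the shape
  of the homotopy equation in degree four, with -\<beta>_3(m_2(t) X(x, y)) in the place of
  h_3.\<close>

lemma df3_b4_X: "df3 K (b4 (mu22 M (X x y) t)) =
  b3 (mu12 M (df2 M t) (X x y)) - mu11 K (b2 (mu11 M x y)) (b2 t)
    - sc2 K (b1 x) (b3 (mu12 M y t)) + sc2 K (b1 y) (b3 (mu12 M x t))"
  by (simp add: b_df M.leibniz22 df2_X lin b3_a1 algebra_simps)

lemma M4_eqI: "w = w'" if "df3 K (b4 w) = df3 K (b4 w')"
  using K.df3_inject[OF that] by (simp add: b4_inject)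

lemma b3_X_cyclic: "b3 (mu12 M z (X x y)) = b3 (mu12 M x (X y z))"
  using b3_X_alternating(2)[of z x y] b3_X_alternating(1)[of x z y] by simp

lemma X_Xt_cyclic: "mu12 M z (X x y) + Xt z (mu11 M x y) = mu12 M x (X y z) + Xt x (mu11 M y z)"
proof (rule M3_eqI)
  fix w
  have S: "mu13 M w (mu12 M x (X y z) + Xt x (mu11 M y z)) =
      mu22 M (X y z) (mu11 M w x) + mu22 M (X w x) (mu11 M y z)" for x y z
    by (simp add: lin Xt_adjoint M.assoc112[symmetric] M.mu22_commute)
  \<comment> \<open>The right-hand side is visibly cyclic in x, y, z except for the terms with
    coefficients \<open>df1 M w\<close> and \<open>b1 w\<close>; these are cyclic by
    \<open>b3_X_cyclic\<close> and by associativity of M.\<close>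
  have k: "df3 K (b4 (mu22 M (X y z) (mu11 M w x) + mu22 M (X w x) (mu11 M y z))) =
      sc2 K (df1 M w) (b3 (mu12 M x (X y z))) - sc2 K (df1 M x) (b3 (mu12 M w (X y z)))
      - sc2 K (df1 M y) (b3 (mu12 M w (X z x))) - sc2 K (df1 M z) (b3 (mu12 M w (X x y)))
      + sc2 K (b1 z) (b3 (mu12 M w (mu11 M x y))) + sc2 K (b1 y) (b3 (mu12 M w (mu11 M z x)))
      + sc2 K (b1 x) (b3 (mu12 M w (mu11 M y z))) - sc2 K (b1 w) (b3 (mu12 M x (mu11 M y z)))" for x y z
  proof -
    have 1: "b3 (mu12 M z (X w x)) = - b3 (mu12 M w (X z x))" "b3 (mu12 M y (X w x)) = b3 (mu12 M w (X x y))"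
      using b3_X_cyclic[of z w x] b3_X_alternating(1)[of w x z] b3_X_cyclic[of y w x] by simp_all
    have 2: "mu12 M z (mu11 M w x) = - mu12 M w (mu11 M z x)" "mu12 M y (mu11 M w x) = mu12 M w (mu11 M x y)"
      using M.assoc111[of z w x] M.assoc111[of y w x] M.mu11_anticommute[of x z] by (simp_all add: lin)
    \<comment> \<open>The two summands contribute the product of \<beta>_2(w x) and \<beta>_2(y z)
      in opposite orders, so these terms cancel.\<close>
    have 3: "mu11 K (b2 (mu11 M w x)) (b2 (mu11 M y z)) = - mu11 K (b2 (mu11 M y z)) (b2 (mu11 M w x))"
      by (rule K.mu11_anticommute)
    show ?thesis
      by (simp add: lin df3_b4_X M.leibniz11 1 2 3 algebra_simps)
  qed
  show "mu13 M w (mu12 M z (X x y) + Xt z (mu11 M x y)) = mu13 M w (mu12 M x (X y z) + Xt x (mu11 M y z))"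
    unfolding S
    by (rule M4_eqI, unfold k) (simp add: b3_X_cyclic[of z x y] M.assoc111[of z x y] algebra_simps)
qed

text \<open>The method of \<open>X_Xt_cyclic\<close> with t = X(y, z) in \<open>df3_b4_X\<close>:
  \<beta>_2(t) is 0, m_2(t) is given by \<open>df2_X\<close>, and its \<alpha>_1 part contributes
  nothing by \<open>b3_a1_X\<close>.\<close>

lemma Xt_X_cyclic: "Xt z (X x y) = Xt x (X y z)"
proof (rule M3_eqI)
  fix w
  have k: "df3 K (b4 (mu22 M (X w x) (X y z))) =
    sc2 K (b1 x) (b3 (mu12 M w (X y z))) + sc2 K (b1 y) (b3 (mu12 M w (X z x)))
      + sc2 K (b1 z) (b3 (mu12 M w (X x y))) - sc2 K (b1 w) (b3 (mu12 M x (X y z)))" for x y z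
  proof -
    have 1: "b3 (mu12 M z (X w x)) = - b3 (mu12 M w (X z x))" "b3 (mu12 M y (X w x)) = b3 (mu12 M w (X x y))"
      using b3_X_cyclic[of z w x] b3_X_alternating(1)[of w x z] b3_X_cyclic[of y w x] by simp_all
    show ?thesis
      by (simp add: lin df3_b4_X df2_X b_X b3_a1_X 1 algebra_simps)
  qed
  show "mu13 M w (Xt z (X x y)) = mu13 M w (Xt x (X y z))"
    unfolding Xt_adjoint
    by (rule M4_eqI) (simp add: k b3_X_cyclic[of z x y] algebra_simps)
qed

end

text \<open>Needed because dual pieces of F list their summands in different orders, for example F_1
  = K_1 \<oplus> M_1 and F_3 = M_3 \<oplus> K_2.\<close>

lemma perfect_bij:
  assumes p: "perfect s t p" and f: "module_hom t' t f" "bij f"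
  shows "perfect s t' (\<lambda>x y. p x (f y))"
proof -
  note fl = module_hom_laws[OF f(1)]
  have inv: "f (inv f y) = y" "inv f (f z) = z" for y z
    using f(2) by (simp_all add: bij_is_surj surj_f_inv_f bij_is_inj)
  show ?thesis
    unfolding perfect_def
  proof (intro conjI allI impI)
    fix g assume g: "module_hom t' (*) g"
    have "inv f (x + y) = inv f x + inv f y" "inv f (t a x) = t' a (inv f x)" for a x y
      using inv(2)[of "inv f x + inv f y"] inv(2)[of "t' a (inv f x)"] by (simp_all add: fl inv(1))
    then have "module_hom t (*) (\<lambda>y. g (inv f y))"
      using module_hom_laws(1,2)[OF g] module_hom_modules[OF f(1)] by (intro module_homI module_ring) simp_all
    then have "\<exists>!x. \<forall>y. p x y = g (inv f y)" by (rule p[unfolded perfect_def, THEN conjunct1, rule_format])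
    moreover have "(\<forall>y. p x y = g (inv f y)) \<longleftrightarrow> (\<forall>y. p x (f y) = g y)" for x
    proof
      show "\<forall>y. p x (f y) = g y" if "\<forall>y. p x y = g (inv f y)" using that inv(2) by simp
      show "\<forall>y. p x y = g (inv f y)" if *: "\<forall>y. p x (f y) = g y"
      proof
        fix y show "p x y = g (inv f y)" using *[rule_format, of "inv f y"] unfolding inv(1) .
      qed
    qed
    ultimately show "\<exists>!x. \<forall>y. p x (f y) = g y" by (simp only:)
  next
    fix g assume "module_hom s (*) g"
    then have "\<exists>!y. \<forall>x. p x y = g x" by (rule p[unfolded perfect_def, THEN conjunct2, rule_format])
    then obtain y where y: "\<forall>x. p x y = g x" "\<And>z. \<forall>x. p x z = g x \<Longrightarrow> z = y"
      by (elim ex1E) blast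
    show "\<exists>!y. \<forall>x. p x (f y) = g x"
    proof (rule ex1I[of _ "inv f y"])
      show "\<forall>x. p x (f (inv f y)) = g x" unfolding inv(1) by (rule y(1))
      fix z assume "\<forall>x. p x (f z) = g x"
      then have "f z = y" by (rule y(2))
      then show "z = inv f y" using inv(2)[of z] by simp
    qed
  qed
qed

section \<open>The algebra F in homogeneous components, and its duality\<close>

context big_small
begin

definition big :: "('r, 'k1 \<times> 'm1, 'k2 \<times> 'm2 \<times> 'k1, 'm3 \<times> 'k2, 'm4) alg4"
  where "big = big_from_small K M \<lparr>al1 = a1, al2 = a2, al3 = a3\<rparr> \<lparr>be1 = b1, be2 = b2, be3 = b3, be4 = b4\<rparr> r brK \<eta> X Xt"

text \<open>Minus the inverse of \<open>b4\<close>. It absorbs the brackets times \<eta> in the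
  products of F and makes them linear expressions in K_3.\<close>

definition eps :: "'k3 \<Rightarrow> 'm4"
  where "eps v = sc4 M (brK v) \<eta>"

lemma big_simps:
  "sc1 big = sc1 K \<oplus>\<^sub>s sc1 M"
  "sc2 big = sc2 K \<oplus>\<^sub>s sc2 M \<oplus>\<^sub>s sc1 K"
  "sc3 big = sc3 M \<oplus>\<^sub>s sc2 K"
  "sc4 big = sc4 M"
  "df1 big (\<phi>, x) = df1 K \<phi> + (b1 x + r * df1 M x)"
  "df2 big (s, t, \<phi>) = (df2 K s + b2 t + sc1 K r \<phi>, - df2 M t - a1 \<phi>)"
  "df3 big (u, s) = (b3 u - sc2 K r s, - df3 M u - a2 s, df2 K s)"
  "df4 big w = (a3 (b4 w) - sc3 M r (df4 M w), - b3 (df4 M w))"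
  "mu11 big (\<phi>, x) (\<phi>', x') = (mu11 K \<phi> \<phi>',
     - mu11 M (a1 \<phi>) x' - mu11 M x (a1 \<phi>') - sc2 M r (mu11 M x x') + X x x',
     sc1 K (df1 M x) \<phi>' - sc1 K (df1 M x') \<phi> + b2 (mu11 M x x'))"
  "mu12 big (\<phi>, x) (s, t, \<phi>') =
    (mu12 M x (a2 s) - df4 M (eps (mu12 K \<phi> s)) - mu12 M (a1 \<phi>) t - sc3 M r (mu12 M x t) + Xt x t,
     mu11 K \<phi> \<phi>' - sc2 K (df1 M x) s - b3 (mu12 M x t))"
  "mu13 big (\<phi>, x) (u, s) = eps (mu12 K \<phi> s) - mu13 M x u"
  "mu22 big (s, t, \<phi>) (s', t', \<phi>') = eps (mu12 K \<phi>' s) + eps (mu12 K \<phi> s') - mu22 M t t'"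
  by (simp_all add: big_def big_from_small_def eps_def mu21_def M.lin b_df)

lemma eps_b4: "eps (b4 w) = - w"
  by (subst bM(6)[symmetric]) (simp add: eps_def bM(1-5) b_pairing brM_eta)

lemma b4_eps: "b4 (eps v) = - v"
  by (subst bK(6)[symmetric]) (simp add: eps_def bK(1,3-5) bM(1-5) b_pairing brM_eta)

lemma eps_hom: "module_hom (sc3 K) (sc4 M) eps"
  by (intro module_homI K.modules M.modules) (simp_all add: eps_def bK(1-5) M.lin)

lemmas eps_lin = module_hom_laws[OF eps_hom]

lemma mu13_a3: "mu13 M x (a3 v) = sc4 M (b1 x) (eps v)"
  by (subst b4_inject[symmetric]) (simp add: b4_lin b4_eps b_product K.lin)

lemma M_commute_a1: "mu11 M x (a1 \<phi>) = - mu11 M (a1 \<phi>) x"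
  by (rule M.mu11_anticommute)

lemma dga4_big: "dga4 big"
proof (rule dga4.intro)
  show "fg_free (sc1 big) UNIV" "fg_free (sc2 big) UNIV" "fg_free (sc3 big) UNIV" "fg_free (sc4 big) UNIV"
    unfolding big_simps(1-4) by (intro fg_free_prod module_prod M.modules K.modules M.free K.free)+
  note mods = module_prod M.modules K.modules module_ring
  show "module_hom (sc1 big) (*) (df1 big)"
    by (intro module_homI) (auto simp: big_simps lin algebra_simps intro!: mods)
  show "module_hom (sc2 big) (sc1 big) (df2 big)"
    by (intro module_homI) (auto simp: big_simps lin algebra_simps intro!: mods)
  show "module_hom (sc3 big) (sc2 big) (df3 big)"
    by (intro module_homI) (auto simp: big_simps lin algebra_simps intro!: mods)
  show "module_hom (sc4 big) (sc3 big) (df4 big)"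
    by (intro module_homI) (auto simp: big_simps lin algebra_simps intro!: mods)
  show "bilinear_map (sc1 big) (sc1 big) (sc2 big) (mu11 big)"
    by (intro bilinear_mapI) (auto simp: big_simps lin algebra_simps intro!: mods)
  show "bilinear_map (sc1 big) (sc2 big) (sc3 big) (mu12 big)"
    by (intro bilinear_mapI) (auto simp: big_simps lin eps_lin algebra_simps intro!: mods)
  show "bilinear_map (sc1 big) (sc3 big) (sc4 big) (mu13 big)"
    by (intro bilinear_mapI) (auto simp: big_simps lin eps_lin algebra_simps intro!: mods)
  show "bilinear_map (sc2 big) (sc2 big) (sc4 big) (mu22 big)"
    by (intro bilinear_mapI) (auto simp: big_simps lin eps_lin algebra_simps intro!: mods)
  \<comment> \<open>F is a complex because \<alpha> and \<beta> are chain maps with \<beta>\<alpha>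
    = 0; the terms containing r cancel in pairs.\<close>
  show "df1 big (df2 big t) = 0" for t
    by (cases t) (simp add: big_simps lin b_df df_a b_a K.df1_df2 M.df_df algebra_simps)
  show "df2 big (df3 big u) = 0" for u
    by (cases u) (simp add: big_simps lin b_df df_a b_a K.df1_df2 K.df2_df3 M.df_df zero_prod_def algebra_simps)
  show "df3 big (df4 big w) = 0" for w
    by (simp add: big_simps lin b_df df_a b_a K.df2_df3 M.df_df zero_prod_def algebra_simps)
  show "mu11 big x x = 0" for x
    using M_commute_a1[of "snd x" "fst x"]
    by (cases x) (simp add: big_simps lin K.mu11_self M.mu11_self X_self zero_prod_def)
  show "mu22 big t s = mu22 big s t" for t s
    by (cases s; cases t) (simp add: big_simps M.mu22_commute add.commute)
  show "df2 big (mu11 big x y) = sc1 big (df1 big x) y - sc1 big (df1 big y) x" for x y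
  proof (cases x; cases y)
    fix \<phi> \<theta> \<phi>' \<theta>'
    assume "x = (\<phi>, \<theta>)" "y = (\<phi>', \<theta>')"
    then show ?thesis
      by (simp add: big_simps lin K.leibniz11 M.leibniz11 b2_a1 b_X df2_X df_a algebra_simps)
  qed
  show "df3 big (mu12 big x t) = sc2 big (df1 big x) t - mu11 big x (df2 big t)" for x t
  proof (cases x; cases t)
    fix \<phi> \<theta> s \<theta>2 \<psi>
    assume "x = (\<phi>, \<theta>)" "t = (s, \<theta>2, \<psi>)"
    then show ?thesis
      by (simp add: big_simps lin K.leibniz11 K.leibniz12 M.leibniz11 M.leibniz12 b2_a1 b3_a1 b3_a2 b_X df3_Xt df_a
          a_mult M.df_df b_df(1,2) b_df(3)[symmetric] b4_eps X_a1 algebra_simps)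
  qed
  show "df4 big (mu13 big x u) = sc3 big (df1 big x) u - mu12 big x (df3 big u)" for x u
  proof (cases x; cases u)
    fix \<phi> \<theta> \<theta>3 s
    assume "x = (\<phi>, \<theta>)" "u = (\<theta>3, s)"
    then show ?thesis
      by (simp add: big_simps lin eps_lin K.leibniz12 M.leibniz13 M.leibniz12 b2_a1 b3_a1 b3_a2 b_X Xt_df3 Xt_a df_a
          a_mult M.df_df b_df(1,2) b_df(3)[symmetric] b4_eps b_product eps_b4 X_a1 algebra_simps)
  qed
  show "df4 big (mu22 big s t) = mu12 big (df2 big s) t + mu12 big (df2 big t) s" for s t
  proof (cases s; cases t)
    fix s2 t2 \<phi> s2' t2' \<phi>'
    assume "s = (s2, t2, \<phi>)" "t = (s2', t2', \<phi>')"
    then show ?thesis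
      by (simp add: big_simps lin eps_lin K.leibniz12 M.leibniz13 M.leibniz12 b2_a1 b3_a1 b3_a2 b_X Xt_df3 Xt_a df_a
          a_mult M.df_df b_df(1,2) b_df(3)[symmetric] b4_eps b_product eps_b4 X_a1 M.leibniz22 a3_b4_mu22
          K.mu11_anticommute[of "b2 _"] K.mu11_anticommute[of "df2 K _"] K.mu11_anticommute[of \<phi> \<phi>'] K.mu12_df2[of s2' s2] algebra_simps)
  qed
  show "mu13 big x (df4 big w) = sc4 big (df1 big x) w" for x w
    by (cases x) (simp add: big_simps lin eps_lin b_product mu13_a3 eps_b4 M.leibniz14 df_a algebra_simps)
  show "mu22 big t (df3 big u) = - mu13 big (df2 big t) u" for t u
  proof (cases t; cases u)
    fix s2 t2 \<phi> \<theta>3 s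
    assume "t = (s2, t2, \<phi>)" "u = (\<theta>3, s)"
    then show ?thesis
      by (simp add: big_simps lin eps_lin b_product eps_b4 M.leibniz23 K.mu12_df2[of s] algebra_simps)
  qed
  \<comment> \<open>\<open>X\<close> and \<open>Xt\<close> match by adjointness. The summand with
    m_4(\<eta>) in the product F_1 \<times> F_2 is what balances m_1(\<theta>_1) \<phi>_1' in the
    product F_1 \<times> F_1, since x m_4(w) = m_1(x) w.\<close>
  show "mu22 big (mu11 big x y) t = mu13 big x (mu12 big y t)" for x y t
  proof (cases x; cases y; cases t)
    fix \<phi> \<theta> \<phi>' \<theta>' s2 t2 \<psi>
    assume "x = (\<phi>, \<theta>)" "y = (\<phi>', \<theta>')" "t = (s2, t2, \<psi>)"
    then show ?thesis
      by (simp add: big_simps lin eps_lin b_product eps_b4 M.leibniz14 M.assoc112 Xt_adjoint K.assoc111[of \<psi>] algebra_simps)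
  qed
  show "mu12 big z (mu11 big x y) = mu12 big x (mu11 big y z)" for x y z
  proof (cases x; cases y; cases z)
    fix \<phi> \<theta> \<phi>' \<theta>' \<phi>'' \<theta>''
    assume "x = (\<phi>, \<theta>)" "y = (\<phi>', \<theta>')" "z = (\<phi>'', \<theta>'')"
    \<comment> \<open>The mixed terms of \<open>mu12\<close> and \<open>X\<close>, \<open>Xt\<close>
      that carry r are r times the two sides of \<open>X_Xt_cyclic\<close>. The triple terms free of
      r are covered by \<open>Xt_X_cyclic\<close> in M_3 and \<open>b3_X_cyclic\<close> in
      K_2.\<close>
    moreover have "sc3 M r (mu12 M \<theta>'' (X \<theta> \<theta>')) = sc3 M r (mu12 M \<theta> (X \<theta>' \<theta>'')) +
        sc3 M r (Xt \<theta> (mu11 M \<theta>' \<theta>'')) - sc3 M r (Xt \<theta>'' (mu11 M \<theta> \<theta>'))"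
      using arg_cong[OF X_Xt_cyclic[of \<theta>'' \<theta> \<theta>'], of "sc3 M r"] by (simp add: lin algebra_simps)
    moreover have "mu12 M \<theta> (mu11 M (a1 \<psi>) z) = mu12 M (a1 \<psi>) (mu11 M z \<theta>)"
      "mu12 M \<theta>'' (mu11 M (a1 \<psi>) z) = mu12 M (a1 \<psi>) (mu11 M z \<theta>'')" for z \<psi>
      by (rule M.assoc111)+
    moreover have "mu12 M (a1 \<phi>'') (mu11 M (a1 \<phi>) y) = - mu12 M (a1 \<phi>) (mu11 M (a1 \<phi>'') y)"
      "mu12 M (a1 \<phi>'') (mu11 M (a1 \<phi>') y) = - mu12 M (a1 \<phi>') (mu11 M (a1 \<phi>'') y)" for y
      using M.assoc111[of "a1 \<phi>''"] M_commute_a1[of y \<phi>''] by (simp_all add: lin)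
    ultimately show ?thesis
      by (simp add: big_simps lin eps_lin a_mult b3_a1 Xt_a1_mult b3_X_cyclic[of \<theta>'' \<theta> \<theta>'] Xt_X_cyclic[of \<theta>'' \<theta> \<theta>']
          K.assoc111[of \<phi>'' \<phi> \<phi>'] M.assoc111[of \<theta>'' \<theta> \<theta>'] K.mu11_anticommute[of \<phi> \<phi>''] K.mu11_anticommute[of \<phi>' \<phi>'']
          M_commute_a1[of \<theta>] M_commute_a1[of \<theta>'] M.mu11_anticommute[of \<theta>'' \<theta>] M.mu11_anticommute[of \<theta>' \<theta>]
          X_anticommute[of \<theta>'' \<theta>] X_anticommute[of \<theta>' \<theta>] algebra_simps)
  qed
qed

lemma brM_eps: "brM (eps v) = brK v"
  by (simp add: eps_def bM brM_eta)

text \<open>With \<open>brM\<close> as orientation, the pairing is the orthogonal sum of the pairing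
  of K and the negative of that of M, after the summands of F_3 are exchanged. In degree 2 the
  K-pairing occurs twice, once transposed.\<close>

lemma perfect_big13: "perfect (sc1 big) (sc3 big) (\<lambda>x u. brM (mu13 big x u))"
proof -
  have "perfect (sc1 K \<oplus>\<^sub>s sc1 M) (sc2 K \<oplus>\<^sub>s sc3 M)
      (\<lambda>(\<phi>, x) (s, u). brK (mu12 K \<phi> s) + - brM (mu13 M x u))"
    using perfectM(1) K.perfect12
    by (intro perfect_prod perfect_uminus M.modules K.modules) (simp_all add: lin bK bM)
  moreover have "brM (mu13 big x u) = (\<lambda>(\<phi>, x) (s, u). brK (mu12 K \<phi> s) + - brM (mu13 M x u)) x (prod.swap u)" for x u
    by (cases x; cases u) (simp add: big_simps bM brM_eps)
  moreover have "module_hom (sc3 big) (sc2 K \<oplus>\<^sub>s sc3 M) prod.swap"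
    by (rule module_homI) (auto simp: big_simps module_prod M.modules K.modules)
  ultimately show ?thesis
    by (simp add: big_simps(1) perfect_bij)
qed

lemma perfect_big22: "perfect (sc2 big) (sc2 big) (\<lambda>x u. brM (mu22 big x u))"
proof -
  have "perfect (sc2 K \<oplus>\<^sub>s sc2 M \<oplus>\<^sub>s sc1 K) (sc1 K \<oplus>\<^sub>s sc2 M \<oplus>\<^sub>s sc2 K)
      (\<lambda>(s, z) (\<phi>', z'). brK (mu12 K \<phi>' s) + (case z of (t, \<phi>) \<Rightarrow> \<lambda>(t', s'). - brM (mu22 M t t') + brK (mu12 K \<phi> s')) z')"
    using perfectM(2) K.perfect12 perfect_swap[OF K.perfect12]
    by (intro perfect_prod perfect_uminus M.modules K.modules module_prod) (auto simp add: lin bK bM zero_prod_def)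
  moreover have "brM (mu22 big x u) = (\<lambda>(s, z) (\<phi>', z'). brK (mu12 K \<phi>' s) +
      (case z of (t, \<phi>) \<Rightarrow> \<lambda>(t', s'). - brM (mu22 M t t') + brK (mu12 K \<phi> s')) z') x ((\<lambda>(s, t, \<phi>). (\<phi>, t, s)) u)" for x u
    by (cases x; cases u) (simp add: big_simps bM brM_eps)
  moreover have "module_hom (sc2 big) (sc1 K \<oplus>\<^sub>s sc2 M \<oplus>\<^sub>s sc2 K) (\<lambda>(s, t, \<phi>). (\<phi>, t, s))"
    by (rule module_homI) (auto simp: big_simps module_prod M.modules K.modules)
  moreover have "bij (\<lambda>(s :: 'k2, t :: 'm2, \<phi> :: 'k1). (\<phi>, t, s))"
    by (rule bij_betw_byWitness[of _ "\<lambda>(\<phi>, t, s). (s, t, \<phi>)"]) auto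
  ultimately show ?thesis
    by (simp add: big_simps(2) perfect_bij)
qed

theorem big_poincare_algebra: "is_dg_algebra4 big \<and> has_poincare_duality4 big"
proof -
  interpret big: dga4 big by (rule dga4_big)
  have "is_orientation (sc4 big) brM" using brM by (simp add: big_simps)
  then show ?thesis using big.is_dg_algebra4 big.has_poincare_duality4I perfect_big13 perfect_big22 by blast
qed

end

section \<open>Normalising the multiplication\<close>

text \<open>The new product at 0 is twice the constant \<open>mu12 A 0 0\<close>, which is 0 for a
  DG algebra. As \<open>mu12\<close> occurs twice in the total multiplication, that multiplication
  does not change.\<close>

definition normalized ::
    "('r::comm_ring_1, 'a1::ab_group_add, 'a2::ab_group_add, 'a3::ab_group_add, 'a4::ab_group_add) alg4 \<Rightarrow>
     ('r, 'a1, 'a2, 'a3, 'a4) alg4"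
  where "normalized A = A\<lparr>mu12 := \<lambda>x t. mu12 A x t + mu12 A 0 0\<rparr>"

lemma normalized_simps [simp]:
  "sc1 (normalized A) = sc1 A" "sc2 (normalized A) = sc2 A" "sc3 (normalized A) = sc3 A" "sc4 (normalized A) = sc4 A"
  "df1 (normalized A) = df1 A" "df2 (normalized A) = df2 A" "df3 (normalized A) = df3 A" "df4 (normalized A) = df4 A"
  "mu11 (normalized A) = mu11 A" "mu13 (normalized A) = mu13 A" "mu22 (normalized A) = mu22 A"
  "mu12 (normalized A) x t = mu12 A x t + mu12 A 0 0"
  "scale4 (normalized A) = scale4 A" "diff4 (normalized A) = diff4 A" "mu31 (normalized A) = mu31 A"
  by (auto simp: normalized_def scale4_def mu31_def fun_eq_iff)

lemma double_mu12_zero: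
  assumes "is_dg_algebra4 A"
  shows "mu12 A 0 0 + mu12 A 0 0 = 0"
proof -
  interpret D: dg_algebra "scale4 A" piece4 "diff4 A" "mult4 A" unit4
    using assms by (simp add: is_dg_algebra4_def)
  show ?thesis
    using bilinear_map_laws(8)[OF D.mult_bilinear, of 0] module_laws(6)[OF is_dg_algebra4_imp_modules(3)[OF assms]]
    by (simp add: zero_prod_def mu21_def)
qed

lemma double_cancel:
  fixes e :: "'a::ab_group_add"
  assumes "e + e = 0"
  shows "x + e + (y + e) = x + y"
proof -
  have "x + e + (y + e) = x + y + (e + e)" by (simp only: ac_simps)
  then show ?thesis by (simp add: assms)
qed

lemma mult4_normalized:
  assumes "is_dg_algebra4 A"
  shows "mult4 (normalized A) = mult4 A"
proof -
  have "x + mu12 A 0 0 + (y + mu12 A 0 0) = x + y" for x y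
    using double_mu12_zero[OF assms] by (simp add: algebra_simps)
  then show ?thesis
    by (auto simp: fun_eq_iff mu21_def)
qed

lemma normalized_dga4:
  assumes "is_dg_algebra4 A" "mu13 A 0 0 = 0"
  shows "dga4 (normalized A)"
proof (rule is_dg_algebra4_imp_dga4)
  show "is_dg_algebra4 (normalized A)"
    using assms(1) by (simp add: is_dg_algebra4_def mult4_normalized[OF assms(1)])
  show "mu12 (normalized A) 0 0 = 0" using double_mu12_zero[OF assms(1)] by simp
qed (use assms in simp)

text \<open>The middle term of the addition formula for \<open>dpow\<close> of order 2 is s t. Hence
  polarising an identity that is quadratic in M_2 replaces \<open>\<gamma>\<close> by
  \<open>mu22\<close>.\<close>

lemma divided_square_add:
  assumes A: "is_dg_gamma_algebra4 A \<gamma>" and 0: "mu13 A 0 0 = 0"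
  shows "\<gamma> (s + t) = \<gamma> s + \<gamma> t + mu22 A s t"
proof -
  interpret D: dg_gamma_algebra "scale4 A" piece4 "diff4 A" "mult4 A" unit4 "dpow4 \<gamma>"
    using A by (simp add: is_dg_gamma_algebra4_def)
  have A': "is_dg_algebra4 A" unfolding is_dg_algebra4_def by (rule D.dg_algebra_axioms)
  interpret N: dga4 "normalized A" by (rule normalized_dga4[OF A' 0])
  have p: "(0, 0, t, 0, 0) \<in> piece4 2" for t by (simp add: piece4_def)
  have "dpow4 \<gamma> 2 ((0, 0, s, 0, 0) + (0, 0, t, 0, 0)) =
    (\<Sum>j\<le>2. mult4 (normalized A) (dpow4 \<gamma> j (0, 0, s, 0, 0)) (dpow4 \<gamma> (2 - j) (0, 0, t, 0, 0)))"
    unfolding mult4_normalized[OF A'] by (rule D.dpow_add[of 2]) (simp_all add: p)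
  moreover have "{..2::nat} = {0, 1, 2}" by auto
  ultimately show ?thesis
    using N.lin by (simp add: mu21_def mu31_def)
qed

text \<open>Passing to \<open>normalized M\<close> shifts the product F_1 \<times> F_2 by a constant
  whose double is 0, and this constant enters the total multiplication twice.\<close>

lemma big_from_small_normalized:
  assumes "is_dg_algebra4 (big_from_small K (normalized M) \<alpha> \<beta> r brK \<eta> X Xt)"
    and M: "is_dg_algebra4 M" and b3: "\<And>u v. be3 \<beta> (u + v) = be3 \<beta> u + be3 \<beta> v"
  defines "F \<equiv> big_from_small K M \<alpha> \<beta> r brK \<eta> X Xt"
    and "F' \<equiv> big_from_small K (normalized M) \<alpha> \<beta> r brK \<eta> X Xt"
  shows "scale4 F = scale4 F'" "diff4 F = diff4 F'" "mult4 F = mult4 F'"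
proof -
  let ?c = "mu12 M 0 0"
  note modules = is_dg_algebra4_imp_modules[OF M]
  note ml = module_laws[OF modules(3)]
  show "scale4 F = scale4 F'" "diff4 F = diff4 F'"
    by (simp_all add: F_def F'_def big_from_small_def scale4_def fun_eq_iff)
  have c: "?c + ?c = 0" by (rule double_mu12_zero[OF M])
  have d: "be3 \<beta> ?c + be3 \<beta> ?c = 0"
    using b3[of ?c ?c] b3[of 0 0] c by simp
  \<comment> \<open>The constants from \<theta>_1 \<alpha>_2(\<phi>_2) and \<alpha>_1(\<phi>_1)
    \<theta>_2 cancel; those under r and under \<beta>_3 remain.\<close>
  let ?e = "(- sc3 M r ?c, - be3 \<beta> ?c)"
  have e: "?e + ?e = 0"
  proof -
    have "- sc3 M r ?c + - sc3 M r ?c = - sc3 M r (?c + ?c)" by (simp only: ml(1) minus_add_distrib)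
    moreover have "- be3 \<beta> ?c + - be3 \<beta> ?c = - (be3 \<beta> ?c + be3 \<beta> ?c)" by (simp only: minus_add_distrib)
    ultimately show ?thesis unfolding c d ml(6) by (simp only: add_Pair zero_prod_def minus_zero)
  qed
  have 12: "mu12 F' x t = mu12 F x t + ?e" for x t
    by (cases x; cases t) (simp add: F_def F'_def big_from_small_def ml b3 algebra_simps)
  have 12: "a + mu12 F' x t + mu12 F' y s = a + mu12 F x t + mu12 F y s" for a x t y s
    unfolding 12 add.assoc[of a] by (subst double_cancel[OF e]) (rule refl)
  have o: "sc1 F' = sc1 F" "sc2 F' = sc2 F" "sc3 F' = sc3 F" "sc4 F' = sc4 F" "mu11 F' = mu11 F" "mu13 F' = mu13 F" "mu22 F' = mu22 F"
    by (simp_all add: F_def F'_def big_from_small_def)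
  show "mult4 F = mult4 F'"
  proof (intro ext)
    fix x y
    show "mult4 F x y = mult4 F' x y"
      by (cases x; cases y) (simp only: mult4.simps mu21_def mu31_def o 12)
  qed
qed

section \<open>Reading the hypotheses in homogeneous components, and conclusion\<close>

lemma is_alpha_laws:
  fixes K :: "('r::comm_ring_1, 'k1::ab_group_add, 'k2::ab_group_add, 'k3::ab_group_add) alg3"
    and M :: "('r, 'm1::ab_group_add, 'm2::ab_group_add, 'm3::ab_group_add, 'm4::ab_group_add) alg4"
  assumes alpha: "is_alpha K M \<alpha>" and K: "koszul K xs brK" and M: "is_dg_algebra4 M"
    and N: "dga4 (normalized M)"
  shows "module_hom (sc1 K) (sc1 M) (al1 \<alpha>)" "module_hom (sc2 K) (sc2 M) (al2 \<alpha>)" "module_hom (sc3 K) (sc3 M) (al3 \<alpha>)"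
    and "df1 M (al1 \<alpha> \<phi>) = df1 K \<phi>" "df2 M (al2 \<alpha> s) = al1 \<alpha> (df2 K s)" "df3 M (al3 \<alpha> v) = al2 \<alpha> (df3 K v)"
    and "al2 \<alpha> (mu11 K \<phi> \<psi>) = mu11 M (al1 \<alpha> \<phi>) (al1 \<alpha> \<psi>)"
      "al3 \<alpha> (mu12 K \<phi> s) = mu12 (normalized M) (al1 \<alpha> \<phi>) (al2 \<alpha> s)"
      "mu13 M (al1 \<alpha> \<phi>) (al3 \<alpha> v) = 0" "mu22 M (al2 \<alpha> s) (al2 \<alpha> s') = 0"
proof -
  interpret K: koszul K xs brK by (rule K)
  interpret N: dga4 "normalized M" by (rule N)
  let ?f = "\<lambda>(a, x1, x2, x3). (a, al1 \<alpha> x1, al2 \<alpha> x2, al3 \<alpha> x3, 0 :: 'm4)"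
  have hom: "module_hom (scale3 K) (scale4 M) ?f"
    and d: "\<And>x. ?f (diff3 K x) = diff4 M (?f x)"
    and mult: "\<And>x y. ?f (mult3 K x y) = mult4 (normalized M) (?f x) (?f y)"
    using alpha unfolding is_alpha_def dg_algebra_hom_def mult4_normalized[OF M] by blast+
  note fl = module_hom_laws[OF hom]
  have m: "module (sc1 M)" "module (sc2 M)" "module (sc3 M)" using N.modules by simp_all
  show h: "module_hom (sc1 K) (sc1 M) (al1 \<alpha>)" "module_hom (sc2 K) (sc2 M) (al2 \<alpha>)" "module_hom (sc3 K) (sc3 M) (al3 \<alpha>)"
    using fl(1)[of "(0, x1, x2, x3)" "(0, y1, y2, y3)" for x1 x2 x3 y1 y2 y3]
      fl(2)[of a "(0, x1, x2, x3)" for a x1 x2 x3]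
    by (intro module_homI m K.modules; simp add: scale3_def scale4_def)+
  note z = module_hom_laws[OF h(1)] module_hom_laws[OF h(2)] module_hom_laws[OF h(3)]
  show "df1 M (al1 \<alpha> \<phi>) = df1 K \<phi>" "df2 M (al2 \<alpha> s) = al1 \<alpha> (df2 K s)" "df3 M (al3 \<alpha> v) = al2 \<alpha> (df3 K v)"
    using d[of "(0, \<phi>, s, v)"] by simp_all
  note lin = N.lin[unfolded normalized_simps(1-11)] K.lin z mu21_def mu31_def
  show "al2 \<alpha> (mu11 K \<phi> \<psi>) = mu11 M (al1 \<alpha> \<phi>) (al1 \<alpha> \<psi>)"
    using mult[of "(0, \<phi>, 0, 0)" "(0, \<psi>, 0, 0)"] by (simp add: lin del: normalized_simps(12))
  show "al3 \<alpha> (mu12 K \<phi> s) = mu12 (normalized M) (al1 \<alpha> \<phi>) (al2 \<alpha> s)"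
    using mult[of "(0, \<phi>, 0, 0)" "(0, 0, s, 0)"] by (simp add: lin del: normalized_simps(12))
  show "mu13 M (al1 \<alpha> \<phi>) (al3 \<alpha> v) = 0"
    using mult[of "(0, \<phi>, 0, 0)" "(0, 0, 0, v)"]
    by (simp add: lin del: normalized_simps(12))
  show "mu22 M (al2 \<alpha> s) (al2 \<alpha> s') = 0"
    using mult[of "(0, 0, s, 0)" "(0, 0, s', 0)"] by (simp add: lin del: normalized_simps(12))
qed

theorem theorem5p1:
  fixes I \<aa> :: "'r::comm_ring_1 set"
    and M :: "('r, 'm1::ab_group_add, 'm2::ab_group_add, 'm3::ab_group_add, 'm4::ab_group_add) alg4"
    and \<gamma> :: "'m2 \<Rightarrow> 'm4"
    and K :: "('r, 'k1::ab_group_add, 'k2::ab_group_add, 'k3::ab_group_add) alg3"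
    and xs :: "'r list"
    and M11 M12 :: "'m1 set"
    and \<alpha> :: "('k1, 'k2, 'k3, 'm1, 'm2, 'm3) alpha_maps"
    and brK :: "'k3 \<Rightarrow> 'r" and brM :: "'m4 \<Rightarrow> 'r"
    and \<beta> :: "('r, 'k1, 'k2, 'k3, 'm1, 'm2, 'm3, 'm4) beta_maps"
    and B :: "('r, 'm1, 'm2, 'm3, 'e2::ab_group_add, 'e3::ab_group_add, 't12::ab_group_add,
               'u22::ab_group_add, 'd2::ab_group_add, 't13::ab_group_add, 'v12::ab_group_add,
               'u23::ab_group_add) complex_B"
    and c :: "('k1, 'k2, 'k3, 'm3, 'e3, 't12, 'u22, 'd2, 't13, 'v12, 'u23) c_maps"
    and h :: "('r, 'k1, 'k2, 'k3, 'm1, 'm2, 'm3, 'e2, 'e3, 't12, 'u22, 'd2, 't13) h_maps"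
    and X :: "'e2 \<Rightarrow> 'm2" and Xt :: "'t12 \<Rightarrow> 'm3"
    and \<eta> :: 'm4 and r :: 'r
  assumes noetherian: "noetherian_ring TYPE('r)"
    and perfect: "perfect_of_grade I 4"
    and M_gamma: "is_dg_gamma_algebra4 M \<gamma>"
    and M_duality: "has_poincare_duality4 M"
    and M_resolution: "resolves_quotient M I"
    and gorenstein: "ext4_isomorphic_quotient M I"
    and regular: "regular_sequence xs"
    and K_koszul: "koszul3 K xs"
    and \<aa>_def: "\<aa> = ideal_generated (set xs)"
    and \<aa>_subset: "\<aa> \<subseteq> I"
    and M1_decomp: "direct_sum_decomp (sc1 M) UNIV M11 M12"
    and M11_rank: "free_of_rank (sc1 M) M11 3"
    and M11_image: "df1 M ` M11 = \<aa>"
    and \<alpha>_hom: "is_alpha K M \<alpha>"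
    and \<alpha>1_image: "range (al1 \<alpha>) = M11"
    and orientation_K: "is_orientation (sc3 K) brK"
    and orientation_M: "is_orientation (sc4 M) brM"
    and \<beta>: "is_beta K M \<alpha> brK brM \<beta>"
    and B: "is_complex_B M B"
    and c: "is_c K M \<gamma> \<beta> B c"
    and h: "is_normalized_homotopy K M \<alpha> B c h"
    and X: "is_X M \<beta> B h X Xt"
    and \<eta>: "brM \<eta> = 1"
  defines "F \<equiv> big_from_small K M \<alpha> \<beta> r brK \<eta>
                 (\<lambda>\<theta> \<theta>'. X (wedge2 B \<theta> \<theta>')) (\<lambda>\<theta> \<theta>2. Xt (tenT12 B \<theta> \<theta>2))"
  shows "is_dg_algebra4 F \<and> has_poincare_duality4 F"
proof -
  let ?N = "normalized M"
  have M: "is_dg_algebra4 M"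
    using M_gamma unfolding is_dg_gamma_algebra4_def is_dg_algebra4_def dg_gamma_algebra_def by blast
  interpret K: koszul K xs brK by unfold_locales (rule K_koszul regular orientation_K)+
  note bK = orientation_laws[OF orientation_K] and bM = orientation_laws[OF orientation_M]
  have pairing: "brK (sc3 K (be1 \<beta> x) v) = brM (mu13 M x (al3 \<alpha> v))"
    "brK (mu12 K (be2 \<beta> t) s) = - brM (mu22 M t (al2 \<alpha> s))"
    "brK (mu12 K \<phi> (be3 \<beta> u)) = - brM (mu13 M (al1 \<alpha> \<phi>) u)" for x v t s \<phi> u
    using \<beta> by (simp_all add: is_beta_def mu21_def mu31_def bM)
  have pairing4: "brK (be4 \<beta> w) = - brM w" for w
  proof -
    have "brK (sc3 K 1 (be4 \<beta> w)) = - brM (sc4 M 1 w)"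
      using \<beta> by (simp add: is_beta_def)
    then show ?thesis
      by (simp add: module_laws[OF K.modules(3)] module_laws[OF is_dg_algebra4_imp_modules(4)[OF M]])
  qed
  \<comment> \<open>The total algebra leaves a constant in \<open>mu13\<close> undetermined. The
    equation defining \<beta>_1, evaluated at zero arguments, fixes it.\<close>
  have "mu13 M 0 0 = 0"
  proof -
    have "al3 \<alpha> 0 = 0"
      using \<alpha>_hom module_hom_laws(3)[of "scale3 K" "scale4 M" "\<lambda>(a, x1, x2, x3). (a, al1 \<alpha> x1, al2 \<alpha> x2, al3 \<alpha> x3, 0)"]
      by (simp add: is_alpha_def dg_algebra_hom_def zero_prod_def)
    then have "brM (mu13 M 0 0) = 0" using pairing(1)[of 0 0] by (simp add: bK module_laws[OF K.modules(3)])
    then show ?thesis using bM(6)[of "mu13 M 0 0" 0] by (simp add: bM(3))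
  qed
  note 0 = this
  have N: "dga4 ?N" by (rule normalized_dga4[OF M 0])
  interpret N: dga4 ?N by (rule N)
  have "has_poincare_duality4 ?N"
    using M_duality by (simp add: has_poincare_duality4_def mult4_normalized[OF M])
  note perfectN = N.has_poincare_duality4D[OF this _ K.nontrivial, of brM, simplified, OF orientation_M]
  note alpha = is_alpha_laws[OF \<alpha>_hom K.koszul_axioms M N]
  interpret S: small_map ?N K xs brK "al1 \<alpha>" "al2 \<alpha>" "al3 \<alpha>" "be1 \<beta>" "be2 \<beta>" "be3 \<beta>" "be4 \<beta>" brM \<eta>
    by (intro_locales, unfold small_map_axioms_def)
      (use orientation_M \<eta> perfectN alpha pairing pairing4 in simp)
  note Mlin = S.small_lin[unfolded normalized_simps(1-11)]
  have "is_exterior_square (sc1 M) (scE2 B) (wedge2 B)" "is_tensor_product (sc1 M) (sc2 M) (scT12 B) (tenT12 B)"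
    using B unfolding is_complex_B_def by blast+
  note E2 = exterior_square_alternating[OF this(1) N.modules(1)[unfolded normalized_simps(1)]]
    and T12 = tensor_product_bilinear[OF this(2) N.modules(1,2)[unfolded normalized_simps(1,2)]]
  have homs: "module_hom (scaleB4 M B) (sc3 K) (hh4 h)" "module_hom (scE2 B) (sc2 M) X" "module_hom (scT12 B) (sc3 M) Xt"
    using h X unfolding is_normalized_homotopy_def is_homotopy_def is_X_def by blast+
  note hl = module_hom_laws[OF homs(1)] and Xl = module_hom_laws[OF homs(2)] and Xtl = module_hom_laws[OF homs(3)]
  have hh4_0: "hh4 h (0, v, 0) = 0" "hh4 h (0, 0, w) = 0" for v w
    using h unfolding is_normalized_homotopy_def by blast+
  \<comment> \<open>As h_4 vanishes on D_2 M_2 and M_1 \<otimes> M_3, it depends only on the first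
    component; the other components of \<open>dB5\<close> drop out.\<close>
  have hh4_split: "hh4 h (p, v, w) = hh4 h (p, 0, 0)" for p v w
    using hl(1)[of "(p, 0, 0)" "(0, v, w)"] hl(1)[of "(0, v, 0)" "(0, 0, w)"] hh4_0 by simp
  have hh4_minus: "hh4 h (- p, v, w) = - hh4 h (p, 0, 0)" for p v w
    using hl(4)[of "(p, 0, 0)"] hh4_split[of "- p" v w] by simp
  have "surj (be4 \<beta>)"
  proof (rule surjI)
    fix v
    have "brM (inv brM (- brK v)) = - brK v"
      using orientation_M by (simp add: is_orientation_def bij_is_surj surj_f_inv_f)
    then have "brK (be4 \<beta> (inv brM (- brK v))) = brK v" by (simp add: pairing4)
    then show "be4 \<beta> (inv brM (- brK v)) = v" by (simp only: bK(6))
  qed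
  then have inv4: "be4 \<beta> (inv (be4 \<beta>) v) = v" for v by (rule surj_f_inv_f)
  have Xh: "be4 \<beta> (mu22 M (X (wedge2 B x y)) t) = hh4 h (tenU22 B (wedge2 B x y) t, 0, 0)" for x y t
    using X inv4 unfolding is_X_def by metis
  have X0: "mu22 M (X (wedge2 B x y)) t = 0" if "hh4 h (tenU22 B (wedge2 B x y) t, 0, 0) = 0" for x y t
    using S.b4_inject[of "mu22 M (X (wedge2 B x y)) t" 0] Xh[of x y t] that S.b4_lin(3) by simp
  have cc5: "hh4 h (dB5 B b) = cc5 c b" for b
    using h unfolding is_normalized_homotopy_def is_homotopy_def by metis
  have X_df3: "mu22 M (X (wedge2 B x y)) (df3 M u) =
      sc4 M (be1 \<beta> x) (mu13 M y u) - sc4 M (be1 \<beta> y) (mu13 M x u) + mu13 M (al1 \<alpha> (be2 \<beta> (mu11 M x y))) u" for x y u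
  proof -
    have "dB5 B (0, tenU23 B (wedge2 B x y) u) =
       (tenU22 B (wedge2 B x y) (df3 M u), 0,
        scT13 B (df1 M x) (tenT13 B y u) - scT13 B (df1 M y) (tenT13 B x u))"
      using B unfolding is_complex_B_def by blast
    moreover have "cc5 c (0, tenU23 B (wedge2 B x y) u) =
       - sc3 K (be1 \<beta> y) (be4 \<beta> (mu13 M x u)) + sc3 K (be1 \<beta> x) (be4 \<beta> (mu13 M y u))
         + mu12 K (be2 \<beta> (mu11 M x y)) (be3 \<beta> u)"
      using c unfolding is_c_def by blast
    ultimately have "be4 \<beta> (mu22 M (X (wedge2 B x y)) (df3 M u)) =
       - sc3 K (be1 \<beta> y) (be4 \<beta> (mu13 M x u)) + sc3 K (be1 \<beta> x) (be4 \<beta> (mu13 M y u))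
         + mu12 K (be2 \<beta> (mu11 M x y)) (be3 \<beta> u)"
      using cc5[of "(0, tenU23 B (wedge2 B x y) u)"] hh4_split unfolding Xh by metis
    also have "\<dots> = be4 \<beta> (sc4 M (be1 \<beta> x) (mu13 M y u) - sc4 M (be1 \<beta> y) (mu13 M x u) + mu13 M (al1 \<alpha> (be2 \<beta> (mu11 M x y))) u)"
      using S.b_product(3) by (simp add: Mlin)
    finally show ?thesis by (simp only: S.b4_inject)
  qed
  have diag: "be4 \<beta> (mu22 M (X (wedge2 B x (df2 M t))) t) =
      mu12 K (be2 \<beta> t) (be3 \<beta> (mu12 M x t)) - sc3 K (be1 \<beta> x) (be4 \<beta> (\<gamma> t))" for x t
  proof -
    have "dB5 B (tenV12 B x (divsq B t), 0) =
       (- tenU22 B (wedge2 B x (df2 M t)) t, scD2 B (df1 M x) (divsq B t), 0)"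
      using B unfolding is_complex_B_def by blast
    moreover have "cc5 c (tenV12 B x (divsq B t), 0) =
       sc3 K (be1 \<beta> x) (be4 \<beta> (\<gamma> t)) - mu21 K (be3 \<beta> (mu12 M x t)) (be2 \<beta> t)"
      using c unfolding is_c_def by blast
    ultimately have "- be4 \<beta> (mu22 M (X (wedge2 B x (df2 M t))) t) =
       sc3 K (be1 \<beta> x) (be4 \<beta> (\<gamma> t)) - mu12 K (be2 \<beta> t) (be3 \<beta> (mu12 M x t))"
      using cc5[of "(tenV12 B x (divsq B t), 0)"] by (simp add: Xh hh4_minus mu21_def)
    from arg_cong[OF this, of uminus] show ?thesis by simp
  qed
  \<comment> \<open>The map c is stated with \<open>mu12 M\<close>, not its normalised form.
    Evaluating \<open>diag\<close> at x = 0, where all other terms vanish, shows that the difference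
    of the two does not affect the formula.\<close>
  have c12: "mu12 K (be2 \<beta> t) (be3 \<beta> (mu12 M 0 0)) = 0" for t
  proof -
    have "mu12 ?N 0 t = 0" by (rule N.lin)
    then have "mu12 M 0 t = - mu12 M 0 0" by (simp add: eq_neg_iff_add_eq_0)
    then show ?thesis
      using diag[of 0 t] by (simp add: bilinear_map_laws[OF E2(1)] Xl Mlin del: normalized_simps(12))
  qed
  have diag: "mu22 M (X (wedge2 B x (df2 M t))) t =
      mu13 M (al1 \<alpha> (be2 \<beta> t)) (mu12 ?N x t) - sc4 M (be1 \<beta> x) (\<gamma> t)" for x t
  proof -
    note diag
    also have "mu12 K (be2 \<beta> t) (be3 \<beta> (mu12 M x t)) = mu12 K (be2 \<beta> t) (be3 \<beta> (mu12 ?N x t))"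
      by (simp add: module_hom_laws[OF S.b3_hom] K.lin c12)
    also have "\<dots> - sc3 K (be1 \<beta> x) (be4 \<beta> (\<gamma> t)) =
        be4 \<beta> (mu13 M (al1 \<alpha> (be2 \<beta> t)) (mu12 ?N x t) - sc4 M (be1 \<beta> x) (\<gamma> t))"
      using S.b_product(3) by (simp add: Mlin del: normalized_simps(12))
    finally show ?thesis by (simp only: S.b4_inject)
  qed
  \<comment> \<open>Subtracting \<open>diag\<close> at s and at t from \<open>diag\<close> at s + t
    eliminates \<open>\<gamma>\<close> by \<open>divided_square_add\<close>.\<close>
  have X_df2: "mu22 M (X (wedge2 B x (df2 M s))) t + mu22 M (X (wedge2 B x (df2 M t))) s =
      mu13 M (al1 \<alpha> (be2 \<beta> t)) (mu12 ?N x s) + mu13 M (al1 \<alpha> (be2 \<beta> s)) (mu12 ?N x t) - sc4 M (be1 \<beta> x) (mu22 M s t)" for x s t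
    using diag[of x "s + t"]
    by (simp add: Mlin bilinear_map_laws[OF E2(1)] Xl divided_square_add[OF M_gamma 0] diag algebra_simps
        del: normalized_simps(12))
  interpret big_small ?N K xs brK "al1 \<alpha>" "al2 \<alpha>" "al3 \<alpha>" "be1 \<beta>" "be2 \<beta>" "be3 \<beta>" "be4 \<beta>" brM \<eta> r
    "\<lambda>\<theta> \<theta>'. X (wedge2 B \<theta> \<theta>')" "\<lambda>\<theta> \<theta>2. Xt (tenT12 B \<theta> \<theta>2)"
  proof (intro_locales, unfold big_small_axioms_def normalized_simps(1-11), intro conjI allI)
    show "bilinear_map (sc1 M) (sc1 M) (sc2 M) (\<lambda>\<theta> \<theta>'. X (wedge2 B \<theta> \<theta>'))"
      using N.modules by (intro bilinear_mapI) (simp_all add: Xl bilinear_map_laws[OF E2(1)])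
    show "bilinear_map (sc1 M) (sc2 M) (sc3 M) (\<lambda>\<theta> \<theta>2. Xt (tenT12 B \<theta> \<theta>2))"
      using N.modules by (intro bilinear_mapI) (simp_all add: Xtl bilinear_map_laws[OF T12])
    show "X (wedge2 B x x) = 0" for x by (simp add: E2 Xl)
    show "mu13 M x (Xt (tenT12 B y t)) = mu22 M (X (wedge2 B x y)) t" for x y t
      using X unfolding is_X_def by simp
    show "mu22 M (X (wedge2 B x (al1 \<alpha> \<phi>))) t = 0" for x \<phi> t
      using h by (intro X0) (simp add: is_normalized_homotopy_def)
    show "mu22 M (X (wedge2 B x y)) (al2 \<alpha> s) = 0" for x y s
      using h by (intro X0) (simp add: is_normalized_homotopy_def)
    show "mu22 M (X (wedge2 B x y)) (mu11 M (al1 \<alpha> \<phi>) x) = 0" for x y \<phi>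
      using h by (intro X0) (simp add: is_normalized_homotopy_def)
    show "mu22 M (X (wedge2 B x (df2 M s))) t + mu22 M (X (wedge2 B x (df2 M t))) s =
      mu13 M (al1 \<alpha> (be2 \<beta> t)) (mu12 ?N x s) + mu13 M (al1 \<alpha> (be2 \<beta> s)) (mu12 ?N x t) - sc4 M (be1 \<beta> x) (mu22 M s t)" for x s t
      by (rule X_df2)
  qed (rule X_df3)
  \<comment> \<open>F' is built from the normalised algebra, to which
    \<open>big_poincare_algebra\<close> applies; F has the same total scalar multiplication,
    differential and product.\<close>
  define F' where "F' = big_from_small K ?N \<alpha> \<beta> r brK \<eta> (\<lambda>\<theta> \<theta>'. X (wedge2 B \<theta> \<theta>')) (\<lambda>\<theta> \<theta>2. Xt (tenT12 B \<theta> \<theta>2))"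
  have "F' = big" unfolding F'_def big_def by (cases \<alpha>; cases \<beta>) simp
  then have F': "is_dg_algebra4 F'" "has_poincare_duality4 F'" using big_poincare_algebra by simp_all
  have "scale4 F = scale4 F'" "diff4 F = diff4 F'" "mult4 F = mult4 F'"
    using big_from_small_normalized[OF F'(1)[unfolded F'_def] M] module_hom_laws(1)[OF S.b3_hom]
    unfolding F_def F'_def by blast+
  then show ?thesis using F' unfolding is_dg_algebra4_def has_poincare_duality4_def by simp
qed

end
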